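(* Let $K>1$. Then the $\mathbb C[\epsilon_1,\epsilon_2^{\pm1},\epsilon_3^{\pm1}]$-algebra $\mathsf A^{(K)}[\epsilon_2^{-1},\epsilon_3^{-1}]$ is generated over $\mathbb C[\epsilon_1,\epsilon_2^{\pm1},\epsilon_3^{\pm1}]$ by $\{\mathsf T_{1,0}(X),\mathsf T_{0,n}(X): X\in\mathfrak{gl}_K,n\in\mathbb N\}$ and $\{\mathsf t_{2,0},\mathsf t_{1,1},\mathsf t_{0,2}\}$ with the following defining relations (for all $X,Y\in\mathfrak{gl}_K$): (A0') $\mathsf T_{0,2}(1)=\epsilon_2\mathsf t_{0,2}$, and $\mathsf T_{n,m}(aX+bY)=a\mathsf T_{n,m}(X)+b\mathsf T_{n,m}(Y)$ for all $a,b\in\mathbb C$ and all $(n,m)\in\{(1,0)\}\sqcup\{(0,k):k\in\mathbb N\}$; (A1') $[\mathsf T_{0,m}(X),\mathsf T_{0,n}(Y)]=\mathsf T_{0,m+n}([X,Y])$ for all $m,n\in\mathbb N$; (A2') for $(p,q)=(2,0)$ or $(0,2)$, all $(m,n)\in\mathbb N^2$ with $m+n=2$ and all $(r,s)\in\mathbb N^2$ with $r+s\le1$: $[\mathsf t_{p,q},\mathsf t_{n,m}]=(mp-nq)\mathsf t_{p+n-1,q+m-1}$ and $[\mathsf t_{p,q},\mathsf T_{r,s}(X)]=(ps-rq)\mathsf T_{p+r-1,q+s-1}(X)$; (A3') for all $n\in\mathbb N$: $[\mathsf T_{1,0}(X),\mathsf T_{0,n}(Y)]=\frac{1}{2n+2}[\mathsf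 t_{2,0},\mathsf T_{0,n+1}([X,Y])]-\frac{\epsilon_3n}{2}\mathsf T_{0,n-1}(\{X,Y\})-n\epsilon_1\mathrm{tr}(Y)\mathsf T_{0,n-1}(X)+\epsilon_1\sum_{m=0}^{n-1}\frac{m+1}{n+1}\mathsf T_{0,m,0,n-1-m}(([X,Y]\otimes1)\cdot\Omega)+\epsilon_1\sum_{m=0}^{n-1}\mathsf T_{0,m,0,n-1-m}((X\otimes Y-XY\otimes1)\cdot\Omega)$.
   Context: Let $\mathbb N=\{0,1,2,\dots\}$, $\mathfrak{gl}_K$ the algebra of complex $K\times K$ matrices with elementary matrices $E^a_b$ (so $E^a_bE^c_d=\delta^c_bE^a_d$), $\{X,Y\}=XY+YX$, $\Omega=\sum_{a,b}E^a_b\otimes E^b_a$. Put $\epsilon_3=-K\epsilon_1-\epsilon_2$. Terms with coefficient $0$ are omitted even if an index is negative; $\mathsf T_{u,r,t,s}(X\otimes Y):=\mathsf T_{u,r}(X)\mathsf T_{t,s}(Y)$, extended linearly to $\mathfrak{gl}_K^{\otimes2}$. $\mathsf A^{(K)}$ is the unital associative $\mathbb C[\epsilon_1,\epsilon_2]$-algebra generated by $\mathsf T_{n,m}(X),\mathsf t_{n,m}$ ($X\in\mathfrak{gl}_K$, $(n,m)\in\mathbb N^2$) with the following relations for all $X,Y\in\mathfrak{gl}_K$ and all indices in $\mathbb N$: (A0) $\mathsf T_{n,m}(1)=\epsilon_2\mathsf t_{n,m}$, $\mathsf T_{n,m}(aX+bY)=a\mathsf T_{n,m}(X)+b\mathsf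 T_{n,m}(Y)$ for $a,b\in\mathbb C$; (A1) $[\mathsf T_{0,0}(X),\mathsf T_{0,n}(Y)]=\mathsf T_{0,n}([X,Y])$, $[\mathsf T_{0,0}(X),\mathsf t_{0,n}]=0$; (A2) for $p+q\le2$: $[\mathsf t_{p,q},\mathsf T_{n,m}(X)]=(mp-nq)\mathsf T_{p+n-1,q+m-1}(X)$, $[\mathsf t_{p,q},\mathsf t_{n,m}]=(mp-nq)\mathsf t_{p+n-1,q+m-1}$; (A3) $[\mathsf T_{1,0}(X),\mathsf T_{0,n}(Y)]=\mathsf T_{1,n}([X,Y])-\frac{\epsilon_3n}{2}\mathsf T_{0,n-1}(\{X,Y\})-n\epsilon_1\mathrm{tr}(Y)\mathsf T_{0,n-1}(X)+\epsilon_1\sum_{m=0}^{n-1}\frac{m+1}{n+1}\mathsf T_{0,m,0,n-1-m}(([X,Y]\otimes1)\cdot\Omega)+\epsilon_1\sum_{m=0}^{n-1}\mathsf T_{0,m,0,n-1-m}((X\otimes Y-XY\otimes1)\cdot\Omega)$, and $[\mathsf T_{1,0}(X),\mathsf t_{0,n}]=n\mathsf T_{0,n-1}(X)$; (A4) for $n\ge3$: $[\mathsf t_{3,0},\mathsf t_{0,n}]=3n\,\mathsf t_{2,n-1}+\frac{n(n-1)(n-2)}{4}(\epsilon_1^2-\epsilon_2\epsilon_3)\mathsf t_{0,n-3}-\frac{3\epsilon_1}{2}\sum_{m=0}^{n-3}(m+1)(n-2-m)\big(\mathsf T_{0,m,0,n-3-m}(\Omega)+\epsilon_1\epsilon_2\mathsf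 t_{0,m}\mathsf t_{0,n-3-m}\big)$. The generators in the claim are the elements of $\mathsf A^{(K)}$ with the same names. *)

theory Defs
  imports
    "HOL-Analysis.Analysis"
    "HOL-Library.Poly_Mapping"
    "HOL-Computational_Algebra.Polynomial"
    "HOL-Computational_Algebra.Fraction_Field"
begin

section \<open>Algebras given by generators and relations\<close>

text \<open>Words form the free monoid, written additively because that is what the multiplication
  of \<^typ>\<open>'a \<Rightarrow>\<^sub>0 'b\<close> convolves along.\<close>

datatype 'g fmonoid = Word (letters: "'g list")

instantiation fmonoid :: (type) monoid_add
begin
definition zero_fmonoid :: "'a fmonoid" where "0 = Word []"
definition plus_fmonoid :: "'a fmonoid \<Rightarrow> 'a fmonoid \<Rightarrow> 'a fmonoid"
  where "u + v = Word (letters u @ letters v)"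
instance
  by standard (simp_all add: zero_fmonoid_def plus_fmonoid_def)
end

lemma letters_simps [simp]:
  "letters 0 = []" "letters (u + v) = letters u @ letters v"
  by (simp_all add: zero_fmonoid_def plus_fmonoid_def)

text \<open>The free associative unital algebra over \<open>'r\<close> on the set of generators \<open>'g\<close>.\<close>

type_synonym ('g, 'r) falg = "'g fmonoid \<Rightarrow>\<^sub>0 'r"

definition scal :: "'r::comm_ring_1 \<Rightarrow> ('g, 'r) falg"
  where "scal c = Poly_Mapping.single 0 c"

definition gen :: "'g \<Rightarrow> ('g, 'r::comm_ring_1) falg"
  where "gen g = Poly_Mapping.single (Word [g]) 1"

lemma scal_simps [simp]:
  "scal 0 = 0" "scal 1 = 1" "scal (a + b) = scal a + scal b" "scal (a - b) = scal a - scal b"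
  "scal (- a) = - scal a" "scal (a * b) = scal a * scal b"
  by (simp_all add: scal_def single_add single_diff single_uminus mult_single)

definition two_sided_ideal :: "'a::ring_1 set \<Rightarrow> bool"
  where "two_sided_ideal I \<longleftrightarrow>
    0 \<in> I \<and> (\<forall>x\<in>I. \<forall>y\<in>I. x + y \<in> I) \<and> (\<forall>x\<in>I. \<forall>a. a * x \<in> I \<and> x * a \<in> I)"

definition ideal_of :: "('a::ring_1 \<Rightarrow> 'a \<Rightarrow> bool) \<Rightarrow> 'a set"
  where "ideal_of rel = two_sided_ideal hull {x - y | x y. rel x y}"

lemma two_sided_ideal_ideal_of: "two_sided_ideal (ideal_of rel)"
  unfolding ideal_of_def by (rule hull_in) (auto simp: two_sided_ideal_def)

lemma ideal_of_closed:
  shows ideal_of_0 [simp]: "0 \<in> ideal_of rel"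
    and ideal_of_add: "x \<in> ideal_of rel \<Longrightarrow> y \<in> ideal_of rel \<Longrightarrow> x + y \<in> ideal_of rel"
    and ideal_of_mult_left: "x \<in> ideal_of rel \<Longrightarrow> a * x \<in> ideal_of rel"
    and ideal_of_mult_right: "x \<in> ideal_of rel \<Longrightarrow> x * a \<in> ideal_of rel"
  using two_sided_ideal_ideal_of[of rel] by (auto simp: two_sided_ideal_def)

lemma ideal_of_uminus: "x \<in> ideal_of rel \<Longrightarrow> - x \<in> ideal_of rel"
  using ideal_of_mult_left[of x rel "-1"] by simp

lemma ideal_of_diff: "x \<in> ideal_of rel \<Longrightarrow> y \<in> ideal_of rel \<Longrightarrow> x - y \<in> ideal_of rel"
  using ideal_of_add[of x rel "- y"] ideal_of_uminus[of y rel] by simp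

lemma ideal_of_rel: "rel x y \<Longrightarrow> x - y \<in> ideal_of rel"
  unfolding ideal_of_def by (rule hull_inc) auto

lemma ideal_of_minimal:
  assumes "two_sided_ideal I" "\<And>x y. rel x y \<Longrightarrow> x - y \<in> I"
  shows "ideal_of rel \<subseteq> I"
  unfolding ideal_of_def using assms by (intro hull_minimal) auto

lemma falg_decomp:
  "(f :: ('g, 'r::comm_ring_1) falg) =
    (\<Sum>w\<in>Poly_Mapping.keys f. Poly_Mapping.single w (Poly_Mapping.lookup f w))"
  by (rule poly_mapping_eqI)
    (auto simp: lookup_sum lookup_single when_def in_keys_iff)

text \<open>The homomorphism out of the free algebra that sends the generator \<open>g\<close> to \<open>e g\<close>,
  where \<open>\<iota>\<close> is the structure map of the target algebra.\<close>

definition free_eval :: "('r::comm_ring_1 \<Rightarrow> 'a::ring_1) \<Rightarrow> ('g \<Rightarrow> 'a) \<Rightarrow> ('g, 'r) falg \<Rightarrow> 'a"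
  where "free_eval \<iota> e f =
    (\<Sum>w\<in>Poly_Mapping.keys f. \<iota> (Poly_Mapping.lookup f w) * prod_list (map e (letters w)))"

definition structure_map :: "('r::comm_ring_1 \<Rightarrow> 'a::ring_1) \<Rightarrow> bool"
  where "structure_map \<iota> \<longleftrightarrow>
    \<iota> 1 = 1 \<and> (\<forall>x y. \<iota> (x + y) = \<iota> x + \<iota> y) \<and> (\<forall>x y. \<iota> (x * y) = \<iota> x * \<iota> y) \<and>
    (\<forall>x a. \<iota> x * a = a * \<iota> x)"

text \<open>The \<open>'r\<close>-algebra \<open>'a\<close> with structure map \<open>\<iota>\<close> is generated by the family \<open>e\<close>,
  with defining relations \<open>rel\<close>.\<close>

definition presented_by ::
    "('r::comm_ring_1 \<Rightarrow> 'a::ring_1) \<Rightarrow> ('g \<Rightarrow> 'a) \<Rightarrow>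
     (('g, 'r) falg \<Rightarrow> ('g, 'r) falg \<Rightarrow> bool) \<Rightarrow> bool"
  where "presented_by \<iota> e rel \<longleftrightarrow>
    structure_map \<iota> \<and> surj (free_eval \<iota> e) \<and> {f. free_eval \<iota> e f = 0} = ideal_of rel"

lemma structure_map_0: "structure_map \<iota> \<Longrightarrow> \<iota> 0 = 0"
  unfolding structure_map_def by (metis add_cancel_right_right)

lemma free_eval_superset:
  assumes "\<iota> 0 = 0" "finite A" "Poly_Mapping.keys f \<subseteq> A"
  shows "free_eval \<iota> e f =
    (\<Sum>w\<in>A. \<iota> (Poly_Mapping.lookup f w) * prod_list (map e (letters w)))"
  unfolding free_eval_def using assms
  by (intro sum.mono_neutral_left) (auto simp: in_keys_iff)

context
  fixes \<iota> :: "'r::comm_ring_1 \<Rightarrow> 'a::ring_1" and e :: "'g \<Rightarrow> 'a"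
  assumes sm: "structure_map \<iota>"
begin

lemma free_eval_0: "free_eval \<iota> e 0 = 0"
  by (simp add: free_eval_def)

lemma free_eval_add: "free_eval \<iota> e (f + g) = free_eval \<iota> e f + free_eval \<iota> e g"
proof -
  let ?A = "Poly_Mapping.keys f \<union> Poly_Mapping.keys g"
  have "Poly_Mapping.keys (f + g) \<subseteq> ?A" by (rule keys_add)
  then show ?thesis
    using sm free_eval_superset[where \<iota> = \<iota> and A = ?A, OF structure_map_0[OF sm]]
    by (simp add: lookup_add structure_map_def distrib_left distrib_right sum.distrib)
qed

lemma free_eval_sum: "free_eval \<iota> e (sum F A) = (\<Sum>x\<in>A. free_eval \<iota> e (F x))"
  by (induction A rule: infinite_finite_induct) (simp_all add: free_eval_0 free_eval_add)

lemma free_eval_uminus: "free_eval \<iota> e (- f) = - free_eval \<iota> e f"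
  using free_eval_add[of f "- f"] by (simp add: free_eval_0 minus_unique)

lemma free_eval_diff: "free_eval \<iota> e (f - g) = free_eval \<iota> e f - free_eval \<iota> e g"
  using free_eval_add[of f "- g"] by (simp add: free_eval_uminus)

lemma free_eval_single:
  "free_eval \<iota> e (Poly_Mapping.single w c) = \<iota> c * prod_list (map e (letters w))"
  using free_eval_superset[where \<iota> = \<iota> and A = "{w}" and f = "Poly_Mapping.single w c",
      OF structure_map_0[OF sm]]
  by simp

lemma free_eval_mult: "free_eval \<iota> e (f * g) = free_eval \<iota> e f * free_eval \<iota> e g"
proof -
  have *: "free_eval \<iota> e (Poly_Mapping.single u c * Poly_Mapping.single v d) =
      free_eval \<iota> e (Poly_Mapping.single u c) * free_eval \<iota> e (Poly_Mapping.single v d)" for u v c d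
  proof -
    define P Q where "P = prod_list (map e (letters u))" and "Q = prod_list (map e (letters v))"
    have "\<iota> (c * d) = \<iota> c * \<iota> d" and "\<iota> d * P = P * \<iota> d"
      using sm unfolding structure_map_def by blast+
    then have "\<iota> (c * d) * (P * Q) = (\<iota> c * P) * (\<iota> d * Q)"
      by (metis mult.assoc)
    then show ?thesis by (simp add: mult_single free_eval_single P_def Q_def)
  qed
  have "free_eval \<iota> e (sum F A * sum G B) = free_eval \<iota> e (sum F A) * free_eval \<iota> e (sum G B)"
    if "\<And>u v. free_eval \<iota> e (F u * G v) = free_eval \<iota> e (F u) * free_eval \<iota> e (G v)"
    for F G :: "'g fmonoid \<Rightarrow> ('g, 'r) falg" and A B
    by (simp add: sum_product free_eval_sum that)
  from this[of "\<lambda>w. Poly_Mapping.single w (Poly_Mapping.lookup f w)"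
      "\<lambda>w. Poly_Mapping.single w (Poly_Mapping.lookup g w)", OF *,
      of "Poly_Mapping.keys f" "Poly_Mapping.keys g"]
  show ?thesis by (simp only: flip: falg_decomp)
qed

lemma free_eval_scal: "free_eval \<iota> e (scal c) = \<iota> c"
  by (simp add: scal_def free_eval_single)

lemma free_eval_1: "free_eval \<iota> e 1 = 1"
  using free_eval_scal[of 1] sm by (simp add: structure_map_def)

lemma free_eval_gen: "free_eval \<iota> e (gen g) = e g"
  using sm by (simp add: gen_def free_eval_single structure_map_def)

lemmas free_eval_simps = free_eval_0 free_eval_1 free_eval_add free_eval_diff free_eval_uminus
  free_eval_mult free_eval_sum free_eval_scal free_eval_gen

end

lemma scal_central: "scal c * f = f * (scal c :: ('g, 'r::comm_ring_1) falg)"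
proof -
  have *: "scal c * Poly_Mapping.single w d = Poly_Mapping.single w d * scal c"
    for w :: "'g fmonoid" and d
    by (simp add: scal_def mult_single mult.commute)
  show ?thesis
    by (subst (1 2) falg_decomp) (simp add: sum_distrib_left sum_distrib_right *)
qed


section \<open>Matrices\<close>

definition mscale :: "complex \<Rightarrow> complex^'k^'k \<Rightarrow> complex^'k^'k"
  where "mscale c X = (\<chi> i j. c * X $ i $ j)"

definition mcomm :: "complex^'k^'k \<Rightarrow> complex^'k^'k \<Rightarrow> complex^'k^'k"
  where "mcomm X Y = X ** Y - Y ** X"

definition macomm :: "complex^'k^'k \<Rightarrow> complex^'k^'k \<Rightarrow> complex^'k^'k"
  where "macomm X Y = X ** Y + Y ** X"

definition elemM :: "'k \<Rightarrow> 'k \<Rightarrow> complex^'k^'k"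
  where "elemM a b = (\<chi> i j. if i = a \<and> j = b then 1 else 0)"

text \<open>The algebra \<open>gl_K \<otimes> gl_K\<close> is identified with the matrices indexed by pairs, a pure tensor
  being the Kronecker product; the product is then matrix multiplication.\<close>

definition kron :: "complex^'k^'k \<Rightarrow> complex^'k^'k \<Rightarrow> complex^('k \<times> 'k)^('k \<times> 'k)"
  where "kron X Y = (\<chi> p q. X $ fst p $ fst q * Y $ snd p $ snd q)"

definition Omega :: "complex^('k::finite \<times> 'k)^('k \<times> 'k)"
  where "Omega = (\<Sum>a\<in>UNIV. \<Sum>b\<in>UNIV. kron (elemM a b) (elemM b a))"

lemma elemM_mult:
  "elemM a b ** elemM c d = (if c = b then elemM a d else (0 :: complex^'k::finite^'k))"
  by (auto simp: vec_eq_iff elemM_def matrix_matrix_mult_def if_distrib[of "\<lambda>x. x * _"]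
      if_distribR sum.delta cong: if_cong)

lemma kron_mult: "kron X Y ** kron X' Y' = kron (X ** X') (Y ** Y' :: complex^'k::finite^'k)"
  unfolding vec_eq_iff kron_def matrix_matrix_mult_def
  by (simp add: sum_product sum.cartesian_product case_prod_beta mult_ac flip: UNIV_Times_UNIV)

text \<open>The linear map with \<open>X \<otimes> Y \<mapsto> f X * g Y\<close> for linear \<open>f\<close>, \<open>g\<close>. It is written through the basis
  of elementary tensors, so that it also makes sense in a free algebra, where the generators
  \<open>T n m X\<close> are not linear in \<open>X\<close> before the relations are imposed.\<close>

definition tens :: "(complex \<Rightarrow> 'a::ring_1) \<Rightarrow> (complex^'k^'k \<Rightarrow> 'a) \<Rightarrow> (complex^'k^'k \<Rightarrow> 'a) \<Rightarrow>
    complex^('k::finite \<times> 'k)^('k \<times> 'k) \<Rightarrow> 'a"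
  where "tens c f g Z = (\<Sum>a1\<in>UNIV. \<Sum>b1\<in>UNIV. \<Sum>a2\<in>UNIV. \<Sum>b2\<in>UNIV.
    c (Z $ (a1, a2) $ (b1, b2)) * (f (elemM a1 b1) * g (elemM a2 b2)))"

lemma mat_decomp:
  "(X :: complex^'k::finite^'k) = (\<Sum>a\<in>UNIV. \<Sum>b\<in>UNIV. mscale (X $ a $ b) (elemM a b))"
proof -
  have "(\<Sum>a\<in>UNIV. \<Sum>b\<in>UNIV. mscale (X $ a $ b) (elemM a b)) $ i $ j = X $ i $ j" for i j
  proof -
    have inner: "(\<Sum>b\<in>UNIV. X $ a $ b * (if i = a \<and> j = b then 1 else 0)) =
        (if a = i then X $ i $ j else 0)" for a
      by (cases "a = i") (auto simp: if_distrib[of "\<lambda>x. _ * x"] cong: if_cong)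
    show ?thesis by (simp add: mscale_def elemM_def inner)
  qed
  then show ?thesis by (simp add: vec_eq_iff)
qed

lemma tens_kron:
  fixes c :: "complex \<Rightarrow> 'a::ring_1" and X Y :: "complex^'k::finite^'k"
  assumes c: "structure_map c"
    and f: "\<And>x y X Y. f (mscale x X + mscale y Y) = c x * f X + c y * f Y"
    and g: "\<And>x y X Y. g (mscale x X + mscale y Y) = c x * g X + c y * g Y"
  shows "tens c f g (kron X Y) = f X * g Y"
proof -
  have lin: "h X = (\<Sum>a\<in>UNIV. \<Sum>b\<in>UNIV. c (X $ a $ b) * h (elemM a b))"
    if h: "\<And>x y X Y. h (mscale x X + mscale y Y) = c x * h X + c y * h Y"
    for h and X :: "complex^'k^'k"
  proof -
    have ms: "mscale 1 X = X" "mscale 0 X = 0" for X :: "complex^'k^'k"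
      by (simp_all add: mscale_def vec_eq_iff)
    have c01: "c 0 = 0" "c 1 = 1"
      using c structure_map_0[OF c] by (auto simp: structure_map_def)
    have sc: "h (mscale x X) = c x * h X" for x X
      using h[of x X 0 0] by (simp add: ms c01)
    have ad: "h (X + Y) = h X + h Y" for X Y
      using h[of 1 X 1 Y] by (simp add: ms c01)
    have z: "h 0 = 0" using sc[of 0 0] by (simp add: ms c01)
    have su: "h (sum F A) = (\<Sum>x\<in>A. h (F x))" for F :: "'k \<Rightarrow> complex^'k^'k" and A
      by (induction A rule: infinite_finite_induct) (simp_all add: z ad)
    show ?thesis by (subst mat_decomp) (simp add: su sc)
  qed
  have cm: "c (x * y) * (u * v) = (c x * u) * (c y * v)" for x y u v
    using c unfolding structure_map_def by (metis mult.assoc)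
  show ?thesis
    unfolding tens_def lin[OF f, of X] lin[OF g, of Y] sum_distrib_right
    unfolding sum_distrib_left by (simp add: kron_def cm)
qed


section \<open>The ground rings\<close>

text \<open>\<open>\<complex>[\<epsilon>\<^sub>1, \<epsilon>\<^sub>2]\<close> is \<open>\<complex>[\<epsilon>\<^sub>1][\<epsilon>\<^sub>2]\<close>; the size \<open>K\<close> of the matrices is \<^term>\<open>CARD('k)\<close>.\<close>

type_synonym base = "complex poly poly"

definition cst :: "complex \<Rightarrow> base" where "cst c = [:[:c:]:]"
definition eps1 :: base where "eps1 = [:[:0, 1:]:]"
definition eps2 :: base where "eps2 = [:0, 1:]"
definition eps3 :: "'k::finite itself \<Rightarrow> base"
  where "eps3 _ = - of_nat CARD('k) * eps1 - eps2"

text \<open>The multiplicative set of all \<open>\<epsilon>\<^sub>2\<^sup>i \<epsilon>\<^sub>3\<^sup>j\<close>, parametrised by \<open>(i, j)\<close>.\<close>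

definition den :: "'k::finite itself \<Rightarrow> nat \<times> nat \<Rightarrow> base"
  where "den K d = eps2 ^ fst d * eps3 K ^ snd d"

lemma den_add: "den K (d + d') = den K d * den K d'"
  by (simp add: den_def power_add mult_ac)

lemma den_0 [simp]: "den K 0 = 1"
  by (simp add: den_def)

lemma den_nonzero [simp]: "den K d \<noteq> 0"
proof -
  have "coeff (eps3 K) 1 = -1"
    by (simp add: eps3_def eps1_def eps2_def of_nat_poly)
  then have "eps3 K \<noteq> 0" by auto
  moreover have "eps2 \<noteq> 0" by (simp add: eps2_def)
  ultimately show ?thesis by (simp add: den_def)
qed

text \<open>\<open>\<complex>[\<epsilon>\<^sub>1, \<epsilon>\<^sub>2\<^sup>\<plusminus>\<^sup>1, \<epsilon>\<^sub>3\<^sup>\<plusminus>\<^sup>1]\<close>, as a subring of \<open>\<complex>(\<epsilon>\<^sub>1, \<epsilon>\<^sub>2)\<close>.\<close>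

typedef (overloaded) ('k::finite) laurent =
  "{Fract p (den TYPE('k) d) | p d. True} :: base fract set"
  morphisms to_fract of_fract
  by auto

lifting_forget poly.lifting
setup_lifting type_definition_laurent

instantiation laurent :: (finite) comm_ring_1
begin

lift_definition zero_laurent :: "'a laurent" is 0
  by (auto simp: Zero_fract_def eq_fract intro!: exI[of _ 0])
lift_definition one_laurent :: "'a laurent" is 1
  by (rule exI[of _ 1], rule exI[of _ "0 :: nat \<times> nat"]) (simp add: One_fract_def)
lift_definition plus_laurent :: "'a laurent \<Rightarrow> 'a laurent \<Rightarrow> 'a laurent" is "(+)"
  by (clarsimp simp: add_fract simp flip: den_add) blast
lift_definition minus_laurent :: "'a laurent \<Rightarrow> 'a laurent \<Rightarrow> 'a laurent" is "(-)"
  by (clarsimp simp: diff_fract simp flip: den_add) blast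
lift_definition uminus_laurent :: "'a laurent \<Rightarrow> 'a laurent" is uminus
  by clarsimp (auto simp: minus_fract)
lift_definition times_laurent :: "'a laurent \<Rightarrow> 'a laurent \<Rightarrow> 'a laurent" is "(*)"
  by (clarsimp simp: mult_fract simp flip: den_add) blast

instance
  by standard (transfer; simp add: algebra_simps)+

end

lift_definition lfrac :: "base \<Rightarrow> nat \<times> nat \<Rightarrow> ('k::finite) laurent"
  is "\<lambda>p d. Fract p (den TYPE('k) d)"
  by auto

definition of_base :: "base \<Rightarrow> ('k::finite) laurent"
  where "of_base p = lfrac p 0"


section \<open>The algebra \<open>A\<^sup>(\<^sup>K\<^sup>)\<close>\<close>

definition comm :: "'a::ring_1 \<Rightarrow> 'a \<Rightarrow> 'a"
  where "comm x y = x * y - y * x"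

datatype 'k dgen = Gen_T nat nat "complex^'k^'k" | Gen_t nat nat

abbreviation fT :: "nat \<Rightarrow> nat \<Rightarrow> complex^'k^'k \<Rightarrow> ('k::finite dgen, base) falg"
  where "fT n m X \<equiv> gen (Gen_T n m X)"

abbreviation ft :: "nat \<Rightarrow> nat \<Rightarrow> ('k::finite dgen, base) falg"
  where "ft n m \<equiv> gen (Gen_t n m)"

text \<open>An index computed with a truncated subtraction occurs with a nonzero coefficient only when
  the subtraction is exact.\<close>

inductive dca_rel :: "('k::finite dgen, base) falg \<Rightarrow> ('k dgen, base) falg \<Rightarrow> bool"
    (infix \<open>\<approx>A\<close> 50) where
  A0_unit: "fT n m (mat 1) \<approx>A scal eps2 * ft n m"
| A0_lin: "fT n m (mscale a X + mscale b Y) \<approx>A scal (cst a) * fT n m X + scal (cst b) * fT n m Y"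
| A1_T: "comm (fT 0 0 X) (fT 0 n Y) \<approx>A fT 0 n (mcomm X Y)"
| A1_t: "comm (fT 0 0 X) (ft 0 n) \<approx>A 0"
| A2_T: "p + q \<le> 2 \<Longrightarrow> comm (ft p q) (fT n m X) \<approx>A
    of_int (int m * int p - int n * int q) * fT (p + n - 1) (q + m - 1) X"
| A2_t: "p + q \<le> 2 \<Longrightarrow> comm (ft p q) (ft n m) \<approx>A
    of_int (int m * int p - int n * int q) * ft (p + n - 1) (q + m - 1)"
| A3_T: "comm (fT 1 0 X) (fT 0 n Y) \<approx>A
    fT 1 n (mcomm X Y)
    - scal (eps3 TYPE('k) * cst (of_nat n / 2)) * fT 0 (n - 1) (macomm X Y)
    - scal (of_nat n * eps1 * cst (trace Y)) * fT 0 (n - 1) X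
    + scal eps1 * (\<Sum>m<n. scal (cst (of_nat (m + 1) / of_nat (n + 1))) *
        tens (\<lambda>c. scal (cst c)) (fT 0 m) (fT 0 (n - 1 - m)) (kron (mcomm X Y) (mat 1) ** Omega))
    + scal eps1 * (\<Sum>m<n.
        tens (\<lambda>c. scal (cst c)) (fT 0 m) (fT 0 (n - 1 - m))
          ((kron X Y - kron (X ** Y) (mat 1)) ** Omega))"
| A3_t: "comm (fT 1 0 X) (ft 0 n) \<approx>A of_nat n * fT 0 (n - 1) X"
| A4: "3 \<le> n \<Longrightarrow> comm (ft 3 0) (ft 0 n) \<approx>A
    of_nat (3 * n) * ft 2 (n - 1)
    + scal (cst (of_nat (n * (n - 1) * (n - 2)) / 4) * (eps1\<^sup>2 - eps2 * eps3 TYPE('k))) * ft 0 (n - 3)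
    - scal (cst (3 / 2) * eps1) * (\<Sum>m\<le>n - 3. of_nat ((m + 1) * (n - 2 - m)) *
        (tens (\<lambda>c. scal (cst c)) (fT 0 m) (fT 0 (n - 3 - m)) Omega
         + scal (eps1 * eps2) * ft 0 m * ft 0 (n - 3 - m)))"

abbreviation dca_ideal :: "('k::finite dgen, base) falg set"
  where "dca_ideal \<equiv> ideal_of dca_rel"

quotient_type (overloaded) 'k dca = "('k::finite dgen, base) falg" /
  "\<lambda>x y. x - y \<in> dca_ideal"
proof (rule equivpI)
  show "reflp (\<lambda>x y. x - y \<in> (dca_ideal :: ('k dgen, base) falg set))" by (simp add: reflp_def)
  show "symp (\<lambda>x y. x - y \<in> (dca_ideal :: ('k dgen, base) falg set))"
    by (rule sympI) (metis ideal_of_uminus minus_diff_eq)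
  show "transp (\<lambda>x y. x - y \<in> (dca_ideal :: ('k dgen, base) falg set))"
  proof (rule transpI)
    fix x y z :: "('k dgen, base) falg"
    assume "x - y \<in> dca_ideal" "y - z \<in> dca_ideal"
    from ideal_of_add[OF this] show "x - z \<in> dca_ideal" by simp
  qed
qed

text \<open>No relation has a constant term, so there is an augmentation and the quotient is nonzero.\<close>

lemma structure_map_id: "structure_map (\<lambda>p::'r::comm_ring_1. p)"
  by (simp add: structure_map_def mult.commute)

lemma augmentation_ideal:
  assumes "x \<in> (dca_ideal :: ('k::finite dgen, base) falg set)"
  shows "free_eval (\<lambda>p. p) (\<lambda>_. 0) x = 0"
proof -
  note s = free_eval_simps[OF structure_map_id]
  have of_int: "free_eval (\<lambda>p. p) (\<lambda>_. 0) (of_int i * gen g) = (0::base)" for i and g :: "'k dgen"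
    by (simp add: s)
  have tens: "free_eval (\<lambda>p. p) (\<lambda>_. 0)
      (tens c (fT a b) (fT a' b') (Z :: complex^('k \<times> 'k)^('k \<times> 'k))) = (0::base)" for a b a' b' c Z
    by (simp add: tens_def s)
  have "dca_ideal \<subseteq> {x :: ('k dgen, base) falg. free_eval (\<lambda>p. p) (\<lambda>_. 0) x = 0}"
  proof (rule ideal_of_minimal)
    show "two_sided_ideal {x :: ('k dgen, base) falg. free_eval (\<lambda>p. p) (\<lambda>_. 0) x = 0}"
      by (simp add: two_sided_ideal_def s)
    show "x - y \<in> {x :: ('k dgen, base) falg. free_eval (\<lambda>p. p) (\<lambda>_. 0) x = 0}"
      if "x \<approx>A y" for x y
      using that by cases (simp_all add: s comm_def tens)
  qed
  then show ?thesis using assms by blast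
qed

lemma scal_in_dca_ideal:
  "scal p \<in> (dca_ideal :: ('k::finite dgen, base) falg set) \<Longrightarrow> p = 0"
  using augmentation_ideal[of "scal p"] by (simp add: free_eval_scal[OF structure_map_id])

instantiation dca :: (finite) ring_1
begin

lift_definition zero_dca :: "'a dca" is 0 .
lift_definition one_dca :: "'a dca" is 1 .
lift_definition plus_dca :: "'a dca \<Rightarrow> 'a dca \<Rightarrow> 'a dca" is "(+)"
  by (metis add_diff_add ideal_of_add)
lift_definition minus_dca :: "'a dca \<Rightarrow> 'a dca \<Rightarrow> 'a dca" is "(-)"
proof -
  fix x x' y y' :: "('a dgen, base) falg"
  assume "x - x' \<in> dca_ideal" "y - y' \<in> dca_ideal"
  from ideal_of_diff[OF this] show "x - y - (x' - y') \<in> dca_ideal" by (simp add: algebra_simps)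
qed
lift_definition uminus_dca :: "'a dca \<Rightarrow> 'a dca" is uminus
  by (metis ideal_of_uminus minus_diff_minus)
lift_definition times_dca :: "'a dca \<Rightarrow> 'a dca \<Rightarrow> 'a dca" is "(*)"
proof -
  fix x x' y y' :: "('a dgen, base) falg"
  assume "x - x' \<in> dca_ideal" "y - y' \<in> dca_ideal"
  then have "(x - x') * y + x' * (y - y') \<in> dca_ideal"
    by (intro ideal_of_add ideal_of_mult_left ideal_of_mult_right)
  then show "x * y - x' * y' \<in> dca_ideal" by (simp add: algebra_simps)
qed

instance
proof
  show "(0::'a dca) \<noteq> 1"
  proof (transfer, rule notI)
    assume "0 - 1 \<in> (dca_ideal :: ('a dgen, base) falg set)"
    then have "scal (-1) \<in> (dca_ideal :: ('a dgen, base) falg set)" by simp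
    from scal_in_dca_ideal[OF this] show False by simp
  qed
qed (transfer; simp add: algebra_simps)+

end

lift_definition dca_scal :: "base \<Rightarrow> ('k::finite) dca" is scal .
lift_definition dca_T :: "nat \<Rightarrow> nat \<Rightarrow> complex^'k^'k \<Rightarrow> ('k::finite) dca" is fT .
lift_definition dca_t :: "nat \<Rightarrow> nat \<Rightarrow> ('k::finite) dca" is ft .

lemma structure_map_dca_scal: "structure_map dca_scal"
  unfolding structure_map_def
proof (intro conjI allI)
  fix p q and a :: "'a dca"
  show "dca_scal 1 = (1 :: 'a dca)" by transfer simp
  show "dca_scal (p + q) = (dca_scal p + dca_scal q :: 'a dca)" by transfer simp
  show "dca_scal (p * q) = (dca_scal p * dca_scal q :: 'a dca)" by transfer simp
  show "dca_scal p * a = a * dca_scal p" by transfer (subst scal_central, simp)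
qed

lemma dca_scal_simps [simp]:
  "dca_scal 0 = 0" "dca_scal 1 = 1" "dca_scal (p + q) = dca_scal p + dca_scal q"
  "dca_scal (p * q) = dca_scal p * dca_scal q"
  using structure_map_dca_scal structure_map_0[OF structure_map_dca_scal]
  by (auto simp: structure_map_def)

lemma dca_scal_central: "dca_scal p * x = x * dca_scal p"
  using structure_map_dca_scal by (auto simp: structure_map_def)

lemma dca_scal_uminus [simp]: "dca_scal (- p) = - dca_scal p"
  by transfer simp

lemma dca_scal_eq_0: "dca_scal p = (0 :: 'k::finite dca) \<Longrightarrow> p = 0"
  by transfer (simp add: scal_in_dca_ideal)


section \<open>The localisation \<open>A\<^sup>(\<^sup>K\<^sup>)[\<epsilon>\<^sub>2\<^sup>-\<^sup>1, \<epsilon>\<^sub>3\<^sup>-\<^sup>1]\<close>\<close>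

lifting_forget dca.lifting

definition dca_smult :: "base \<Rightarrow> 'k::finite dca \<Rightarrow> 'k dca"  (infixr \<open>*A\<close> 75)
  where "p *A a = dca_scal p * a"

lemma dca_smult_simps [simp]:
  "p *A 0 = 0" "0 *A a = 0" "1 *A a = a" "p *A (q *A a) = (p * q) *A a"
  "(p *A a) * b = p *A (a * b)" "a * (p *A b) = p *A (a * b)"
  by (simp_all add: dca_smult_def mult.assoc) (metis dca_scal_central mult.assoc)

lemma dca_smult_distrib:
  "p *A (a + b) = p *A a + p *A b" "p *A (a - b) = p *A a - p *A b" "p *A (- a) = - (p *A a)"
  "(p + q) *A a = p *A a + q *A a"
  by (simp_all add: dca_smult_def algebra_simps)

lemma dca_smult_one: "p *A 1 = dca_scal p"
  by (simp add: dca_smult_def)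

lemma dca_smult_scal: "p *A dca_scal q = dca_scal (q * p)"
  unfolding dca_smult_def dca_scal_simps by (rule dca_scal_central)

definition loc_eq :: "'k::finite dca \<times> (nat \<times> nat) \<Rightarrow> 'k dca \<times> (nat \<times> nat) \<Rightarrow> bool"
  where "loc_eq = (\<lambda>(a, d) (b, d').
    \<exists>u. den TYPE('k) u *A den TYPE('k) d' *A a = den TYPE('k) u *A den TYPE('k) d *A b)"

lemma loc_eqI:
  fixes a b :: "'k::finite dca"
  assumes "den TYPE('k) d' *A a = den TYPE('k) d *A b"
  shows "loc_eq (a, d) (b, d')"
  unfolding loc_eq_def prod.case using assms by (intro exI[of _ 0]) simp

lemma loc_eqI':
  fixes a b :: "'k::finite dca"
  assumes "(den TYPE('k) u * den TYPE('k) d') *A a = (den TYPE('k) u * den TYPE('k) d) *A b"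
  shows "loc_eq (a, d) (b, d')"
  unfolding loc_eq_def prod.case using assms by (intro exI[of _ u]) simp

lemma loc_eqE:
  fixes a b :: "'k::finite dca"
  assumes "loc_eq (a, d) (b, d')"
  obtains u where
    "(den TYPE('k) u * den TYPE('k) d') *A a = (den TYPE('k) u * den TYPE('k) d) *A b"
  using assms unfolding loc_eq_def prod.case dca_smult_simps by blast

text \<open>The class of \<open>(a, d)\<close> is the fraction with numerator \<open>a\<close> and denominator \<open>den d\<close>.\<close>

quotient_type (overloaded) 'k dca_loc = "('k::finite) dca \<times> (nat \<times> nat)" / loc_eq
proof (rule equivpI)
  show "reflp (loc_eq :: 'k dca \<times> _ \<Rightarrow> _)" by (auto simp: reflp_def loc_eq_def)
  show "symp (loc_eq :: 'k dca \<times> _ \<Rightarrow> _)" unfolding symp_def loc_eq_def by (auto, metis)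
  show "transp (loc_eq :: 'k dca \<times> _ \<Rightarrow> _)"
  proof (rule transpI)
    fix x y z :: "'k dca \<times> (nat \<times> nat)"
    assume xy: "loc_eq x y" and yz: "loc_eq y z"
    obtain a d b e c f where xyz: "x = (a, d)" "y = (b, e)" "z = (c, f)"
      by (cases x, cases y, cases z) auto
    let ?D = "den TYPE('k)"
    from xy yz obtain u v where
      u: "(?D u * ?D e) *A a = (?D u * ?D d) *A b" and
      v: "(?D v * ?D f) *A b = (?D v * ?D e) *A c"
      unfolding xyz by (metis loc_eqE)
    have "(?D v * ?D f) *A (?D u * ?D e) *A a = (?D u * ?D d) *A (?D v * ?D f) *A b"
      unfolding u by (simp add: mult_ac)
    also have "\<dots> = (?D u * ?D d) *A (?D v * ?D e) *A c"
      unfolding v ..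
    finally show "loc_eq x z" unfolding xyz
      by (intro loc_eqI'[of "u + v + e"]) (simp add: den_add mult_ac)
  qed
qed

instantiation dca_loc :: (finite) ring_1
begin

lift_definition zero_dca_loc :: "'a dca_loc" is "(0, 0)" .
lift_definition one_dca_loc :: "'a dca_loc" is "(1, 0)" .

lift_definition plus_dca_loc :: "'a dca_loc \<Rightarrow> 'a dca_loc \<Rightarrow> 'a dca_loc"
  is "\<lambda>(a, d) (b, e). (den TYPE('a) e *A a + den TYPE('a) d *A b, d + e)"
proof clarify
  let ?D = "den TYPE('a)"
  fix a a' b b' :: "'a dca" and d1 d2 d1' d2' e1 e2 e1' e2' :: nat
  assume "loc_eq (a, d1, d2) (a', d1', d2')" "loc_eq (b, e1, e2) (b', e1', e2')"
  then obtain u v where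
    u: "(?D u * ?D (d1', d2')) *A a = (?D u * ?D (d1, d2)) *A a'" and
    v: "(?D v * ?D (e1', e2')) *A b = (?D v * ?D (e1, e2)) *A b'"
    by (metis loc_eqE)
  have "(?D v * ?D (e1', e2') * ?D (e1, e2)) *A (?D u * ?D (d1', d2')) *A a
      + (?D u * ?D (d1', d2') * ?D (d1, d2)) *A (?D v * ?D (e1', e2')) *A b
      = (?D v * ?D (e1', e2') * ?D (e1, e2)) *A (?D u * ?D (d1, d2)) *A a'
      + (?D u * ?D (d1', d2') * ?D (d1, d2)) *A (?D v * ?D (e1, e2)) *A b'"
    unfolding u v ..
  then show "loc_eq
      (?D (e1, e2) *A a + ?D (d1, d2) *A b, (d1, d2) + (e1, e2))
      (?D (e1', e2') *A a' + ?D (d1', d2') *A b', (d1', d2') + (e1', e2'))"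
    by (intro loc_eqI'[of "u + v"]) (simp only: den_add dca_smult_distrib dca_smult_simps mult_ac)
qed

lift_definition uminus_dca_loc :: "'a dca_loc \<Rightarrow> 'a dca_loc" is "\<lambda>(a, d). (- a, d)"
  by (clarsimp simp: loc_eq_def dca_smult_distrib simp del: split_paired_Ex) blast

definition minus_dca_loc :: "'a dca_loc \<Rightarrow> 'a dca_loc \<Rightarrow> 'a dca_loc"
  where "minus_dca_loc x y = x + - y"

lift_definition times_dca_loc :: "'a dca_loc \<Rightarrow> 'a dca_loc \<Rightarrow> 'a dca_loc"
  is "\<lambda>(a, d) (b, e). (a * b, d + e)"
proof clarify
  let ?D = "den TYPE('a)"
  fix a a' b b' :: "'a dca" and d1 d2 d1' d2' e1 e2 e1' e2' :: nat
  assume "loc_eq (a, d1, d2) (a', d1', d2')" "loc_eq (b, e1, e2) (b', e1', e2')"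
  then obtain u v where
    u: "(?D u * ?D (d1', d2')) *A a = (?D u * ?D (d1, d2)) *A a'" and
    v: "(?D v * ?D (e1', e2')) *A b = (?D v * ?D (e1, e2)) *A b'"
    by (metis loc_eqE)
  have "((?D u * ?D (d1', d2')) *A a) * ((?D v * ?D (e1', e2')) *A b)
      = ((?D u * ?D (d1, d2)) *A a') * ((?D v * ?D (e1, e2)) *A b')"
    unfolding u v ..
  then show "loc_eq (a * b, (d1, d2) + (e1, e2)) (a' * b', (d1', d2') + (e1', e2'))"
    by (intro loc_eqI'[of "u + v"]) (simp add: den_add mult_ac del: add_Pair)
qed

instance
proof
  fix a b c :: "'a dca_loc"
  show "a + b + c = a + (b + c)"
    by transfer (clarsimp simp del: add_Pair intro!: loc_eqI,
      simp only: den_add dca_smult_distrib dca_smult_simps mult_ac add_ac)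
  show "a + b = b + a"
    by transfer (clarsimp simp del: add_Pair intro!: loc_eqI,
      simp only: den_add dca_smult_distrib dca_smult_simps mult_ac add_ac)
  show "0 + a = a"
    by transfer (clarsimp simp del: add_Pair intro!: loc_eqI)
  show "- a + a = 0"
    by transfer (clarsimp simp del: add_Pair simp: dca_smult_distrib intro!: loc_eqI)
  show "a - b = a + - b"
    by (rule minus_dca_loc_def)
  show "a * b * c = a * (b * c)"
    by transfer (clarsimp simp del: add_Pair simp: mult.assoc add.assoc intro!: loc_eqI)
  show "1 * a = a" "a * 1 = a"
    by (transfer; clarsimp simp del: add_Pair intro!: loc_eqI)+
  show "(a + b) * c = a * c + b * c" "a * (b + c) = a * b + a * c"
    by (transfer; clarsimp simp del: add_Pair intro!: loc_eqI;
      simp only: den_add dca_smult_distrib dca_smult_simps mult_ac distrib_left distrib_right)+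
  show "(0::'a dca_loc) \<noteq> 1"
  proof (transfer, rule notI)
    assume "loc_eq (0, 0) (1 :: 'a dca, 0)"
    then obtain u where "dca_scal (den TYPE('a) u) = (0 :: 'a dca)"
      by (auto simp: loc_eq_def dca_smult_one)
    then show False using dca_scal_eq_0 den_nonzero by blast
  qed
qed

end

lift_definition loc_frac :: "'k::finite dca \<Rightarrow> nat \<times> nat \<Rightarrow> 'k dca_loc" is Pair .

lemma loc_frac_cases: obtains a d where "x = loc_frac a d"
  by transfer (metis surj_pair loc_eqI)

lemma loc_frac_eq_iff:
  "loc_frac a d = loc_frac b d' \<longleftrightarrow>
    (\<exists>u. den TYPE('k) u *A den TYPE('k) d' *A (a :: 'k::finite dca) =
         den TYPE('k) u *A den TYPE('k) d *A b)"
  by transfer (simp add: loc_eq_def)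

lemma loc_frac_arith:
  fixes a b :: "'k::finite dca"
  shows "loc_frac a d + loc_frac b e = loc_frac (den TYPE('k) e *A a + den TYPE('k) d *A b) (d + e)"
    and "loc_frac a d * loc_frac b e = loc_frac (a * b) (d + e)"
    and "- loc_frac a d = loc_frac (- a) d"
    and "loc_frac 0 d = 0"
    and "loc_frac 1 0 = 1"
  by (transfer; auto simp: loc_eq_def)+

text \<open>The structure map, \<open>p / den d \<mapsto> (p 1) / den d\<close>; see \<open>loc_scal_lfrac\<close>.\<close>

definition loc_scal :: "'k::finite laurent \<Rightarrow> 'k dca_loc"
  where "loc_scal x = (THE y. \<exists>p d. x = lfrac p d \<and> y = loc_frac (dca_scal p) d)"

lemma lfrac_cases: obtains p d where "x = lfrac p d"
  by transfer auto

lemma lfrac_eq_iff: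
  "lfrac p d = (lfrac q e :: 'k::finite laurent) \<longleftrightarrow>
    p * den TYPE('k) e = q * den TYPE('k) d"
  by transfer (simp add: eq_fract)

lemma lfrac_arith:
  shows "lfrac p d + lfrac q e =
      (lfrac (p * den TYPE('k) e + q * den TYPE('k) d) (d + e) :: 'k::finite laurent)"
    and "lfrac p d * lfrac q e = (lfrac (p * q) (d + e) :: 'k::finite laurent)"
    and "lfrac 1 0 = (1 :: 'k::finite laurent)"
  by (transfer; simp add: den_add One_fract_def)+

lemma loc_scal_lfrac: "loc_scal (lfrac p d :: 'k::finite laurent) = loc_frac (dca_scal p) d"
proof -
  have "loc_frac (dca_scal q) e = (loc_frac (dca_scal p) d :: 'k dca_loc)"
    if "lfrac p d = (lfrac q e :: 'k laurent)" for q e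
    using that[symmetric] unfolding lfrac_eq_iff loc_frac_eq_iff dca_smult_scal
    by (intro exI[of _ 0]) (simp only:)
  then show ?thesis unfolding loc_scal_def by (intro the_equality) blast+
qed

lemma structure_map_loc_scal: "structure_map (loc_scal :: 'k::finite laurent \<Rightarrow> _)"
  unfolding structure_map_def
proof (intro conjI allI)
  fix x y :: "'k laurent" and z :: "'k dca_loc"
  obtain p d q e a f where xyz: "x = lfrac p d" "y = lfrac q e" "z = loc_frac a f"
    by (metis lfrac_cases loc_frac_cases)
  show "loc_scal (1 :: 'k laurent) = 1"
    by (simp add: loc_scal_lfrac loc_frac_arith flip: lfrac_arith)
  show "loc_scal (x + y) = loc_scal x + loc_scal y"
    by (simp only: xyz lfrac_arith loc_scal_lfrac loc_frac_arith dca_smult_scal dca_scal_simps)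
  show "loc_scal (x * y) = loc_scal x * loc_scal y"
    by (simp add: xyz lfrac_arith loc_scal_lfrac loc_frac_arith)
  show "loc_scal x * z = z * loc_scal x"
    by (simp add: xyz loc_scal_lfrac loc_frac_arith dca_scal_central[of p a] add.commute)
qed


section \<open>The smaller presentation\<close>

datatype 'k sgen = S_T10 "complex^'k^'k" | S_T0 nat "complex^'k^'k" | S_t20 | S_t11 | S_t02

text \<open>The generators in terms of their indices. Indices outside the generating set occur in the
  relations only with coefficient zero; the value \<open>0\<close> given to them is immaterial.\<close>

definition sT :: "nat \<Rightarrow> nat \<Rightarrow> complex^'k^'k \<Rightarrow> ('k::finite sgen, 'k laurent) falg"
  where "sT n m X =
    (if (n, m) = (1, 0) then gen (S_T10 X) else if n = 0 then gen (S_T0 m X) else 0)"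

definition st :: "nat \<Rightarrow> nat \<Rightarrow> ('k::finite sgen, 'k laurent) falg"
  where "st n m =
    (if (n, m) = (2, 0) then gen S_t20 else if (n, m) = (1, 1) then gen S_t11
     else if (n, m) = (0, 2) then gen S_t02 else 0)"

abbreviation sscal :: "base \<Rightarrow> ('k::finite sgen, 'k laurent) falg"
  where "sscal p \<equiv> scal (of_base p)"

inductive small_rel ::
    "('k::finite sgen, 'k laurent) falg \<Rightarrow> ('k sgen, 'k laurent) falg \<Rightarrow> bool"
    (infix \<open>\<approx>S\<close> 50) where
  S0_unit: "sT 0 2 (mat 1) \<approx>S sscal eps2 * st 0 2"
| S0_lin: "(n, m) = (1, 0) \<or> n = 0 \<Longrightarrow>
    sT n m (mscale a X + mscale b Y) \<approx>S sscal (cst a) * sT n m X + sscal (cst b) * sT n m Y"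
| S1: "comm (sT 0 m X) (sT 0 n Y) \<approx>S sT 0 (m + n) (mcomm X Y)"
| S2_t: "(p, q) \<in> {(2, 0), (0, 2)} \<Longrightarrow> m + n = 2 \<Longrightarrow> comm (st p q) (st n m) \<approx>S
    of_int (int m * int p - int n * int q) * st (p + n - 1) (q + m - 1)"
| S2_T: "(p, q) \<in> {(2, 0), (0, 2)} \<Longrightarrow> r + s \<le> 1 \<Longrightarrow> comm (st p q) (sT r s X) \<approx>S
    of_int (int p * int s - int r * int q) * sT (p + r - 1) (q + s - 1) X"
| S3: "comm (sT 1 0 X) (sT 0 n Y) \<approx>S
    sscal (cst (1 / of_nat (2 * n + 2))) * comm (st 2 0) (sT 0 (n + 1) (mcomm X Y))
    - sscal (eps3 TYPE('k) * cst (of_nat n / 2)) * sT 0 (n - 1) (macomm X Y)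
    - sscal (of_nat n * eps1 * cst (trace Y)) * sT 0 (n - 1) X
    + sscal eps1 * (\<Sum>m<n. sscal (cst (of_nat (m + 1) / of_nat (n + 1))) *
        tens (\<lambda>c. sscal (cst c)) (sT 0 m) (sT 0 (n - 1 - m)) (kron (mcomm X Y) (mat 1) ** Omega))
    + sscal eps1 * (\<Sum>m<n.
        tens (\<lambda>c. sscal (cst c)) (sT 0 m) (sT 0 (n - 1 - m))
          ((kron X Y - kron (X ** Y) (mat 1)) ** Omega))"

primrec sgen_val :: "'k::finite sgen \<Rightarrow> 'k dca_loc"
  where
    "sgen_val (S_T10 X) = loc_frac (dca_T 1 0 X) 0"
  | "sgen_val (S_T0 n X) = loc_frac (dca_T 0 n X) 0"
  | "sgen_val S_t20 = loc_frac (dca_t 2 0) 0"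
  | "sgen_val S_t11 = loc_frac (dca_t 1 1) 0"
  | "sgen_val S_t02 = loc_frac (dca_t 0 2) 0"

end

theory Submission
  imports Defs "HOL-Computational_Algebra.Formal_Power_Series"
begin

text \<open>The relations (A1') hold in \<open>A\<close> because \<open>ad t\<^sub>0\<^sub>2\<close> turns (A3) into the case \<open>m = 1\<close> and (A4) into
  \<open>[t\<^sub>0\<^sub>m, t\<^sub>0\<^sub>n] = 0\<close>; the Jacobi identity does the rest.

  Conversely, in the algebra with the smaller presentation put
  \<open>T\<^sub>n\<^sub>m(X) = m! / ((n + m)! 2\<^sup>n) (ad t\<^sub>2\<^sub>0)\<^sup>n T\<^sub>0\<^sub>,\<^sub>n\<^sub>+\<^sub>m(X)\<close>. The elements \<open>t\<^sub>2\<^sub>0, t\<^sub>1\<^sub>1, t\<^sub>0\<^sub>2\<close> span a copy of \<open>sl\<^sub>2\<close>.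
  Since \<open>\<epsilon>\<^sub>3\<close> is invertible, (A3') expresses the trace part of \<open>T\<^sub>0\<^sub>n\<close> through commutators of traceless
  parts; hence \<open>T\<^sub>0\<^sub>n(X)\<close> generates a finite-dimensional \<open>sl\<^sub>2\<close>-module of highest weight \<open>n\<close>, which
  gives (A0)-(A3). Let \<open>R\<^sub>n\<close> be the difference of the two sides of (A4). By induction on \<open>n\<close> it
  commutes with \<open>T\<^sub>1\<^sub>0(E\<^sub>i\<^sub>j)\<close> for \<open>i \<noteq> j\<close>; the induction step is an identity between generating series in
  a differential ring. It follows that \<open>R\<^sub>n\<close> commutes with all \<open>T\<^sub>0\<^sub>m(X)\<close> and with \<open>T\<^sub>1\<^sub>0(1)\<close>, and
  \<open>[T\<^sub>1\<^sub>0(1), R\<^sub>n\<^sub>+\<^sub>1] = (n + 1) \<epsilon>\<^sub>2 R\<^sub>n\<close> shows that \<open>R\<^sub>n = 0\<close>.\<close>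

section \<open>Presentations and homomorphisms\<close>

text \<open>(A4) is not among the relations of the smaller presentation and t_30 is not a generator,
  so both sides of (A4) can be compared only through their commutators. Put w = T_01(E_ii - E_jj).
  For i distinct from j, 2 T_{0,n+1}(E_ij) = [w, T_{0n}(E_ij)] and [t_30, w] = 3 T_20(E_ii - E_jj),
  so the elements [t_30, T_{0n}(E_ij)] obey a recursion in n. The induction step asks that the
  right-hand side of (A4), bracketed with T_10(E_ij), obeys the same recursion; this is the identity
  of series. It explains the constants of (A4): the products e1 e2 t_0m t_0n cancel the trace term
  of (A3'), and e1^2 - e2 e3 arises as e1^2 + K e1 e3 + e3^2. The inverse of e3 acts through one
  formula, \<open>HR\<close>, used twice: for weights and nilpotence, and to see that what commutes
  with traceless elements commutes with all. Both times commutators alone reach only traceless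
  matrices, and K > 1 is what provides nonzero diagonal ones. The inverse of e2 recovers t_nm from
  T_nm(1) and permits the last cancellation.\<close>

lemma single_word: "Poly_Mapping.single (Word l) (c::'r::comm_ring_1) = scal c * prod_list (map gen l)"
proof (induction l arbitrary: c)
  case Nil
  then show ?case by (simp add: scal_def zero_fmonoid_def)
next
  case (Cons g l)
  have "Poly_Mapping.single (Word (g # l)) c = gen g * Poly_Mapping.single (Word l) c"
    by (simp add: gen_def mult_single plus_fmonoid_def)
  also have "\<dots> = scal c * (gen g * prod_list (map gen l))"
    unfolding Cons.IH mult.assoc[symmetric] scal_central[of c "gen g"] ..
  finally show ?case by simp
qed

text \<open>The uniqueness half of freeness. It turns abstract quotient maps into evaluations, so
  that relations of a quotient can be read off with \<open>free_evals\<close>, and it identifies two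
  homomorphisms in \<open>theorem4\<close>.\<close>

lemma falg_hom_unique:
  fixes \<phi> :: "('g, 'r::comm_ring_1) falg \<Rightarrow> 'a::ring_1"
  assumes add: "\<And>f g. \<phi> (f + g) = \<phi> f + \<phi> g" and mult: "\<And>f g. \<phi> (f * g) = \<phi> f * \<phi> g"
    and scal: "\<And>c. \<phi> (scal c) = \<iota> c" and gen: "\<And>g. \<phi> (gen g) = e g" and one: "\<iota> 1 = 1"
  shows "\<phi> f = free_eval \<iota> e f"
proof -
  have 1: "\<phi> 1 = 1" using scal[of 1] one by simp
  have 0: "\<phi> 0 = 0" using add[of 0 0] by simp
  have s: "\<phi> (sum F A) = (\<Sum>x\<in>A. \<phi> (F x))" for F :: "'g fmonoid \<Rightarrow> _" and A
    by (induction A rule: infinite_finite_induct) (simp_all add: 0 add)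
  have p: "\<phi> (prod_list (map gen l)) = prod_list (map e l)" for l
    by (induction l) (simp_all add: 1 mult gen)
  have w: "\<phi> (Poly_Mapping.single w c) = \<iota> c * prod_list (map e (letters w))" for w c
    using single_word[of "letters w" c] by (cases w) (simp add: mult scal p)
  show ?thesis by (subst falg_decomp) (simp add: s w free_eval_def)
qed

context
  fixes \<iota> :: "'r::comm_ring_1 \<Rightarrow> 'a::ring_1" and e :: "'g \<Rightarrow> 'a"
  assumes sm: "structure_map \<iota>"
begin
lemma free_eval_comm: "free_eval \<iota> e (comm x y) = comm (free_eval \<iota> e x) (free_eval \<iota> e y)"
  by (simp add: comm_def free_eval_simps[OF sm])
lemma free_eval_of_nat: "free_eval \<iota> e (of_nat n) = of_nat n"
  by (induction n) (simp_all add: free_eval_simps[OF sm])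
lemma free_eval_of_int: "free_eval \<iota> e (of_int z) = of_int z"
  by (cases z) (simp_all add: free_eval_of_nat free_eval_uminus[OF sm] free_eval_diff[OF sm] free_eval_1[OF sm] del: of_nat_Suc)
lemma free_eval_tens: "free_eval \<iota> e (tens (\<lambda>c. scal (p c)) f g Z) = tens (\<lambda>c. \<iota> (p c)) (\<lambda>X. free_eval \<iota> e (f X)) (\<lambda>X. free_eval \<iota> e (g X)) Z"
  by (simp add: tens_def free_eval_simps[OF sm])
lemmas free_evals = free_eval_simps[OF sm] free_eval_comm free_eval_of_nat free_eval_of_int free_eval_tens

lemma ideal_of_killed:
  assumes "\<And>x y. rel x y \<Longrightarrow> free_eval \<iota> e x = free_eval \<iota> e y"
  shows "ideal_of rel \<subseteq> {f. free_eval \<iota> e f = 0}"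
  using assms by (intro ideal_of_minimal) (auto simp: two_sided_ideal_def free_evals)
end

section \<open>Algebras satisfying (A0)-(A4), and the derivation of (A1')\<close>

locale dca_alg =
  fixes \<iota> :: "base \<Rightarrow> 'b::ring_1" and T :: "nat \<Rightarrow> nat \<Rightarrow> complex^'k::finite^'k \<Rightarrow> 'b" and t :: "nat \<Rightarrow> nat \<Rightarrow> 'b"
  assumes sm: "structure_map \<iota>"
    and A0u: "T n m (mat 1) = \<iota> eps2 * t n m"
    and A0l: "T n m (mscale a X + mscale b Y) = \<iota> (cst a) * T n m X + \<iota> (cst b) * T n m Y"
    and A1T: "comm (T 0 0 X) (T 0 n Y) = T 0 n (mcomm X Y)"
    and A1t: "comm (T 0 0 X) (t 0 n) = 0"
    and A2T: "p + q \<le> 2 \<Longrightarrow> comm (t p q) (T n m X) = of_int (int m * int p - int n * int q) * T (p + n - 1) (q + m - 1) X"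
    and A2t: "p + q \<le> 2 \<Longrightarrow> comm (t p q) (t n m) = of_int (int m * int p - int n * int q) * t (p + n - 1) (q + m - 1)"
    and A3T: "comm (T 1 0 X) (T 0 n Y) =
    T 1 n (mcomm X Y)
    - \<iota> (eps3 TYPE('k) * cst (of_nat n / 2)) * T 0 (n - 1) (macomm X Y)
    - \<iota> (of_nat n * eps1 * cst (trace Y)) * T 0 (n - 1) X
    + \<iota> eps1 * (\<Sum>m<n. \<iota> (cst (of_nat (m + 1) / of_nat (n + 1))) *
        tens (\<lambda>c. \<iota> (cst c)) (T 0 m) (T 0 (n - 1 - m)) (kron (mcomm X Y) (mat 1) ** Omega))
    + \<iota> eps1 * (\<Sum>m<n.
        tens (\<lambda>c. \<iota> (cst c)) (T 0 m) (T 0 (n - 1 - m))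
          ((kron X Y - kron (X ** Y) (mat 1)) ** Omega))"
    and A3t: "comm (T 1 0 X) (t 0 n) = of_nat n * T 0 (n - 1) X"
    and A4: "3 \<le> n \<Longrightarrow> comm (t 3 0) (t 0 n) =
    of_nat (3 * n) * t 2 (n - 1)
    + \<iota> (cst (of_nat (n * (n - 1) * (n - 2)) / 4) * (eps1\<^sup>2 - eps2 * eps3 TYPE('k))) * t 0 (n - 3)
    - \<iota> (cst (3 / 2) * eps1) * (\<Sum>m\<le>n - 3. of_nat ((m + 1) * (n - 2 - m)) *
        (tens (\<lambda>c. \<iota> (cst c)) (T 0 m) (T 0 (n - 3 - m)) Omega
         + \<iota> (eps1 * eps2) * t 0 m * t 0 (n - 3 - m)))"
begin

definition gval :: "'k dgen \<Rightarrow> 'b" where "gval g = (case g of Gen_T n m X \<Rightarrow> T n m X | Gen_t n m \<Rightarrow> t n m)"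

lemma rel_killed: "dca_rel x y \<Longrightarrow> free_eval \<iota> gval x = free_eval \<iota> gval y"
proof (induction rule: dca_rel.induct)
  case prem: (A4 n)
  then show ?case by (simp only: free_evals[OF sm] gval_def dgen.case A4[OF prem])
qed (simp_all only: free_evals[OF sm] gval_def dgen.case A0u A0l A1T A1t A2T A2t A3T A3t)

lemma i_cent: "\<iota> x * z = z * \<iota> x" using sm unfolding structure_map_def by blast
lemma kk: "\<iota> (cst (a + b)) = \<iota> (cst a) + \<iota> (cst b)" "\<iota> (cst (a * b)) = \<iota> (cst a) * \<iota> (cst b)" "\<iota> (cst 0) = 0" "\<iota> (cst 1) = 1"
proof -
  have "\<iota> (x + y) = \<iota> x + \<iota> y" "\<iota> (x * y) = \<iota> x * \<iota> y" "\<iota> 1 = 1" for x y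
    using sm unfolding structure_map_def by blast+
  moreover have "cst (a + b) = cst a + cst b" "cst (a * b) = cst a * cst b" "cst 0 = 0" "cst 1 = 1"
    by (simp_all add: cst_def one_pCons)
  ultimately show "\<iota> (cst (a + b)) = \<iota> (cst a) + \<iota> (cst b)" "\<iota> (cst (a * b)) = \<iota> (cst a) * \<iota> (cst b)" "\<iota> (cst 0) = 0" "\<iota> (cst 1) = 1"
    using structure_map_0[OF sm] by simp_all
qed
lemma nat_cancel: assumes "0 < n" "of_nat n * x = of_nat n * z" shows "x = (z::'b)"
proof -
  have on: "\<iota> (cst (of_nat n)) = of_nat n" by (induction n) (simp_all add: kk)
  have "\<iota> (cst (1 / of_nat n)) * of_nat n = 1"
    unfolding on[symmetric] kk(2)[symmetric] using assms(1) kk(4) by simp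
  then show ?thesis using assms(2) by (metis mult.assoc mult_1)
qed
lemma two_cancel: "- 2 * x = - 2 * z \<Longrightarrow> x = (z::'b)" using nat_cancel[of 2 x z] by simp

lemma T_lin: "T n m (X + Y) = T n m X + T n m Y" "T n m (mscale a X) = \<iota> (cst a) * T n m X" "T n m 0 = 0" "T n m (X - Y) = T n m X - T n m Y"
proof -
  have ms: "mscale 1 X = X" "mscale 0 X = 0" for X :: "complex^'k^'k" by (simp_all add: mscale_def vec_eq_iff)
  show a: "T n m (X + Y) = T n m X + T n m Y" for X Y using A0l[of n m 1 X 1 Y] by (simp add: ms kk)
  show b: "T n m (mscale a X) = \<iota> (cst a) * T n m X" for a X using A0l[of n m a X 0 X] by (simp add: ms kk)
  show "T n m 0 = 0" using b[of 0 0] by (simp add: ms kk)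
  show "T n m (X - Y) = T n m X - T n m Y" using a[of "X - Y" Y] by simp
qed

text \<open>This derivation lowers the first index by (A2) and kills scalars, \<open>T 0 m X\<close>
  and \<open>t 0 m\<close>. Applied to a relation, it therefore erases all the correction
  terms.\<close>

definition "E z = comm (t 0 2) z"
lemma E_lin: "E (x + z) = E x + E z" "E (x - z) = E x - E z" "E (x * z) = E x * z + x * E z" "E (- x) = - E x"
  "E (comm x z) = comm (E x) z + comm x (E z)"
  by (simp_all add: E_def comm_def algebra_simps)
lemma E_i: "E (\<iota> p) = 0" unfolding E_def comm_def i_cent[of p] by simp
lemma E_0: "E 0 = 0" by (simp add: E_def comm_def)
lemma E_sum: "E (sum f A) = (\<Sum>x\<in>A. E (f x))"
  by (induction A rule: infinite_finite_induct) (simp_all add: E_lin E_0)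
lemma E_nat: "E (of_nat n) = 0" by (simp add: E_def comm_def mult_of_nat_commute)
lemma E_T: "E (T n m X) = - (of_nat (2 * n) * T (n - 1) (m + 1) X)"
  using A2T[of 0 2 n m X] by (simp add: E_def mult.commute)
lemma E_t: "E (t n m) = - (of_nat (2 * n) * t (n - 1) (m + 1))"
  using A2t[of 0 2 n m] by (simp add: E_def mult.commute)
lemma E_T0: "E (T 0 m X) = 0" "E (t 0 m) = 0" using E_T[of 0] E_t[of 0] by simp_all
lemma E_tens: "E (tens (\<lambda>c. \<iota> (p c)) (T 0 m) (T 0 n) Z) = 0"
  unfolding tens_def by (simp add: E_sum E_lin E_i E_T0)

lemma jac: "comm (comm x z) w = comm x (comm z w) - comm z (comm x (w::'b))"
  by (simp add: comm_def algebra_simps)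
lemma comm_nat: "comm (of_nat n * x) z = of_nat n * comm x z" "comm x (of_nat n * z) = of_nat n * comm x (z::'b)"
  unfolding comm_def by (simp_all add: right_diff_distrib mult.assoc) (metis mult.assoc mult_of_nat_commute)+
lemma comm_minus: "comm (- x) z = - comm x z" "comm x (- z) = - comm x (z::'b)" "comm 0 x = 0" "comm x 0 = 0"
  by (simp_all add: comm_def)

lemma comm_num: "comm (numeral w * x) z = numeral w * comm x z" "comm x (numeral w * z) = numeral w * comm x (z::'b)"
  using comm_nat(1)[of "numeral w" x z] comm_nat(2)[of x "numeral w" z] by simp_all

text \<open>ad t_02 applied to (A3): the lower terms contain only \<open>T 0 m\<close> and vanish,
  while \<open>T 1 0 X\<close> and \<open>T 1 n\<close> turn into -2 \<open>T 0 1 X\<close> and -2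
  \<open>T 0 (n + 1)\<close>.\<close>

lemma L1: "comm (T 0 1 X) (T 0 n Y) = T 0 (n + 1) (mcomm X Y)"
proof (rule two_cancel)
  have "E (comm (T 1 0 X) (T 0 n Y)) = E (T 1 n (mcomm X Y))"
    unfolding A3T by (simp add: E_lin E_sum E_i E_T0 E_tens)
  then show "- 2 * comm (T 0 1 X) (T 0 n Y) = - 2 * T 0 (n + 1) (mcomm X Y)"
    unfolding E_lin E_T E_T0 by (simp add: comm_minus comm_num)
qed

lemma E_nat_mult: "E (of_nat n * x) = of_nat n * E x" by (simp add: E_lin E_nat)

text \<open>ad t_02 applied to (A4) twice and then once more. On the right only 3n t_{2,n-1}
  survives the first step. The chain t_30, t_21, t_12, t_03 carries the factors 6, 4, 2, so 24
  [t_12, t_0n] = 3n * 4 * 2 t_{0,n+1}.\<close>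

lemma t03: assumes "3 \<le> n" shows "comm (t 0 3) (t 0 n) = 0" and "comm (t 1 2) (t 0 n) = of_nat n * t 0 (n + 1)"
proof -
  have t30: "E (t 3 0) = - (of_nat 6 * t 2 1)" "E (t 2 1) = - (of_nat 4 * t 1 2)" "E (t 1 2) = - (of_nat 2 * t 0 3)"
    "E (t 2 (n - 1)) = - (of_nat 4 * t 1 n)" "E (t 1 n) = - (of_nat 2 * t 0 (n + 1))"
    using assms E_t[of 3 0] E_t[of 2 1] E_t[of 1 2] E_t[of 2 "n - 1"] E_t[of 1 n] by (simp_all add: numeral_3_eq_3 numeral_2_eq_2)
  have "(of_nat (3 * n * 8) :: 'b) = of_nat (24 * n)" by (rule arg_cong[of _ _ of_nat]) simp
  then have e: "3 * of_nat n * 8 = (24 * of_nat n :: 'b)" by (simp only: of_nat_mult of_nat_numeral)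
  have "E (comm (t 3 0) (t 0 n)) = of_nat (3 * n) * E (t 2 (n - 1))"
    unfolding A4[OF assms] E_lin E_sum E_i E_nat E_T0 E_nat_mult E_tens[of "cst"] E_tens tens_def
    by (simp add: E_lin E_sum E_i E_T0 E_nat)
  then have "E (E (comm (t 3 0) (t 0 n))) = E (of_nat (3 * n) * E (t 2 (n - 1)))" by simp
  then have 2: "of_nat 24 * comm (t 1 2) (t 0 n) = of_nat (24 * n) * t 0 (n + 1)"
    unfolding E_lin E_T0 t30 E_nat_mult comm_minus comm_nat add_0_right E_nat
    by (simp add: mult.assoc[symmetric] comm_nat comm_minus e)
  have "of_nat 24 * comm (t 1 2) (t 0 n) = of_nat 24 * (of_nat n * t 0 (n + 1))" unfolding 2 by (simp add: mult.assoc)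
  then show c: "comm (t 1 2) (t 0 n) = of_nat n * t 0 (n + 1)" by (rule nat_cancel[rotated]) simp
  have "E (comm (t 1 2) (t 0 n)) = 0" unfolding c E_nat_mult E_T0 by simp
  then have "of_nat 2 * comm (t 0 3) (t 0 n) = of_nat 2 * 0" unfolding E_lin E_T0 t30 comm_minus comm_nat by simp
  then show "comm (t 0 3) (t 0 n) = 0" by (rule nat_cancel[rotated]) simp
qed

text \<open>For n < 3 (A4) says nothing, but then t_0n is one of the t_pq with p + q <= 2 and (A2)
  gives the bracket with the roles exchanged.\<close>

lemma t12: "comm (t 1 2) (t 0 n) = of_nat n * t 0 (n + 1)"
proof (cases "3 \<le> n")
  case False
  then have "comm (t 0 n) (t 1 2) = of_int (int 2 * int 0 - int 1 * int n) * t (0 + 1 - 1) (n + 2 - 1)" by (intro A2t) simp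
  then have "comm (t 0 n) (t 1 2) = - (of_nat n * t 0 (n + 1))" by simp
  moreover have "comm (t 1 2) (t 0 n) = - comm (t 0 n) (t 1 2)" by (simp add: comm_def)
  ultimately show ?thesis by simp
qed (rule t03)

lemma tt_le2: "m \<le> 2 \<Longrightarrow> comm (t 0 m) (t 0 n) = 0"
  using A2t[of 0 m 0 n] by simp

text \<open>Since t_{0,m+1} is [t_12, t_0m] up to the factor m, the Jacobi identity propagates
  commutativity upwards from m = 3.\<close>

lemma tt: "comm (t 0 m) (t 0 n) = 0"
proof -
  have anti: "comm x z = - comm z x" for x z :: 'b by (simp add: comm_def)
  have "m \<ge> 3 \<Longrightarrow> comm (t 0 m) (t 0 n) = 0" for n
  proof (induction m arbitrary: n rule: nat_induct_at_least)
    case base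
    show ?case
    proof (cases "3 \<le> n")
      case False
      then show ?thesis using tt_le2[of n 3] anti[of "t 0 3" "t 0 n"] by simp
    qed (rule t03)
  next
    case (Suc m)
    have "of_nat m * comm (t 0 (m + 1)) (t 0 n) = comm (comm (t 1 2) (t 0 m)) (t 0 n)"
      unfolding t12 comm_nat ..
    also have "\<dots> = 0" unfolding jac unfolding t12 comm_nat Suc.IH by (simp add: comm_minus)
    finally have "of_nat m * comm (t 0 (m + 1)) (t 0 n) = of_nat m * 0" by (simp only: mult_zero_right)
    then show ?case using nat_cancel[of m] Suc.hyps by fastforce
  qed
  then show ?thesis using tt_le2[of m n] by (cases "m \<ge> 3") auto
qed

text \<open>The Jacobi step: by \<open>L1\<close>, the element on the left is [T_01(Z), T_0m(W)].
  Off-diagonal units and differences of diagonal units are commutators [Z, W], so this induction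
  reaches all traceless matrices.\<close>

lemma raise: assumes "\<And>n Y. comm (T 0 m W) (T 0 n Y) = T 0 (m + n) (mcomm W Y)"
  shows "comm (T 0 (Suc m) (mcomm Z W)) (T 0 n Y) = T 0 (Suc m + n) (mcomm (mcomm Z W) Y)"
proof -
  have J: "mcomm (mcomm Z W) Y = mcomm Z (mcomm W Y) - mcomm W (mcomm Z Y)"
  proof -
    have "A ** (B - C) = A ** B - A ** C" "(A - B) ** C = A ** C - B ** C" for A B C :: "complex^'k^'k"
      by (simp_all add: matrix_matrix_mult_def vec_eq_iff algebra_simps sum_subtractf)
    then show ?thesis unfolding mcomm_def by (simp add: matrix_mul_assoc)
  qed
  have "comm (T 0 (Suc m) (mcomm Z W)) (T 0 n Y) = comm (comm (T 0 1 Z) (T 0 m W)) (T 0 n Y)" unfolding L1 by simp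
  also have "\<dots> = comm (T 0 1 Z) (comm (T 0 m W) (T 0 n Y)) - comm (T 0 m W) (comm (T 0 1 Z) (T 0 n Y))" by (rule jac)
  also have "\<dots> = T 0 (m + n + 1) (mcomm Z (mcomm W Y)) - T 0 (m + (n + 1)) (mcomm W (mcomm Z Y))" unfolding assms L1 ..
  finally show ?thesis unfolding J T_lin by simp
qed

lemma mcomm_el: "a \<noteq> b \<Longrightarrow> mcomm (elemM a a) (elemM a b) = (elemM a b :: complex^'k^'k)"
  "a \<noteq> b \<Longrightarrow> mcomm (elemM a b) (elemM b a) = (elemM a a - elemM b b :: complex^'k^'k)"
  by (simp_all add: mcomm_def elemM_mult)

lemma S1_off: "a \<noteq> b \<Longrightarrow> comm (T 0 m (elemM a b)) (T 0 n Y) = T 0 (m + n) (mcomm (elemM a b) Y)"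
proof (induction m arbitrary: n Y)
  case (Suc m)
  show ?case using raise[of m "elemM a b" "elemM a a" n Y] Suc mcomm_el(1)[of a b] by simp
qed (simp add: A1T)

lemma S1_diff: "comm (T 0 m (elemM a a - elemM b b)) (T 0 n Y) = T 0 (m + n) (mcomm (elemM a a - elemM b b) Y)"
proof (cases "a = b")
  case True
  then show ?thesis by (simp add: T_lin comm_minus mcomm_def matrix_matrix_mult_def vec_eq_iff)
next
  case False
  then show ?thesis
    using raise[of "m - 1" "elemM b a" "elemM a b" n Y] S1_off[of b a "m - 1"] mcomm_el(2)[of a b]
    by (cases m) (simp_all add: A1T)
qed

text \<open>The diagonal units come from K E_aa = 1 + sum over b of (E_aa - E_bb).\<close>

lemma mat_span:
  assumes add: "\<And>X Y. P X \<Longrightarrow> P Y \<Longrightarrow> P (X + Y)" and sc: "\<And>a X. P X \<Longrightarrow> P (mscale a X)"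
    and off: "\<And>a b. a \<noteq> b \<Longrightarrow> P (elemM a b)" and diff: "\<And>a b. P (elemM a a - elemM b b)" and one: "P (mat 1)"
  shows "P (X :: complex^'k^'k)"
proof -
  have z: "P 0" using diff[of undefined undefined] by simp
  have s: "(\<And>x. x \<in> A \<Longrightarrow> P (f x)) \<Longrightarrow> P (sum f A)" for f :: "'k \<Rightarrow> _" and A
    by (induction A rule: infinite_finite_induct) (auto intro: add z)
  have dg: "P (elemM a a)" for a
  proof -
    have "P (mscale (1 / of_nat CARD('k)) (mat 1 + (\<Sum>b\<in>UNIV. elemM a a - elemM b b)))"
      by (intro sc add one s diff)
    moreover have "mscale (1 / of_nat CARD('k)) (mat 1 + (\<Sum>b\<in>UNIV. elemM a a - elemM b b)) = elemM a a"
    proof -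
      have "(\<Sum>b\<in>UNIV. if i = b \<and> j = b then 1 else 0) = (if i = j then 1 else (0::complex))" for i j :: 'k
        by (cases "i = j") (auto intro!: sum.neutral)
      moreover have "(\<Sum>b\<in>UNIV. elemM a a - elemM b b) $ i $ j
          = (\<Sum>b\<in>UNIV. (if i = a \<and> j = a then 1 else 0) - (if i = b \<and> j = b then 1 else (0::complex)))" for i j :: 'k
        by (simp only: sum_component vector_minus_component elemM_def vec_lambda_beta)
      ultimately show ?thesis by (simp add: vec_eq_iff mscale_def mat_def elemM_def[of a a] sum_subtractf)
    qed
    ultimately show ?thesis by simp
  qed
  have "P (elemM a b)" for a b using off dg by (cases "a = b") auto
  then show ?thesis by (subst mat_decomp) (intro s sc)
qed

lemma comm_i: "comm (\<iota> p * x) z = \<iota> p * comm x z" "comm x (\<iota> p * z) = \<iota> p * comm x z"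
  unfolding comm_def right_diff_distrib mult.assoc by (metis i_cent mult.assoc)+
lemma comm_add: "comm (x + y) z = comm x z + comm y z" "comm x (y + z) = comm x y + comm x (z::'b)"
  by (simp_all add: comm_def algebra_simps)
lemma mcomm_lin: "mcomm (X + X') Y = mcomm X Y + mcomm X' (Y :: complex^'k^'k)" "mcomm (mscale a X) Y = mscale a (mcomm X Y)"
  by (simp_all add: mcomm_def matrix_matrix_mult_def vec_eq_iff mscale_def algebra_simps sum.distrib sum_distrib_left)

lemma mcomm_1: "mcomm (mat 1) Y = 0" "mcomm Y (mat 1) = (0 :: complex^'k^'k)" by (simp_all add: mcomm_def)

text \<open>Commutators reach only traceless X. For X = 1 the same decomposition is applied to Y,
  and the case that is left is e2^2 [t_0m, t_0n] = 0.\<close>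

theorem S1: "comm (T 0 m X) (T 0 n Y) = T 0 (m + n) (mcomm X Y)"
proof (induction X rule: mat_span)
  case (5)
  have anti: "comm x z = 0 \<Longrightarrow> comm z x = 0" for x z :: 'b by (simp add: comm_def)
  have "comm (t 0 m) (t 0 n) = 0" by (rule tt)
  then have "comm (T 0 m (mat 1)) (T 0 n Y) = 0"
  proof (induction Y rule: mat_span)
    case (3 a b) then show ?case using S1_off[of a b n m "mat 1"] anti by (simp add: mcomm_1 T_lin)
  next
    case (4 a b) then show ?case using S1_diff[of n a b m "mat 1"] anti by (simp add: mcomm_1 T_lin)
  qed (simp_all add: T_lin comm_add comm_i A0u)
  then show ?case by (simp add: mcomm_1 T_lin)
qed (simp_all add: T_lin(1-3) comm_add comm_i mcomm_lin S1_off S1_diff)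

end

section \<open>The algebra A and its localisation satisfy the smaller relations\<close>

abbreviation dval :: "'k::finite dgen \<Rightarrow> 'k dca" where
  "dval g \<equiv> (case g of Gen_T n m X \<Rightarrow> dca_T n m X | Gen_t n m \<Rightarrow> dca_t n m)"

lemma abs_dca_eval: "abs_dca f = free_eval dca_scal dval (f :: ('k::finite dgen, base) falg)"
proof (rule falg_hom_unique)
  show "abs_dca (f + g) = abs_dca f + abs_dca g" for f g :: "('k dgen, base) falg" by (rule plus_dca.abs_eq[symmetric])
  show "abs_dca (f * g) = abs_dca f * abs_dca g" for f g :: "('k dgen, base) falg" by (rule times_dca.abs_eq[symmetric])
  show "abs_dca (scal c) = (dca_scal c :: 'k dca)" for c by (rule dca_scal.abs_eq[symmetric])
  show "abs_dca (gen g) = dval g" for g :: "'k dgen" by (cases g) (simp_all add: dca_T.abs_eq dca_t.abs_eq)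
  show "dca_scal 1 = (1 :: 'k dca)" by simp
qed
lemma dca_rel_eval: "x \<approx>A y \<Longrightarrow> free_eval dca_scal dval x = free_eval dca_scal dval y"
  unfolding abs_dca_eval[symmetric] dca.abs_eq_iff by (rule ideal_of_rel)

text \<open>One of two uses of the locale. Here it makes (A1') available in A; in \<open>big\<close>
  it provides a target for a homomorphism out of A.\<close>

lemma dca_is_alg: "dca_alg dca_scal (dca_T :: _ \<Rightarrow> _ \<Rightarrow> _ \<Rightarrow> 'k::finite dca) dca_t"
proof
  note ev = free_evals[OF structure_map_dca_scal, of "dval :: _ \<Rightarrow> 'k dca"] dgen.case
  have r: "free_eval dca_scal dval x = free_eval dca_scal dval y" if "x \<approx>A y" for x y :: "('k dgen, base) falg"
    using that by (rule dca_rel_eval)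
  fix n m p q :: nat and a b :: complex and X Y :: "complex^'k^'k"
  show "structure_map (dca_scal :: _ \<Rightarrow> 'k dca)" by (rule structure_map_dca_scal)
  show "dca_T n m (mat 1) = dca_scal eps2 * (dca_t n m :: 'k dca)" using r[OF dca_rel.A0_unit, of n m] by (simp only: ev)
  show "dca_T n m (mscale a X + mscale b Y) = dca_scal (cst a) * dca_T n m X + dca_scal (cst b) * dca_T n m Y"
    using r[OF dca_rel.A0_lin, of n m a X b Y] by (simp only: ev)
  show "comm (dca_T 0 0 X) (dca_T 0 n Y) = dca_T 0 n (mcomm X Y)" using r[OF dca_rel.A1_T, of X n Y] by (simp only: ev)
  show "comm (dca_T 0 0 X) (dca_t 0 n) = 0" using r[OF dca_rel.A1_t, of X n] by (simp only: ev)
  show "comm (dca_t p q) (dca_T n m X) = of_int (int m * int p - int n * int q) * dca_T (p + n - 1) (q + m - 1) X" if "p + q \<le> 2"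
    using r[OF dca_rel.A2_T[OF that], of n m X] by (simp only: ev)
  show "comm (dca_t p q) (dca_t n m) = of_int (int m * int p - int n * int q) * (dca_t (p + n - 1) (q + m - 1) :: 'k dca)" if "p + q \<le> 2"
    using r[OF dca_rel.A2_t[OF that], of n m] by (simp only: ev)
  show "comm (dca_T 1 0 X) (dca_t 0 n) = of_nat n * dca_T 0 (n - 1) X" using r[OF dca_rel.A3_t, of X n] by (simp only: ev)
  show "comm (dca_T 1 0 X) (dca_T 0 n Y) = dca_T 1 n (mcomm X Y)
    - dca_scal (eps3 TYPE('k) * cst (of_nat n / 2)) * dca_T 0 (n - 1) (macomm X Y)
    - dca_scal (of_nat n * eps1 * cst (trace Y)) * dca_T 0 (n - 1) X
    + dca_scal eps1 * (\<Sum>m<n. dca_scal (cst (of_nat (m + 1) / of_nat (n + 1))) *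
        tens (\<lambda>c. dca_scal (cst c)) (dca_T 0 m) (dca_T 0 (n - 1 - m)) (kron (mcomm X Y) (mat 1) ** Omega))
    + dca_scal eps1 * (\<Sum>m<n.
        tens (\<lambda>c. dca_scal (cst c)) (dca_T 0 m) (dca_T 0 (n - 1 - m))
          ((kron X Y - kron (X ** Y) (mat 1)) ** Omega))"
    using r[OF dca_rel.A3_T, of X n Y] by (simp only: ev)
  show "comm (dca_t 3 0) (dca_t 0 n) = of_nat (3 * n) * dca_t 2 (n - 1)
    + dca_scal (cst (of_nat (n * (n - 1) * (n - 2)) / 4) * (eps1\<^sup>2 - eps2 * eps3 TYPE('k))) * (dca_t 0 (n - 3) :: 'k dca)
    - dca_scal (cst (3 / 2) * eps1) * (\<Sum>m\<le>n - 3. of_nat ((m + 1) * (n - 2 - m)) *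
        (tens (\<lambda>c. dca_scal (cst c)) (dca_T 0 m) (dca_T 0 (n - 3 - m)) Omega
         + dca_scal (eps1 * eps2) * dca_t 0 m * dca_t 0 (n - 3 - m)))" if "3 \<le> n"
    using r[OF dca_rel.A4[OF that]] by (simp only: ev)
qed

interpretation D: dca_alg dca_scal dca_T dca_t by (rule dca_is_alg)

abbreviation LL :: "'k::finite dca \<Rightarrow> 'k dca_loc" where "LL a \<equiv> loc_frac a 0"
lemma LL_add: "LL (a + b) = LL a + LL b" and LL_mult: "LL (a * b) = LL a * LL b" and LL_minus: "LL (- a) = - LL a"
  and LL_0: "LL 0 = 0" and LL_1: "LL 1 = 1"
  by (simp_all add: loc_frac_arith)
lemma LL_diff: "LL (a - b) = LL a - LL b" using LL_add[of a "- b"] by (simp add: LL_minus)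
lemma LL_sum: "LL (sum f A) = (\<Sum>x\<in>A. LL (f x))"
  by (induction A rule: infinite_finite_induct) (simp_all add: LL_0 LL_add)
lemma LL_comm: "LL (comm a b) = comm (LL a) (LL b)" by (simp add: comm_def LL_diff LL_mult)
lemma LL_nat: "LL (of_nat n) = of_nat n" by (induction n) (simp_all add: LL_0 LL_1 LL_add)
lemma LL_int: "LL (of_int z) = of_int z" by (cases z) (simp_all add: LL_nat LL_minus LL_diff LL_1 del: of_nat_Suc)
lemma LL_scal: "LL (dca_scal p) = loc_scal (of_base p)" by (simp add: of_base_def loc_scal_lfrac)
lemma LL_tens: "LL (tens (\<lambda>c. dca_scal (p c)) f g Z) = tens (\<lambda>c. loc_scal (of_base (p c))) (\<lambda>X. LL (f X)) (\<lambda>X. LL (g X)) Z"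
  by (simp add: tens_def LL_sum LL_mult LL_scal)
lemmas LL = LL_add LL_mult LL_minus LL_0 LL_1 LL_diff LL_sum LL_comm LL_nat LL_int LL_scal LL_tens

lemma small_rel_killed: "x \<approx>S y \<Longrightarrow> free_eval loc_scal sgen_val x = free_eval loc_scal sgen_val (y :: ('k::finite sgen, 'k laurent) falg)"
proof (induction rule: small_rel.induct)
  let ?ev = "free_eval loc_scal sgen_val :: ('k sgen, 'k laurent) falg \<Rightarrow> _"
  note ev = free_evals[OF structure_map_loc_scal, of "sgen_val :: 'k sgen \<Rightarrow> _"]
  have T0: "?ev (sT 0 m X) = LL (dca_T 0 m X)" and T1: "?ev (sT 1 0 X) = LL (dca_T 1 0 X)" for m X
    by (simp_all add: sT_def ev)
  have t: "?ev (st 2 0) = LL (dca_t 2 0)" "?ev (st 1 1) = LL (dca_t 1 1)" "?ev (st 0 2) = LL (dca_t 0 2)" by (simp_all add: st_def ev)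
  have evn: "?ev (numeral w) = numeral w" for w using free_eval_of_nat[OF structure_map_loc_scal, of sgen_val "numeral w"] by simp
  have "LL (numeral w) = numeral w" for w using LL_nat[of "numeral w"] by simp
  note LLs = this LL_mult LL_minus LL_0
  {
    case S0_unit
    show ?case unfolding ev T0 t D.A0u LL ..
  next
    case (S0_lin n m a X b Y)
    then show ?case by (elim disjE) (simp_all add: T0 T1 T1[unfolded One_nat_def] ev D.A0l LL)
  next
    case (S1 m X n Y)
    show ?case unfolding ev T0 LL_comm[symmetric] D.S1 ..
  next
    case (S2_t p q m n)
    then have "(p, q) = (2, 0) \<or> (p, q) = (0, 2)" "(m, n) = (0, 2) \<or> (m, n) = (1, 1) \<or> (m, n) = (2, 0)" by auto
    then show ?case
      using dca_alg.A2t[OF dca_is_alg[where 'k = 'k], of p q n m] by (elim disjE) (simp_all add: ev evn t t(2)[unfolded One_nat_def] LLs flip: LL_comm)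
  next
    case (S2_T p q r s X)
    then have "(p, q) = (2, 0) \<or> (p, q) = (0, 2)" "(r, s) = (0, 0) \<or> (r, s) = (1, 0) \<or> (r, s) = (0, 1)" by auto
    then show ?case
      using dca_alg.A2T[OF dca_is_alg[where 'k = 'k], of p q r s X] by (elim disjE) (simp_all add: ev evn t T0 T1 T1[unfolded One_nat_def] LLs flip: LL_comm)
  next
    case (S3 X n Y)
    \<comment> \<open>This instance of (A2) is how (A3') avoids the elements T_{1n}, which are not
      generators of the smaller presentation for n > 0.\<close>
    have "dca_scal (cst (1 / of_nat (2 * n + 2))) * comm (dca_t 2 0) (dca_T 0 (n + 1) (mcomm X Y)) = dca_T 1 n (mcomm X Y)"
    proof -
      have "comm (dca_t 2 0) (dca_T 0 (n + 1) (mcomm X Y)) = of_nat (2 * n + 2) * dca_T 1 n (mcomm X Y)"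
        using D.A2T[of 2 0 0 "n + 1" "mcomm X Y"] by (simp add: algebra_simps mult_2)
      moreover have "(of_nat (2 * n + 2) :: 'k dca) = dca_scal (cst (of_nat (2 * n + 2)))"
      proof -
        have "(of_nat j :: 'k dca) = dca_scal (cst (of_nat j))" for j by (induction j) (simp_all add: D.kk)
        then show ?thesis .
      qed
      moreover have "dca_scal (cst (1 / of_nat (2 * n + 2))) * dca_scal (cst (of_nat (2 * n + 2))) = (1 :: 'k dca)"
        unfolding D.kk(2)[symmetric] using of_nat_eq_0_iff[of "2 * n + 2", where 'a = complex] by (simp add: D.kk del: of_nat_add of_nat_mult)
      ultimately show ?thesis by (simp only: mult.assoc[symmetric] mult_1)
    qed
    then show ?case unfolding ev T0 T1 t LL_comm[symmetric] D.A3T LL[symmetric] by (simp only: LL)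
  }
qed

lemma small_ideal_killed: "ideal_of small_rel \<subseteq> {f. free_eval loc_scal sgen_val f = (0 :: 'k::finite dca_loc)}"
  by (rule ideal_of_killed[OF structure_map_loc_scal small_rel_killed])

\<comment> \<open>The abstract algebra given by the smaller presentation\<close>
quotient_type (overloaded) 'k sq = "('k::finite sgen, 'k laurent) falg" / "\<lambda>x y. x - y \<in> ideal_of small_rel"
proof (rule equivpI)
  show "reflp (\<lambda>x y :: ('k sgen, 'k laurent) falg. x - y \<in> ideal_of small_rel)" by (simp add: reflp_def)
  show "symp (\<lambda>x y :: ('k sgen, 'k laurent) falg. x - y \<in> ideal_of small_rel)"
    by (rule sympI) (metis ideal_of_uminus minus_diff_eq)
  show "transp (\<lambda>x y :: ('k sgen, 'k laurent) falg. x - y \<in> ideal_of small_rel)"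
  proof (rule transpI)
    fix x y z :: "('k sgen, 'k laurent) falg"
    assume "x - y \<in> ideal_of small_rel" "y - z \<in> ideal_of small_rel"
    from ideal_of_add[OF this] show "x - z \<in> ideal_of small_rel" by simp
  qed
qed

instantiation sq :: (finite) ring_1
begin
lift_definition zero_sq :: "'a sq" is 0 .
lift_definition one_sq :: "'a sq" is 1 .
lift_definition plus_sq :: "'a sq \<Rightarrow> 'a sq \<Rightarrow> 'a sq" is "(+)"
  by (metis ideal_of_add add_diff_add)
lift_definition minus_sq :: "'a sq \<Rightarrow> 'a sq \<Rightarrow> 'a sq" is "(-)"
proof -
  fix x x' y y' :: "('a sgen, 'a laurent) falg"
  assume "x - x' \<in> ideal_of small_rel" "y - y' \<in> ideal_of small_rel"
  from ideal_of_diff[OF this] show "x - y - (x' - y') \<in> ideal_of small_rel" by (simp add: algebra_simps)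
qed
lift_definition uminus_sq :: "'a sq \<Rightarrow> 'a sq" is uminus
  by (metis ideal_of_uminus minus_diff_minus)
lift_definition times_sq :: "'a sq \<Rightarrow> 'a sq \<Rightarrow> 'a sq" is "(*)"
proof -
  fix x x' y y' :: "('a sgen, 'a laurent) falg"
  assume "x - x' \<in> ideal_of small_rel" "y - y' \<in> ideal_of small_rel"
  then have "(x - x') * y + x' * (y - y') \<in> ideal_of small_rel"
    by (intro ideal_of_add ideal_of_mult_left ideal_of_mult_right)
  then show "x * y - x' * y' \<in> ideal_of small_rel" by (simp add: algebra_simps)
qed
instance
proof
  \<comment> \<open>Nontriviality is inherited from the localisation of A, where the smaller
    relations already hold.\<close>
  show "(0::'a sq) \<noteq> 1"
  proof (transfer, rule notI)
    assume "0 - 1 \<in> ideal_of (small_rel :: ('a sgen, 'a laurent) falg \<Rightarrow> _)"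
    then have "free_eval loc_scal sgen_val (0 - 1 :: ('a sgen, 'a laurent) falg) = 0" using small_ideal_killed by blast
    then show False by (simp add: free_eval_simps[OF structure_map_loc_scal])
  qed
qed (transfer; simp add: algebra_simps)+
end

definition sq_scal :: "'k::finite laurent \<Rightarrow> 'k sq" where "sq_scal c = abs_sq (scal c)"
definition sq_gen :: "'k::finite sgen \<Rightarrow> 'k sq" where "sq_gen g = abs_sq (gen g)"

lemma structure_map_sq_scal: "structure_map (sq_scal :: 'k::finite laurent \<Rightarrow> _)"
  unfolding structure_map_def sq_scal_def
proof (intro conjI allI)
  fix x y :: "'k laurent" and a :: "'k sq"
  show "abs_sq (scal 1) = (1 :: 'k sq)" by (simp add: one_sq.abs_eq)
  show "abs_sq (scal (x + y)) = (abs_sq (scal x) + abs_sq (scal y) :: 'k sq)" by (simp add: plus_sq.abs_eq)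
  show "abs_sq (scal (x * y)) = (abs_sq (scal x) * abs_sq (scal y) :: 'k sq)" by (simp add: times_sq.abs_eq)
  have "\<exists>f. a = abs_sq f" by (induct a rule: sq.abs_induct) blast
  then obtain f where "a = abs_sq f" ..
  then show "abs_sq (scal x) * a = a * abs_sq (scal x)" by (simp add: times_sq.abs_eq scal_central)
qed

lemma abs_sq_eval: "abs_sq f = free_eval sq_scal sq_gen (f :: ('k::finite sgen, 'k laurent) falg)"
proof (rule falg_hom_unique)
  show "abs_sq (f + g) = abs_sq f + abs_sq g" for f g :: "('k sgen, 'k laurent) falg" by (rule plus_sq.abs_eq[symmetric])
  show "abs_sq (f * g) = abs_sq f * abs_sq g" for f g :: "('k sgen, 'k laurent) falg" by (rule times_sq.abs_eq[symmetric])
  show "sq_scal 1 = (1 :: 'k sq)" using structure_map_sq_scal unfolding structure_map_def by blast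
qed (simp_all add: sq_scal_def sq_gen_def)
lemma abs_sq_0: "abs_sq f = 0 \<longleftrightarrow> f \<in> ideal_of small_rel" by (simp add: zero_sq.abs_eq sq.abs_eq_iff)
lemma small_rel_sq: "x \<approx>S y \<Longrightarrow> free_eval sq_scal sq_gen x = free_eval sq_scal sq_gen (y :: ('k::finite sgen, 'k laurent) falg)"
  unfolding abs_sq_eval[symmetric] sq.abs_eq_iff by (rule ideal_of_rel)

text \<open>ad t_20 raises the first index at the cost of the second and so produces all T_nm from
  the T_0n; the t_nm then need the inverse of e2, and general fractions the inverses of both e2 and
  e3.\<close>

lemma surj_small: "surj (free_eval loc_scal (sgen_val :: 'k::finite sgen \<Rightarrow> _))"
proof -
  let ?ev = "free_eval loc_scal sgen_val :: ('k sgen, 'k laurent) falg \<Rightarrow> _"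
  note ev = free_evals[OF structure_map_loc_scal, of "sgen_val :: 'k sgen \<Rightarrow> _"]
  define I where "I = range ?ev"
  have c: "loc_scal p \<in> I" for p using ev(8)[of p, symmetric] unfolding I_def by (rule range_eqI)
  have add: "x + y \<in> I" and mult: "x * y \<in> I" and diff: "x - y \<in> I" if "x \<in> I" "y \<in> I" for x y
    using that unfolding I_def by (auto simp flip: ev(3,4,6))
  have g: "sgen_val s \<in> I" for s using ev(9)[of s, symmetric] unfolding I_def by (rule range_eqI)
  have sc: "LL (dca_scal p) \<in> I" for p unfolding LL_scal by (rule c)
  have T0: "LL (dca_T 0 n X) \<in> I" for n X using g[of "S_T0 n X"] by simp
  have t20: "LL (dca_t 2 0) \<in> I" using g[of S_t20] by simp
  have T: "LL (dca_T n m X) \<in> I" for n m X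
  proof (induction n arbitrary: m)
    case (Suc n)
    have on: "dca_scal (cst (of_nat j)) = (of_nat j :: 'k dca)" for j by (induction j) (simp_all add: D.kk)
    have "comm (dca_t 2 0) (dca_T n (Suc m) X) = of_nat (2 * Suc m) * dca_T (Suc n) m X"
      using D.A2T[of 2 0 n "Suc m" X] by (simp add: algebra_simps mult_2)
    then have "dca_scal (cst (1 / of_nat (2 * Suc m))) * comm (dca_t 2 0) (dca_T n (Suc m) X)
        = dca_scal (cst (1 / of_nat (2 * Suc m) * of_nat (2 * Suc m))) * dca_T (Suc n) m X"
      unfolding D.kk(2) on by (simp only: mult.assoc)
    also have "\<dots> = dca_T (Suc n) m X" by (simp add: D.kk del: of_nat_Suc of_nat_mult mult_Suc mult_Suc_right)
    finally have "LL (dca_T (Suc n) m X) = LL (dca_scal (cst (1 / of_nat (2 * Suc m)))) * (LL (dca_t 2 0) * LL (dca_T n (Suc m) X) - LL (dca_T n (Suc m) X) * LL (dca_t 2 0))"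
      by (simp only: LL_mult[symmetric] LL_diff[symmetric] comm_def)
    then show ?case using sc t20 Suc.IH by (simp only: mult diff)
  qed (rule T0)
  have t: "LL (dca_t n m :: 'k dca) \<in> I" for n m
  proof -
    have "LL (dca_t n m :: 'k dca) = loc_scal (lfrac 1 (1, 0)) * LL (dca_T n m (mat 1))"
      unfolding loc_scal_lfrac D.A0u loc_frac_arith
      by (simp add: loc_frac_eq_iff den_def dca_smult_def)
    then show ?thesis by (simp only: mult c T)
  qed
  have A: "LL a \<in> I" for a :: "'k dca"
  proof -
    have "\<exists>f. a = abs_dca f" by (induct a rule: dca.abs_induct) blast
    then obtain f where a: "a = abs_dca f" ..
    have gen: "LL (dval s) \<in> I" for s :: "'k dgen" by (cases s) (simp_all add: T t)
    have 0: "0 \<in> I" and 1: "1 \<in> I" using sc[of 0] sc[of 1] by (simp_all add: LL_0 LL_1)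
    have p: "LL (prod_list (map dval l)) \<in> I" for l :: "'k dgen list"
      by (induction l) (simp_all add: LL_1 LL_mult 1 mult gen)
    have s: "(\<And>x. x \<in> S \<Longrightarrow> h x \<in> I) \<Longrightarrow> sum h S \<in> I" for h :: "'k dgen fmonoid \<Rightarrow> _" and S
      by (induction S rule: infinite_finite_induct) (auto intro: 0 add)
    show ?thesis unfolding a abs_dca_eval free_eval_def LL_sum LL_mult by (intro s mult sc p)
  qed
  have "x \<in> I" for x
  proof -
    obtain a d where x: "x = loc_frac a d" by (rule loc_frac_cases)
    have "x = loc_scal (lfrac 1 d) * LL a" unfolding x loc_scal_lfrac loc_frac_arith by simp
    then show ?thesis by (simp only: mult c A)
  qed
  then show ?thesis unfolding I_def by blast
qed

section \<open>A differential ring of generating series\<close>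

text \<open>The central elements act as operators instead of being ring elements, so that the
  simplifier pulls them out of products in one direction. Injectivity of \<open>U\<close> and
  characteristic 0 permit cancelling powers of u and integers.\<close>

locale dring =
  fixes d U E1 E3 :: "'r::ring_1 \<Rightarrow> 'r"
  assumes d_add[simp]: "d (x + z) = d x + d z"
    and d_mult[simp]: "d (x * z) = d x * z + x * d z"
    and U_add[simp]: "U (x + z) = U x + U z"
    and U_mult[simp]: "U x * z = U (x * z)" "x * U z = U (x * z)"
    and E1_add[simp]: "E1 (x + z) = E1 x + E1 z"
    and E1_mult[simp]: "E1 x * z = E1 (x * z)" "x * E1 z = E1 (x * z)"
    and E3_add[simp]: "E3 (x + z) = E3 x + E3 z"
    and E3_mult[simp]: "E3 x * z = E3 (x * z)" "x * E3 z = E3 (x * z)"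
    and d_U[simp]: "d (U x) = x + U (d x)"
    and d_E1[simp]: "d (E1 x) = E1 (d x)"
    and d_E3[simp]: "d (E3 x) = E3 (d x)"
    and UE[simp]: "U (E1 x) = E1 (U x)" "U (E3 x) = E3 (U x)" "E3 (E1 x) = E1 (E3 x)"
    and U_inj: "U x = 0 \<Longrightarrow> x = 0"
    and char0: "0 < n \<Longrightarrow> of_nat n * x = 0 \<Longrightarrow> x = (0::'r)"
begin

lemma d_0[simp]: "d 0 = 0" using d_add[of 0 0] by simp
lemma U_0[simp]: "U 0 = 0" using U_add[of 0 0] by simp
lemma E1_0[simp]: "E1 0 = 0" using E1_add[of 0 0] by simp
lemma E3_0[simp]: "E3 0 = 0" using E3_add[of 0 0] by simp
lemma d_minus[simp]: "d (- x) = - d x" using d_add[of x "-x"] by (simp add: minus_unique)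
lemma U_minus[simp]: "U (- x) = - U x" using U_add[of x "-x"] by (simp add: minus_unique)
lemma E1_minus[simp]: "E1 (- x) = - E1 x" using E1_add[of x "-x"] by (simp add: minus_unique)
lemma E3_minus[simp]: "E3 (- x) = - E3 x" using E3_add[of x "-x"] by (simp add: minus_unique)
lemma d_diff[simp]: "d (x - z) = d x - d z" using d_add[of x "-z"] by simp
lemma U_diff[simp]: "U (x - z) = U x - U z" using U_add[of x "-z"] by simp
lemma E1_diff[simp]: "E1 (x - z) = E1 x - E1 z" using E1_add[of x "-z"] by simp
lemma E3_diff[simp]: "E3 (x - z) = E3 x - E3 z" using E3_add[of x "-z"] by simp
lemma d_sum[simp]: "d (sum f A) = (\<Sum>x\<in>A. d (f x))" by (induction A rule: infinite_finite_induct) auto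
lemma U_sum[simp]: "U (sum f A) = (\<Sum>x\<in>A. U (f x))" by (induction A rule: infinite_finite_induct) auto
lemma E1_sum[simp]: "E1 (sum f A) = (\<Sum>x\<in>A. E1 (f x))" by (induction A rule: infinite_finite_induct) auto
lemma E3_sum[simp]: "E3 (sum f A) = (\<Sum>x\<in>A. E3 (f x))" by (induction A rule: infinite_finite_induct) auto
lemma U_cancel: "U x = U z \<longleftrightarrow> x = z" using U_inj[of "x - z"] by auto
lemma two_cancel: "x + x = z + z \<longleftrightarrow> x = (z::'r)"
  using char0[of 2 "x - z"] by (auto simp: mult_2 algebra_simps)

text \<open>This derivation u^2 d/du, unlike d/du, sends each of the letters y, y1, h, m to a
  combination of letters with powers of u (\<open>dd_atoms\<close>), so it can be rewritten
  away.\<close>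

definition dd :: "'r \<Rightarrow> 'r" where "dd x = U (U (d x))"
lemma dd_simps[simp]: "dd (x + z) = dd x + dd z" "dd (x - z) = dd x - dd z" "dd (-x) = - dd x" "dd 0 = 0"
  "dd (x * z) = dd x * z + x * dd z" "dd (U x) = U (U x) + U (dd x)" "dd (E1 x) = E1 (dd x)" "dd (E3 x) = E3 (dd x)"
  "dd (sum f A) = (\<Sum>a\<in>A. dd (f a))"
  by (simp_all add: dd_def)
text \<open>Multiplying by u^2 before differentiating leaves no lower terms: y1 becomes 2 h, and h
  becomes 3 u^2 m.\<close>

definition del :: "'r \<Rightarrow> 'r" where "del x = d (U (U x))"
lemma dd_fold: "U (U (d x)) = dd x" "U (U (z * d x)) = z * dd x" "U (U (d x * z)) = dd x * z"
  "U (U (w * (z * d x))) = w * (z * dd x)" "U (U (w * (d x * z))) = w * (dd x * z)"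
  by (simp_all add: dd_def)
lemma del_alt: "del x = dd x + U x + U x" by (simp add: del_def dd_def)
definition acomm :: "'r \<Rightarrow> 'r \<Rightarrow> 'r" where "acomm x y = x * y + y * x"
end

text \<open>Here \<open>d\<close> stands for \<open>d/du\<close>, \<open>U\<close> for multiplication by \<open>u\<close>, \<open>E1\<close> and \<open>E3\<close> for multiplication by
  \<open>\<epsilon>\<^sub>1\<close> and \<open>\<epsilon>\<^sub>3\<close>. The letters \<open>y, y1, h, m, r\<close> are \<open>u\<^sup>e \<Sum>\<^sub>n (n + q choose q) T\<^sub>0\<^sub>n(E\<^sub>a\<^sub>b) u\<^sup>n\<close> with \<open>q = 0, \<dots>, 4\<close>
  and \<open>e = 1, 0, 1, 0, 1\<close>; \<open>s\<close> is the series of the \<open>(n + 1) T\<^sub>1\<^sub>n(E\<^sub>a\<^sub>b)\<close>, \<open>X\<close> is \<open>T\<^sub>1\<^sub>0(E\<^sub>a\<^sub>b)\<close> and \<open>F\<close> is \<open>t\<^sub>2\<^sub>0\<close>.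
  Integer multiples are written as sums (\<open>Tw\<close>, \<open>Th\<close>), which keeps the simplifier's normal forms
  free of numerals.\<close>

locale cur = dring d U E1 E3 for d U E1 E3 :: "'r::ring_1 \<Rightarrow> 'r" +
  fixes y y1 h m r G s X :: "'k::finite \<Rightarrow> 'k \<Rightarrow> 'r" and F :: 'r
  assumes dy[simp]: "d (y a b) = y1 a b"
    and dy1: "d (U (U (y1 a b))) = h a b + h a b"
    and dh: "d (U (U (h a b))) = U (U (m a b + m a b + m a b))"
    and dm: "d (U (U (U (U (m a b))))) = U (U (r a b + r a b + r a b + r a b))"
    and yy: "comm (y a b) (y c e) = (if b = c then U (U (y1 a e)) else 0) - (if a = e then U (U (y1 c b)) else 0)"
    and y1y: "comm (y1 a b) (y c e) = (if b = c then h a e else 0) - (if a = e then h c b else 0)"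
    and y1y1: "comm (y1 a b) (y1 c e) = (if b = c then m a e else 0) - (if a = e then m c b else 0)"
    and hy: "comm (h a b) (y c e) = (if b = c then U (U (m a e)) else 0) - (if a = e then U (U (m c b)) else 0)"
    and hy1: "comm (h a b) (y1 c e) = (if b = c then r a e else 0) - (if a = e then r c b else 0)"
    and my: "comm (m a b) (y c e) = (if b = c then r a e else 0) - (if a = e then r c b else 0)"
    and dF[simp]: "d F = 0" and dX[simp]: "d (X a b) = 0"
    and FX: "comm F (X a b) = 0"
    and Fy: "comm F (y a b) = U (U (s a b + s a b))"
    and dG: "d (G a b) = s a b - E3 (h a b) - E1 (\<Sum>c\<in>UNIV. y a c * y1 c b)"
begin
text \<open>In [X_ab, y_ce] the terms with b = c form \<open>G\<close> and those with a = e form, up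
  to sign, \<open>H\<close>. Their difference contains no s, and several cancellations rest on
  that.\<close>

definition H where "H a b = G a b + E3 (U (U (y1 a b))) + E1 (\<Sum>c\<in>UNIV. y a c * y c b)"
end

text \<open>The added assumption is (A3') for matrix units in the language of series. It is split
  off from \<open>cur\<close> because it refers to \<open>H\<close>, which is defined there.\<close>

locale cur2 = cur d U E1 E3 y y1 h m r G s X F for d U E1 E3 :: "'r::ring_1 \<Rightarrow> 'r"
  and y y1 h m r G s X :: "'k::finite \<Rightarrow> 'k \<Rightarrow> 'r" and F :: 'r +
  assumes Xy: "comm (X a b) (y c e) = (if b = c then G a e else 0) - (if a = e then H c b else 0)
     - (if c = e then E1 (U (U (y1 a b))) else 0) + E1 (y a e * y c b)"
begin

lemma dH: "d (H a b) = s a b + E3 (h a b) + E1 (\<Sum>c\<in>UNIV. y1 a c * y c b)"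
  using dy1[of a b] by (simp add: H_def dG sum.distrib algebra_simps)

lemma UUdy1: "U (U (d (y1 a b))) = h a b + h a b - U (y1 a b) - U (y1 a b)"
  using dy1[of a b] by (simp add: algebra_simps)
lemma UUdh: "U (U (d (h a b))) = U (U (m a b)) + U (U (m a b)) + U (U (m a b)) - U (h a b) - U (h a b)"
  using dh[of a b] by (simp add: algebra_simps)
lemma UUdm: "U (U (d (m a b))) = r a b + r a b + r a b + r a b - U (m a b)- U (m a b)- U (m a b)- U (m a b)"
proof -
  have "U (U (U (U (d (m a b))))) = U (U (r a b + r a b + r a b + r a b - U (m a b)- U (m a b)- U (m a b)- U (m a b)))"
    using dm[of a b] by (simp add: algebra_simps)
  thus ?thesis by (simp only: U_cancel)
qed

lemma dd_atoms[simp]: "dd (y a b) = U (U (y1 a b))" "dd (y1 a b) = h a b + h a b - U (y1 a b) - U (y1 a b)"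
  "dd (h a b) = U (U (m a b)) + U (U (m a b)) + U (U (m a b)) - U (h a b) - U (h a b)"
  "dd (m a b) = r a b + r a b + r a b + r a b - U (m a b)- U (m a b)- U (m a b)- U (m a b)"
  by (simp_all add: dd_def UUdy1 UUdh UUdm)

lemma del_simps: "del (x + z) = del x + del z" "del (x - z) = del x - del z" "del (-x) = - del x" "del 0 = 0"
  "del (E1 x) = E1 (del x)" "del (E3 x) = E3 (del x)" "del (sum f A) = (\<Sum>a\<in>A. del (f a))"
  by (simp_all add: del_def)
lemma del_y1: "del (y1 a b) = h a b + h a b" by (simp add: del_alt)
lemma del_h: "del (h a b) = U (U (m a b)) + U (U (m a b)) + U (U (m a b))" by (simp add: del_alt)

lemma y1h: "comm (y1 c e) (h a b) = (if a = e then r c b else 0) - (if b = c then r a e else 0)"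
  using hy1[of a b c e] by (auto simp: comm_def algebra_simps split: if_splits)

text \<open>\<open>G\<close> is known only through its derivative. Off the diagonal,
  \<open>G\<close> and \<open>H\<close> are brackets with a diagonal X up to a product, which opens
  them to the Jacobi identity.\<close>

lemma Gib: assumes "b \<noteq> i" shows "G i b = comm (X i i) (y i b) - E1 (y i b * y i i)"
  using Xy[of i i i b] assms by simp
lemma Hbj: assumes "b \<noteq> j" shows "H b j = E1 (y j j * y b j) - comm (X j j) (y b j)"
  using Xy[of j j b j] assms by simp

lemma jac: "comm (comm x z) w = comm x (comm z w) - comm z (comm x w)" "comm z (comm x w) = comm x (comm z w) - comm (comm x z) w"
  for x z w :: 'r by (simp_all add: comm_def algebra_simps)
lemma comm_lin: "comm (x + z) w = comm x w + comm z w" "comm (x - z) w = comm x w - comm z w" "comm (E1 x) w = E1 (comm x w)"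
   "comm (E3 x) w = E3 (comm x w)" "comm (U x) w = U (comm x w)" "comm (- x) w = - comm x w" "comm 0 w = 0"
   "comm w (x + z) = comm w x + comm w z" "comm w (x - z) = comm w x - comm w z" "comm w (E1 x) = E1 (comm w x)"
   "comm w (E3 x) = E3 (comm w x)" "comm w (U x) = U (comm w x)" "comm w (- x) = - comm w x" "comm w 0 = 0"
   "comm (x * z) w = comm x w * z + x * comm z w" "comm w (x * z) = comm w x * z + x * comm w z"
   "comm (sum f A) w = (\<Sum>a\<in>A. comm (f a) w)" "comm w (sum f A) = (\<Sum>a\<in>A. comm w (f a))"
  for x z w :: 'r by (simp_all add: comm_def algebra_simps sum_distrib_left sum_distrib_right sum_subtractf)

lemma dcX: "d (comm (X a b) z) = comm (X a b) (d z)" by (simp add: comm_def)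
lemma dcF: "d (comm F z) = comm F (d z)" by (simp add: comm_def)
lemma d_comm: "d (comm x z) = comm (d x) z + comm x (d z)" by (simp add: comm_def algebra_simps)
lemma yy1: "comm (y a b) (y1 c e) = (if b = c then h a e else 0) - (if a = e then h c b else 0)"
  using y1y[of c e a b] by (auto simp: comm_def algebra_simps split: if_splits)

lemma Xy1: "comm (X a b) (y1 c e) = (if b = c then d (G a e) else 0) - (if a = e then d (H c b) else 0)
     - (if c = e then E1 (h a b + h a b) else 0) + E1 (y1 a e * y c b + y a e * y1 c b)"
proof -
  have "comm (X a b) (y1 c e) = d (comm (X a b) (y c e))" by (simp add: dcX)
  then show ?thesis unfolding Xy using dy1[of a b] by (cases "b = c"; cases "a = e"; cases "c = e") (simp_all add: algebra_simps)
qed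

lemma GyA: assumes "b \<noteq> i" "b \<noteq> j" "i \<noteq> j"
  shows "comm (G i b) (y b j) = U (U (d (G i j))) + E1 (U (U (y i j * y1 b b)))"
  using assms unfolding Gib[OF assms(1)] comm_lin(2,3) jac(1)[of "X i i"]
  by (simp add: comm_lin yy Xy Xy1) (simp add: algebra_simps)

lemma GyB: assumes "b \<noteq> i" "b \<noteq> j" "i \<noteq> j"
  shows "comm (y i b) (H b j) = U (U (d (H i j))) - E1 (U (U (y1 b b * y i j)))"
  using assms unfolding Hbj[OF assms(2)] comm_lin(9,10) jac(2)[of _ "X j j"]
  by (simp add: comm_lin yy Xy Xy1) (simp add: algebra_simps)

text \<open>\<open>del (del y1)\<close> is 6 u^2 m, and d and U commute with the bracket because
  X_ab is constant. Brackets of X with m thus follow from those with y.\<close>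

lemma X6m: "U (U (comm (X a b) (m c e) + comm (X a b) (m c e) + comm (X a b) (m c e) + comm (X a b) (m c e)
   + comm (X a b) (m c e) + comm (X a b) (m c e))) = del (del (d (comm (X a b) (y c e))))"
proof -
  have "del (del (d (comm (X a b) (y c e)))) = comm (X a b) (del (del (y1 c e)))"
    by (simp add: del_def dcX comm_lin(12)[symmetric] del: d_U)
  also have "del (del (y1 c e)) = U (U (m c e + m c e + m c e + m c e + m c e + m c e))"
    by (simp add: del_y1 del_simps del_h algebra_simps)
  finally show ?thesis by (simp add: comm_lin)
qed

lemma q1: assumes "b \<noteq> i" "b \<noteq> j" "i \<noteq> j"
  shows "comm (\<Sum>c\<in>UNIV. y i c * y1 c b) (y b j) = (\<Sum>c\<in>UNIV. y i c * h c j) - y i j * h b b + U (U (y1 i j * y1 b b))"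
  using assms by (simp add: comm_lin yy y1y sum.distrib sum_subtractf if_distrib[of "\<lambda>x. x * _"] if_distrib[of "\<lambda>x. _ * x"] algebra_simps cong: if_cong)
lemma q2: assumes "b \<noteq> i" "b \<noteq> j" "i \<noteq> j"
  shows "comm (\<Sum>c\<in>UNIV. y i c * y1 c b) (y1 b j) = (\<Sum>c\<in>UNIV. y i c * m c j) - y i j * m b b + h i j * y1 b b"
  using assms by (simp add: comm_lin yy1 y1y1 sum.distrib sum_subtractf if_distrib[of "\<lambda>x. x * _"] if_distrib[of "\<lambda>x. _ * x"] algebra_simps cong: if_cong)
lemma q3: assumes "b \<noteq> i" "b \<noteq> j" "i \<noteq> j"
  shows "comm (y i b) (\<Sum>c\<in>UNIV. y1 b c * y c j) = (\<Sum>c\<in>UNIV. h i c * y c j) - h b b * y i j + U (U (y1 b b * y1 i j))"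
  using assms by (simp add: comm_lin yy yy1 sum.distrib sum_subtractf if_distrib[of "\<lambda>x. x * _"] if_distrib[of "\<lambda>x. _ * x"] algebra_simps cong: if_cong)
lemma q4: assumes "b \<noteq> i" "b \<noteq> j" "i \<noteq> j"
  shows "comm (y1 i b) (\<Sum>c\<in>UNIV. y1 b c * y c j) = (\<Sum>c\<in>UNIV. m i c * y c j) - m b b * y i j + y1 b b * h i j"
  using assms by (simp add: comm_lin y1y y1y1 sum.distrib sum_subtractf if_distrib[of "\<lambda>x. x * _"] if_distrib[of "\<lambda>x. _ * x"] algebra_simps cong: if_cong)

text \<open>One sixth of the image of the sum of the y_ic y_cj under \<open>d\<close> followed by
  \<open>del\<close> twice; see \<open>qyy\<close>.\<close>

definition "V i j = U (U (\<Sum>c\<in>UNIV. m i c * y c j + y i c * m c j + h i c * y1 c j + y1 i c * h c j))"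

abbreviation "Tw \<equiv> \<lambda>x::'r. x + x"
abbreviation "Th \<equiv> \<lambda>x::'r. x + x + x"

text \<open>The factor 3 makes 6 u^2 [X_ii, m_ij] appear, to which \<open>X6m\<close> applies. The
  derivative of \<open>GyA\<close> accounts for the two remaining brackets.\<close>

lemma S2a: assumes "b \<noteq> i" "b \<noteq> j" "i \<noteq> j"
  shows "Th (U (U (Tw (comm (d (G i b)) (y1 b j)))) - del (comm (d (G i b)) (y b j)) - del (comm (G i b) (y1 b j)))
   = - Tw (del (del (d (G i j)))) - Th (E1 (U (U (Tw (h i j * y1 b b) + Tw (y1 i j * h b b) + Tw (Tw (y i j * m b b))))))"
    (is "?L = ?R")
proof -
  have A: "comm (d (G i b)) (y b j) + comm (G i b) (y1 b j) = del (d (G i j)) + E1 (del (y i j * y1 b b))"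
    using d_comm[of "G i b" "y b j"] GyA[OF assms] by (simp only: d_add d_E1 del_def dy)
  have dG': "d (G i b) = comm (X i i) (y1 i b) - E1 (y1 i b * y i i + y i b * y1 i i)"
    using Xy1[of i i i b] assms by (simp add: algebra_simps)
  have B: "comm (d (G i b)) (y1 b j) = comm (X i i) (m i j) - E1 (y1 i j * (h i i - h b b) + y i j * (m i i - m b b) + m i j * y i i + h i j * y1 i i)"
    using assms unfolding dG' comm_lin(2,3) jac(1)[of "X i i"]
    by (simp add: comm_lin Xy1 Xy yy yy1 y1y y1y1 algebra_simps)
  have "?L = U (U (Th (Tw (comm (X i i) (m i j))))) - E1 (U (U (Th (Tw (y1 i j * (h i i - h b b) + y i j * (m i i - m b b) + m i j * y i i + h i j * y1 i i)))))
     - Th (del (comm (d (G i b)) (y b j) + comm (G i b) (y1 b j)))"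
    unfolding B by (simp add: del_simps algebra_simps)
  also have "U (U (Th (Tw (comm (X i i) (m i j))))) = del (del (d (G i j + E1 (y i j * y i i))))"
    using X6m[of i i i j] Xy[of i i i j] assms by (simp add: algebra_simps)
  also have "del (del (d (G i j + E1 (y i j * y i i)))) = del (del (d (G i j))) + E1 (del (del (d (y i j * y i i))))"
    by (simp only: d_add d_E1 del_simps d_minus)
  finally show ?thesis unfolding A del_simps by (simp add: del_alt[of "_ * _"] del_alt[of "_ + _"] del_alt[of "U _"] del_alt[of "y _ _"] dd_fold algebra_simps)
qed

lemma S2b: assumes "b \<noteq> i" "b \<noteq> j" "i \<noteq> j"
  shows "Th (- U (U (Tw (comm (y1 i b) (d (H b j))))) + del (comm (y i b) (d (H b j))) + del (comm (y1 i b) (H b j)))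
   = Tw (del (del (d (H i j)))) - Th (E1 (U (U (Tw (y1 b b * h i j) + Tw (h b b * y1 i j) + Tw (Tw (m b b * y i j))))))"
    (is "?L = ?R")
proof -
  have A: "comm (y i b) (d (H b j)) + comm (y1 i b) (H b j) = del (d (H i j)) - E1 (del (y1 b b * y i j))"
    using d_comm[of "y i b" "H b j"] GyB[OF assms] by (simp only: d_diff d_E1 del_def dy add.commute)
  have dH': "d (H b j) = E1 (y1 j j * y b j + y j j * y1 b j) - comm (X j j) (y1 b j)"
    using Xy1[of j j b j] assms by (simp add: algebra_simps)
  have B: "comm (y1 i b) (d (H b j)) = - comm (X j j) (m i j) + E1 ((m j j - m b b) * y i j + (h j j - h b b) * y1 i j + y j j * m i j + y1 j j * h i j)"
    using assms unfolding dH' comm_lin(9,10) jac(2)[of _ "X j j"]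
    by (simp add: comm_lin Xy1 Xy yy yy1 y1y y1y1 algebra_simps)
  have "?L = U (U (Th (Tw (comm (X j j) (m i j))))) - E1 (U (U (Th (Tw ((m j j - m b b) * y i j + (h j j - h b b) * y1 i j + y j j * m i j + y1 j j * h i j)))))
     + Th (del (comm (y i b) (d (H b j)) + comm (y1 i b) (H b j)))"
    unfolding B by (simp add: del_simps algebra_simps)
  also have "U (U (Th (Tw (comm (X j j) (m i j))))) = del (del (d (- H i j + E1 (y j j * y i j))))"
    using X6m[of j j i j] Xy[of j j i j] assms by (simp add: algebra_simps)
  also have "del (del (d (- H i j + E1 (y j j * y i j)))) = - del (del (d (H i j))) + E1 (del (del (d (y j j * y i j))))"
    by (simp only: d_add d_E1 del_simps d_minus)
  finally show ?thesis unfolding A del_simps by (simp add: del_alt[of "_ * _"] del_alt[of "_ + _"] del_alt[of "U _"] del_alt[of "y _ _"] dd_fold algebra_simps)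
qed

lemma three_cancel: "Th x = Th z \<longleftrightarrow> x = (z::'r)"
proof -
  have "of_nat (Suc (Suc (Suc 0))) * w = Th w" for w :: 'r
    by (simp only: of_nat_Suc of_nat_0 distrib_right mult_1_left mult_zero_left add_0_right add.assoc)
  then show ?thesis using char0[of "Suc (Suc (Suc 0))" "x - z"] by (auto simp: algebra_simps)
qed

lemma qyy: "del (del (d (\<Sum>c\<in>UNIV. y i c * y c j))) = Th (Tw (V i j))"
  by (simp add: V_def del_alt sum.distrib sum_subtractf algebra_simps)
lemma q12: "Tw (U (U (\<Sum>c\<in>UNIV. y i c * m c j))) - del (\<Sum>c\<in>UNIV. y i c * h c j)
    + Tw (U (U (\<Sum>c\<in>UNIV. m i c * y c j))) - del (\<Sum>c\<in>UNIV. h i c * y c j) = - V i j"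
  by (simp add: V_def del_alt sum.distrib sum_subtractf algebra_simps)

lemma sG: "s a b = d (G a b) + E3 (h a b) + E1 (\<Sum>c\<in>UNIV. y a c * y1 c b)" by (simp add: dG)
lemma sH: "s a b = d (H a b) - E3 (h a b) - E1 (\<Sum>c\<in>UNIV. y1 a c * y c b)" by (simp add: dH)

text \<open>Writing s_ib through \<open>G\<close> and s_bj through \<open>H\<close> lets
  \<open>S2a\<close> and \<open>S2b\<close> be added. Their leading terms leave only the difference
  of \<open>H i j\<close> and \<open>G i j\<close>, which is free of s. The factor 3 is cancelled at
  the end.\<close>

lemma S2: assumes "b \<noteq> i" "b \<noteq> j" "i \<noteq> j"
  shows "Tw (U (U (comm (s i b) (y1 b j)))) - Tw (U (U (comm (y1 i b) (s b j)))) - del (comm (s i b) (y b j)) + del (comm (y i b) (s b j))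
     - del (comm (G i b) (y1 b j)) + del (comm (y1 i b) (H b j))
   = E3 (U (U (Th (Tw (Tw (r i j)))))) + E1 (Th (V i j)) - E1 (U (U (Th (y i j * m b b + m b b * y i j) + Th (y1 i j * h b b + h b b * y1 i j)
        + Tw (h i j * y1 b b + y1 b b * h i j))))" (is "?L = ?R")
proof -
  have e3: "comm (h i b) (y1 b j) + comm (y1 i b) (h b j) = Tw (r i j)" using hy1[of i b b j] y1h[of i b b j] assms by simp
  have e3': "comm (h i b) (y b j) = U (U (m i j))" "comm (y i b) (h b j) = U (U (m i j))"
    using hy[of i b b j] hy[of b j i b] assms by (auto simp: comm_def algebra_simps)
  have "?L = (U (U (Tw (comm (d (G i b)) (y1 b j)))) - del (comm (d (G i b)) (y b j)) - del (comm (G i b) (y1 b j)))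
     + (- U (U (Tw (comm (y1 i b) (d (H b j))))) + del (comm (y i b) (d (H b j))) + del (comm (y1 i b) (H b j)))
     + E3 (Tw (U (U (comm (h i b) (y1 b j) + comm (y1 i b) (h b j)))) - del (comm (h i b) (y b j)) - del (comm (y i b) (h b j)))
     + E1 (Tw (U (U (comm (\<Sum>c\<in>UNIV. y i c * y1 c b) (y1 b j)))) - del (comm (\<Sum>c\<in>UNIV. y i c * y1 c b) (y b j))
        + Tw (U (U (comm (y1 i b) (\<Sum>c\<in>UNIV. y1 b c * y c j)))) - del (comm (y i b) (\<Sum>c\<in>UNIV. y1 b c * y c j)))"
    unfolding sG[of i b] sH[of b j] comm_lin(1,2,3,4,8,9,10,11) del_simps U_add U_diff E1_add E1_diff E3_add E3_diff UE
    by (simp only: algebra_simps minus_add_distrib minus_diff_eq minus_minus add_uminus_conv_diff uminus_add_conv_diff)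
  also have "E3 (Tw (U (U (comm (h i b) (y1 b j) + comm (y1 i b) (h b j)))) - del (comm (h i b) (y b j)) - del (comm (y i b) (h b j)))
     = - E3 (Tw (Tw (U (U (r i j)))))"
    unfolding e3 e3' by (simp add: del_alt algebra_simps)
  also have "E1 (Tw (U (U (comm (\<Sum>c\<in>UNIV. y i c * y1 c b) (y1 b j)))) - del (comm (\<Sum>c\<in>UNIV. y i c * y1 c b) (y b j))
        + Tw (U (U (comm (y1 i b) (\<Sum>c\<in>UNIV. y1 b c * y c j)))) - del (comm (y i b) (\<Sum>c\<in>UNIV. y1 b c * y c j)))
    = - E1 (V i j) + E1 (Tw (U (U (h i j * y1 b b - y i j * m b b))) + Tw (U (U (y1 b b * h i j - m b b * y i j)))
       + del (y i j * h b b - U (U (y1 i j * y1 b b))) + del (h b b * y i j - U (U (y1 b b * y1 i j))))" (is "E1 ?A = _")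
  proof -
    have "?A = (Tw (U (U (\<Sum>c\<in>UNIV. y i c * m c j))) - del (\<Sum>c\<in>UNIV. y i c * h c j)
    + Tw (U (U (\<Sum>c\<in>UNIV. m i c * y c j))) - del (\<Sum>c\<in>UNIV. h i c * y c j)) + (Tw (U (U (h i j * y1 b b - y i j * m b b))) + Tw (U (U (y1 b b * h i j - m b b * y i j)))
       + del (y i j * h b b - U (U (y1 i j * y1 b b))) + del (h b b * y i j - U (U (y1 b b * y1 i j))))"
      unfolding q1[OF assms] q2[OF assms] q3[OF assms] q4[OF assms] del_simps U_add U_diff by (simp only: algebra_simps minus_add_distrib minus_diff_eq minus_minus add_uminus_conv_diff uminus_add_conv_diff)
    then show ?thesis unfolding q12 by simp
  qed
  finally have L0: "?L = (U (U (Tw (comm (d (G i b)) (y1 b j)))) - del (comm (d (G i b)) (y b j)) - del (comm (G i b) (y1 b j)))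
     + (- U (U (Tw (comm (y1 i b) (d (H b j))))) + del (comm (y i b) (d (H b j))) + del (comm (y1 i b) (H b j)))
     + (- E3 (Tw (Tw (U (U (r i j))))) - E1 (V i j) + E1 (Tw (U (U (h i j * y1 b b - y i j * m b b))) + Tw (U (U (y1 b b * h i j - m b b * y i j)))
       + del (y i j * h b b - U (U (y1 i j * y1 b b))) + del (h b b * y i j - U (U (y1 b b * y1 i j)))))"
    by (simp only: algebra_simps minus_add_distrib minus_diff_eq minus_minus add_uminus_conv_diff uminus_add_conv_diff)
  have L: "Th ?L = Th (U (U (Tw (comm (d (G i b)) (y1 b j)))) - del (comm (d (G i b)) (y b j)) - del (comm (G i b) (y1 b j)))
     + Th (- U (U (Tw (comm (y1 i b) (d (H b j))))) + del (comm (y i b) (d (H b j))) + del (comm (y1 i b) (H b j)))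
     + Th (- E3 (Tw (Tw (U (U (r i j))))) - E1 (V i j) + E1 (Tw (U (U (h i j * y1 b b - y i j * m b b))) + Tw (U (U (y1 b b * h i j - m b b * y i j)))
       + del (y i j * h b b - U (U (y1 i j * y1 b b))) + del (h b b * y i j - U (U (y1 b b * y1 i j)))))"
    unfolding L0 by (simp only: add_ac)
  have qGH: "del (del (d (H i j))) - del (del (d (G i j))) = E3 (Th (Tw (Tw (Tw (U (U (r i j))))))) + E1 (Th (Tw (V i j)))"
  proof -
    have "del (del (d (H i j))) - del (del (d (G i j))) = E3 (del (del (d (U (U (y1 i j)))))) + E1 (del (del (d (\<Sum>c\<in>UNIV. y i c * y c j))))"
      unfolding H_def del_simps d_add d_E1 d_E3 by simp
    also have "del (del (d (U (U (y1 i j))))) = Th (Tw (Tw (Tw (U (U (r i j))))))"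
      by (simp add: del_def[symmetric] del_y1 del: d_U) (simp add: del_alt algebra_simps)
    finally show ?thesis unfolding qyy .
  qed
  have "Th ?L = Th ?R"
    unfolding L S2a[OF assms] S2b[OF assms]
    using arg_cong[OF qGH, of Tw]
    by (simp add: del_alt[of "_ * _"] del_alt[of "_ - _"] algebra_simps)
  then show ?thesis unfolding three_cancel .
qed
end

section \<open>Normal ordering of products, and the share of an index b outside {i, j}\<close>

context cur2 begin

lemma mswap: "x * z = z * x + comm x z" for x z :: 'r by (simp add: comm_def)
lemma assocR: "x * z = w \<Longrightarrow> x * (z * v) = w * (v::'r)"
  by (simp flip: mult.assoc)
lemma yh: "comm (y c e) (h a b) = (if a = e then U (U (m c b)) else 0) - (if b = c then U (U (m a e)) else 0)"
  using hy[of a b c e] by (auto simp: comm_def algebra_simps split: if_splits)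
lemma ym: "comm (y c e) (m a b) = (if a = e then r c b else 0) - (if b = c then r a e else 0)"
  using my[of a b c e] by (auto simp: comm_def algebra_simps split: if_splits)

lemmas sw = mswap[of "y a b" "y c e" for a b c e, unfolded yy] mswap[of "y a b" "y1 c e" for a b c e, unfolded yy1]
  mswap[of "y1 a b" "y c e" for a b c e, unfolded y1y] mswap[of "y1 a b" "y1 c e" for a b c e, unfolded y1y1]
  mswap[of "y a b" "h c e" for a b c e, unfolded yh] mswap[of "h a b" "y c e" for a b c e, unfolded hy]
  mswap[of "y1 a b" "h c e" for a b c e, unfolded y1h] mswap[of "h a b" "y1 c e" for a b c e, unfolded hy1]
  mswap[of "y a b" "m c e" for a b c e, unfolded ym] mswap[of "m a b" "y c e" for a b c e, unfolded my]
lemma Fs2: "comm F (y1 a b) = Tw (del (s a b))"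
  using dcF[of "y a b"] by (simp add: Fy del_def del: d_U)
lemma del_sy: "del (s a b * y c e) = del (s a b) * y c e + U (U (s a b * y1 c e))"
   "del (y c e * s a b) = U (U (y1 c e * s a b)) + y c e * del (s a b)"
  by (simp_all add: del_alt algebra_simps)

text \<open>A residue of normal ordering. Each of the K indices leaves it once, and the term with
  factor K in \<open>XI\<close> removes it again, so it is absent from \<open>Theta\<close>.\<close>

definition "wp i j = - (y j j * h i j) - h i j * y i i + h j j * y i j + y i j * h i i"
definition "Vt i j c = U (U (m i c * y c j + y i c * m c j + h i c * y1 c j + y1 i c * h c j))"

context fixes i j b :: 'k assumes b: "b \<noteq> i" "b \<noteq> j" "i \<noteq> j" begin
text \<open>The 28 pairs of units in the order ib, bj, jb, bi, ij, ii, jj, bb, each exchanged in one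
  direction only, so that rewriting ends in a normal form.\<close>

lemmas ordb = sw[of b j i b]
  sw[of j b i b]
  sw[of j b b j]
  sw[of b i i b]
  sw[of b i b j]
  sw[of b i j b]
  sw[of i j i b]
  sw[of i j b j]
  sw[of i j j b]
  sw[of i j b i]
  sw[of i i i b]
  sw[of i i b j]
  sw[of i i j b]
  sw[of i i b i]
  sw[of i i i j]
  sw[of j j i b]
  sw[of j j b j]
  sw[of j j j b]
  sw[of j j b i]
  sw[of j j i j]
  sw[of j j i i]
  sw[of b b i b]
  sw[of b b b j]
  sw[of b b j b]
  sw[of b b b i]
  sw[of b b i j]
  sw[of b b i i]
  sw[of b b j j]
lemmas ordbA = ordb[THEN assocR]

text \<open>These cubic terms make up part of the e1-coefficient in \<open>Tb\<close>; in normal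
  order they collapse to quadratic ones. The next lemma treats the e3-coefficient.\<close>

lemma cb: "Tw (- (y j j * (y1 i b * y b j - y i b * y1 b j)) + (y1 i b * y b j - y i b * y1 b j) * y i i
       + acomm (y j b * y1 b j + y1 i b * y b i) (y i j) - y i b * y j j * y1 b j - y j b * (y1 i j * y b j + y i j * y1 b j)
       - (y1 i b * y i j + y i b * y1 i j) * y b i - y1 i b * y i i * y b j)
     + acomm (y i b * y b i + y j b * y b j) (y1 i j) + acomm (y i b * y i i - y j b * y i j) (y1 b j)
     - acomm (y1 i b) (y i j * y b i - y j j * y b j) - comm (y i b * y b j) (y1 i i - y1 j j)
    = Tw (h i b * y b j + y i b * h b j) + Tw (Tw (U (U (y1 i b * y1 b j)))) - y j j * h i j - h i j * y i i + h j j * y i j + y i j * h i i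
       - h b b * y i j - y i j * h b b"
  using b b[symmetric]
  by (simp add: acomm_def comm_def ordb ordbA algebra_simps)
lemma eb: "del (del (d (y i b * y b j))) + Tw (U (U (acomm (h i b) (y1 b j) + acomm (y1 i b) (h b j))))
       - del (U (U (Tw (acomm (y1 i b) (y1 b j)))) + acomm (h i b) (y b j) + acomm (y i b) (h b j)) = Th (Tw (Tw (U (U (r i j)))))"
  using b b[symmetric] by (simp add: acomm_def del_alt ordb algebra_simps)
end

context fixes i j :: 'k assumes ij: "i \<noteq> j" begin
text \<open>The same device for the order ij, ii, jj, ji.\<close>

lemmas ord0 = sw[of i i i j]
  sw[of j j i j]
  sw[of j j i i]
  sw[of j i i j]
  sw[of j i i i]
  sw[of j i j j]
lemmas ord0A = ord0[THEN assocR]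

text \<open>E_ij commutes with E_ii + E_jj, so the leading terms vanish and only corrections with e1
  and e3 remain. They are found by writing s_ij through \<open>sG\<close> and d G_ij as a bracket
  with X_ii.\<close>

lemma S1E: "comm (s i j) (y i i + y j j) = - E3 (U (U (m i j))) - E1 (Tw (U (U (m i j)))) - E1 (U (U (\<Sum>b\<in>UNIV. y1 i b * y1 b j)))
     + E1 (U (U (y1 i i * y1 i j + y1 i j * y1 j j)))"
proof -
  have dG': "d (G i j) = comm (X i i) (y1 i j) - E1 (y1 i j * y i i + y i j * y1 i i)"
    using Xy1[of i i i j] ij by (simp add: algebra_simps)
  have X1: "comm (X i i) (y i i) = - E3 (U (U (y1 i i))) - E1 (\<Sum>c\<in>UNIV. y i c * y c i) - E1 (U (U (y1 i i))) + E1 (y i i * y i i)"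
    by (simp add: Xy H_def)
  have X2: "comm (X i i) (y j j) = - E1 (U (U (y1 i i))) + E1 (y i j * y j i)"
    using ij by (simp add: Xy)
  have "comm (d (G i j)) (y i i + y j j) = - E3 (U (U (m i j))) - E1 (Tw (U (U (m i j))))
     - E1 (\<Sum>c\<in>UNIV. y i c * h c j) + E1 (y i i * h i j + y i j * h j j)"
    using ij unfolding dG' comm_lin(2,3) jac(1)[of "X i i"]
    by (simp add: comm_lin X1 X2 Xy[of i i i j] Xy1[of i i i j] yy yy1 y1y y1y1 if_distrib[of "\<lambda>x. x * _"] if_distrib[of "\<lambda>x. _ * x"] sum.distrib sum_subtractf ord0 cong: if_cong) (simp add: algebra_simps ord0 if_distrib[of "\<lambda>x. _ * x"] if_distrib[of E1] sum.distrib sum_subtractf cong: if_cong)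
  moreover have "comm (\<Sum>c\<in>UNIV. y i c * y1 c j) (y i i + y j j) = (\<Sum>c\<in>UNIV. y i c * h c j) - y i i * h i j - y i j * h j j
     - U (U (\<Sum>b\<in>UNIV. y1 i b * y1 b j)) + U (U (y1 i i * y1 i j + y1 i j * y1 j j))"
    using ij
    by (simp add: comm_lin yy yy1 y1y y1y1 if_distrib[of "\<lambda>x. x * _"] if_distrib[of "\<lambda>x. _ * x"] if_distrib[of U] sum.distrib sum_subtractf ord0 cong: if_cong) (simp add: algebra_simps ord0 if_distrib[of "\<lambda>x. x * _"] if_distrib[of "\<lambda>x. _ * x"] if_distrib[of U] sum.distrib sum_subtractf cong: if_cong)
  moreover have "comm (h i j) (y i i + y j j) = 0" using ij by (simp add: comm_lin hy)
  moreover have "comm (s i j) (y i i + y j j) = comm (d (G i j)) (y i i + y j j) + E3 (comm (h i j) (y i i + y j j))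
      + E1 (comm (\<Sum>c\<in>UNIV. y i c * y1 c j) (y i i + y j j))"
    unfolding sG[of i j] comm_lin(1,3,4) ..
  ultimately show ?thesis by (simp only: E3_0) (simp add: algebra_simps)
qed

end

text \<open>ad F, which turns y into 2 u^2 s and y1 into 2 \<open>del s\<close>, is applied to the
  vanishing brackets of y_ij and of y1_ij with y_ii + y_jj.\<close>

lemma sig: assumes "i \<noteq> j"
  shows "comm (s i i + s j j) (y i j) = comm (s i j) (y i i + y j j)"
   "U (U (comm (s i i + s j j) (y1 i j))) + U (U (comm (s i j) (y1 i i + y1 j j))) = del (comm (s i j) (y i i + y j j))"
proof -
  have "comm F (comm (y i j) (y i i + y j j)) = 0" using assms by (simp add: comm_lin yy)
  then have "comm (comm F (y i j)) (y i i + y j j) + comm (y i j) (comm F (y i i + y j j)) = 0" by (simp add: comm_def algebra_simps)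
  then have "U (U (Tw (comm (s i j) (y i i + y j j) - comm (s i i + s j j) (y i j)))) = 0"
    by (simp add: Fy comm_lin) (simp add: comm_def algebra_simps)
  then have "Tw (comm (s i j) (y i i + y j j) - comm (s i i + s j j) (y i j)) = Tw 0" using U_inj by fastforce
  then show "comm (s i i + s j j) (y i j) = comm (s i j) (y i i + y j j)" unfolding two_cancel by simp
  have "comm F (comm (y1 i j) (y i i + y j j)) = 0" using assms by (simp add: comm_lin y1y)
  then have "comm (comm F (y1 i j)) (y i i + y j j) + comm (y1 i j) (comm F (y i i + y j j)) = 0" by (simp add: comm_def algebra_simps)
  then have "Tw (comm (del (s i j)) (y i i + y j j) - U (U (comm (s i i + s j j) (y1 i j)))) = Tw 0"
    by (simp add: Fy Fs2 comm_lin) (simp add: comm_def algebra_simps)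
  then have "comm (del (s i j)) (y i i + y j j) = U (U (comm (s i i + s j j) (y1 i j)))" unfolding two_cancel by simp
  then show "U (U (comm (s i i + s j j) (y1 i j))) + U (U (comm (s i j) (y1 i i + y1 j j))) = del (comm (s i j) (y i i + y j j))"
    by (simp add: comm_def del_simps del_sy algebra_simps)
qed

text \<open>This and the next three expressions are the shares of an index b outside {i, j} in
  \<open>Fpart\<close>, \<open>p1\<close>, \<open>PSI\<close> and \<open>XI\<close>. The versions
  with suffix 0 are the corresponding shares of i and j.\<close>

definition "Fb i j b = - (Tw (del (s i b) * y b j) + Tw (U (U (y1 i b * s b j))) - Tw (U (U (s i b * y1 b j))) - Tw (y i b * del (s b j)))"
definition "pb i j b = - (G i b * y1 b j) + y1 i b * H b j
   + E1 (- (y j j * (y1 i b * y b j - y i b * y1 b j)) + (y1 i b * y b j - y i b * y1 b j) * y i i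
       + acomm (y j b * y1 b j + y1 i b * y b i) (y i j) - y i b * y j j * y1 b j - y j b * (y1 i j * y b j + y i j * y1 b j)
       - (y1 i b * y i j + y i b * y1 i j) * y b i - y1 i b * y i i * y b j + acomm (y i b * y b i + y j b * y b j) (y1 i j)
       + (y1 i i - y1 j j) * (y i b * y b j))"
definition "Psb i j b = acomm (s i b) (y1 b j) - acomm (y1 i b) (s b j) - E3 (acomm (h i b) (y1 b j) + acomm (y1 i b) (h b j))
   + E1 (acomm (y1 b b) (h i j) + acomm (h b b) (y1 i j))"
definition "Xib i j b = - acomm (s i b) (y b j) + acomm (y i b) (s b j)
   - acomm (G i b + E1 (y i b * y i i - y j b * y i j)) (y1 b j) + acomm (y1 i b) (H b j + E1 (y i j * y b i - y j j * y b j))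
   + E1 (acomm (y i b * y b i + y j b * y b j) (y1 i j)) + E1 (acomm (y1 i i - y1 j j) (y i b * y b j))
   + E3 (U (U (Tw (acomm (y1 i b) (y1 b j)))) + acomm (h i b) (y b j) + acomm (y i b) (h b j))
   - E1 (U (U (Tw (acomm (y1 b b) (y1 i j)))) + Tw (acomm (h b b) (y i j)))"

text \<open>The terms containing s form the left-hand side of \<open>S2\<close>. The rest splits
  into an e3-part, evaluated by \<open>eb\<close>, and an e1-part, evaluated by
  \<open>cb\<close>.\<close>

lemma Tb: assumes b: "b \<noteq> i" "b \<noteq> j" "i \<noteq> j"
  shows "Fb i j b + E3 (del (del (d (y i b * y b j)))) + Tw (del (pb i j b)) - Tw (U (U (Psb i j b))) - del (Xib i j b)
   - E1 (Tw (del (U (U (y1 i b * y1 b j)))))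
   = E3 (Th (Tw (Tw (Tw (U (U (r i j))))))) + E1 (Th (V i j) + Th (Tw (Vt i j b)) + del (wp i j))"
   (is "?L = ?R")
proof -
  define c where "c = Tw (h i b * y b j + y i b * h b j) + Tw (Tw (U (U (y1 i b * y1 b j)))) - y j j * h i j - h i j * y i i + h j j * y i j + y i j * h i i
       - h b b * y i j - y i j * h b b"
  note C = cb[OF b, folded c_def]
  have s: "?L = (Tw (U (U (comm (s i b) (y1 b j)))) - Tw (U (U (comm (y1 i b) (s b j)))) - del (comm (s i b) (y b j)) + del (comm (y i b) (s b j))
     - del (comm (G i b) (y1 b j)) + del (comm (y1 i b) (H b j)))
    + E3 (del (del (d (y i b * y b j))) + Tw (U (U (acomm (h i b) (y1 b j) + acomm (y1 i b) (h b j))))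
       - del (U (U (Tw (acomm (y1 i b) (y1 b j)))) + acomm (h i b) (y b j) + acomm (y i b) (h b j)))
    + E1 (del c - Tw (U (U (acomm (y1 b b) (h i j) + acomm (h b b) (y1 i j)))) + Tw (del (U (U (acomm (y1 b b) (y1 i j))) + acomm (h b b) (y i j)))
        - Tw (del (U (U (y1 i b * y1 b j)))))"
    unfolding C[symmetric] Fb_def pb_def Psb_def Xib_def
    by (simp add: comm_def acomm_def del_simps del_sy algebra_simps)
  have f: "del c - Tw (U (U (acomm (y1 b b) (h i j) + acomm (h b b) (y1 i j)))) + Tw (del (U (U (acomm (y1 b b) (y1 i j))) + acomm (h b b) (y i j)))
        - Tw (del (U (U (y1 i b * y1 b j))))
      = U (U (Th (y i j * m b b + m b b * y i j) + Th (y1 i j * h b b + h b b * y1 i j)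
        + Tw (h i j * y1 b b + y1 b b * h i j))) + Th (Tw (Vt i j b)) + del (wp i j)"
    unfolding c_def by (simp add: acomm_def del_alt Vt_def wp_def algebra_simps)
  show ?thesis unfolding s eb[OF b] f S2[OF b] by (simp add: algebra_simps)
qed
end

section \<open>The share of the indices i and j themselves\<close>

context cur2 begin

lemma same: "y1 a a * y a a = y a a * y1 a a" "h a a * y a a = y a a * h a a" "h a a * y1 a a = y1 a a * h a a"
  by (subst mswap, simp add: y1y hy hy1)+

text \<open>\<open>H a c\<close> minus \<open>G a c\<close>, with the sum over the middle index
  restricted to i and j. The three expressions that follow are [X_ii - X_jj, .] on y_ij, y_ii and
  y_jj, restricted in the same way.\<close>

definition "gh0 i j a c = E3 (U (U (y1 a c))) + E1 (y a i * y i c + y a j * y j c)"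
definition "XBij i j = G i j + (G i j + gh0 i j i j) + E1 (y i j * y i i - y j j * y i j)"
definition "XBii i j = - gh0 i j i i - E1 (U (U (y1 i i - y1 j j))) + E1 (y i i * y i i - y j i * y i j)"
definition "XBjj i j = gh0 i j j j - E1 (U (U (y1 i i - y1 j j))) + E1 (y i j * y j i - y j j * y j j)"
definition "F0 i j = - (Tw (del (s i i) * y i j) + Tw (U (U (y1 i i * s i j))) + Tw (del (s i j) * y j j) + Tw (U (U (y1 i j * s j j)))
   - Tw (U (U (s i i * y1 i j))) - Tw (y i i * del (s i j)) - Tw (U (U (s i j * y1 j j))) - Tw (y i j * del (s j j)))
   - Th (Tw (del (s i i * y i j + y i i * s i j - s i j * y j j - y i j * s j j)))"
definition "z0 i j = y1 i i * y i j + y1 i j * y j j - y i i * y1 i j - y i j * y1 j j"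
definition "p0 i j = - (y j j * (Tw (s i j) + E1 (z0 i j))) + (Tw (s i j) + E1 (z0 i j)) * y i i
   - acomm (s j j - s i i - E3 (h j j + h i i) - E1 (y j i * y1 i j + y j j * y1 j j + y1 i i * y i i + y1 i j * y j i)) (y i j)
   + acomm (gh0 i j i i + gh0 i j j j) (y1 i j) + G i j * (y1 i i - y1 j j) + (y1 i i - y1 j j) * (G i j + gh0 i j i j)
   + E1 (- (y i i * y j j * y1 i j + y j i * d (y i j * y i j) + (y i j * y j j - U (U (y1 i j))) * y1 j j + y j j * (d (y i j * y j j) - h i j - h i j))
     - ((d (y i i * y i j) - h i j - h i j) * y i i + y1 i i * (y i i * y i j - U (U (y1 i j))) + d (y i j * y i j) * y j i + y1 i j * (y i i * y j j))
     + (y1 i j * y j j + y i j * y1 j j - h i j - h i j) * y i i + (y i j * y j j - U (U (y1 i j))) * y1 i i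
     + y1 j j * (y i i * y i j - U (U (y1 i j))) + y j j * (y1 i i * y i j + y i i * y1 i j - h i j - h i j)
     - d (y j j * y i i * y i j + y i j * y j j * y i i))"
definition "Ps0 i j = acomm (s i i) (y1 i j) + acomm (s i j) (y1 j j) - acomm (y1 i i) (s i j) - acomm (y1 i j) (s j j)
   - E3 (acomm (h i i) (y1 i j) + acomm (h i j) (y1 j j) + acomm (y1 i i) (h i j) + acomm (y1 i j) (h j j))
   + E1 (acomm (y1 i i + y1 j j) (h i j) + acomm (h i i + h j j) (y1 i j))"
definition "Xi0 i j = - Tw (acomm (s i i) (y i j)) + Tw (acomm (y i j) (s j j)) - acomm (XBii i j) (y1 i j) - acomm (XBij i j) (y1 j j)
   + acomm (y1 i i) (XBij i j) + acomm (y1 i j) (XBjj i j)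
   + E3 (U (U (Tw (acomm (y1 i i) (y1 i j)))) + Tw (acomm (h i i) (y i j)) + U (U (Tw (acomm (y1 i j) (y1 j j)))) + Tw (acomm (y i j) (h j j)))
   - E1 (U (U (Tw (acomm (y1 i i + y1 j j) (y1 i j)))) + Tw (acomm (h i i + h j j) (y i j)))"

text \<open>The terms of \<open>T0\<close> with s, kept apart because no rule exchanges s with the
  other letters. They combine into the brackets that \<open>sig\<close> compares.\<close>

lemma T0s: assumes "i \<noteq> j"
  shows "F0 i j + Tw (del (- (y j j * Tw (s i j)) + Tw (s i j) * y i i - acomm (s j j - s i i) (y i j)))
     - Tw (U (U (acomm (s i i) (y1 i j) + acomm (s i j) (y1 j j) - acomm (y1 i i) (s i j) - acomm (y1 i j) (s j j))))
     - del (- Tw (acomm (s i i) (y i j)) + Tw (acomm (y i j) (s j j)))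
   = Tw (del (comm (s i j) (y i i + y j j)))" (is "?L = _")
proof -
  have "?L = Tw (Tw (del (comm (s i j) (y i i + y j j)))) - Tw (Tw (del (comm (s i i + s j j) (y i j))))
      + Tw (U (U (comm (s i i + s j j) (y1 i j))) + U (U (comm (s i j) (y1 i i + y1 j j))))"
    unfolding F0_def by (simp add: comm_def acomm_def del_simps del_sy algebra_simps)
  then show ?thesis unfolding sig[OF assms] by simp
qed

lemma T0: assumes "i \<noteq> j"
  shows "F0 i j + E3 (Tw (Th (Tw (Tw (Tw (U (U (r i j)))))))) + Tw (del (p0 i j)) - Tw (U (U (Ps0 i j))) - del (Xi0 i j)
    - E1 (Th (Tw (Tw (Tw (U (U (r i j)))))))
   = Tw (del (comm (s i j) (y i i + y j j))) + E3 (Tw (Tw (Tw (Th (Tw (U (U (r i j)))))) + Tw (Tw (U (U (r i j))))))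
     + E1 (Th (Tw (Vt i j i + Vt i j j)) + Tw (del (wp i j)) + Tw (Tw (Tw (Tw (U (U (r i j)))))))" (is "?L = ?R")
proof -
  \<comment> \<open>After this subtraction no bracket of s is needed any more, and both sides can be
    compared in normal order.\<close>
  have "?L - (F0 i j + Tw (del (- (y j j * Tw (s i j)) + Tw (s i j) * y i i - acomm (s j j - s i i) (y i j)))
     - Tw (U (U (acomm (s i i) (y1 i j) + acomm (s i j) (y1 j j) - acomm (y1 i i) (s i j) - acomm (y1 i j) (s j j))))
     - del (- Tw (acomm (s i i) (y i j)) + Tw (acomm (y i j) (s j j))))
    = ?R - Tw (del (comm (s i j) (y i i + y j j)))"
    using assms assms[symmetric]
    apply (simp add: p0_def Ps0_def Xi0_def XBij_def XBii_def XBjj_def gh0_def z0_def Vt_def wp_def acomm_def del_simps)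
    apply (simp add: algebra_simps)
    apply (simp add: del_alt)
    apply (simp add: ord0[OF assms] ord0A[OF assms] same same[THEN assocR] algebra_simps)
    done
  then show ?thesis unfolding T0s[OF assms] by (simp add: algebra_simps)
qed
end

section \<open>Brackets of T_10(E_ij) with the quadratic terms of (A4)\<close>

context cur2 begin

context fixes i j :: 'k assumes ij: "i \<noteq> j" begin

lemma split: "(\<Sum>c\<in>UNIV. f c) = f i + f j + (\<Sum>b\<in>UNIV - {i, j}. f b)" for f :: "'k \<Rightarrow> 'r"
proof -
  have "(\<Sum>c\<in>UNIV. f c) = (\<Sum>c\<in>{i,j}. f c) + (\<Sum>b\<in>UNIV - {i, j}. f b)"
    using sum.subset_diff[of "{i,j}" UNIV f] by (simp add: add.commute)
  then show ?thesis using ij by simp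
qed

lemma sumif2: "(\<Sum>a\<in>UNIV. \<Sum>b\<in>UNIV. if a = x then f a b else 0) = (\<Sum>b\<in>UNIV. f x b)"
   "(\<Sum>a\<in>UNIV. \<Sum>b\<in>UNIV. if x = a then f a b else 0) = (\<Sum>b\<in>UNIV. f x b)" for f :: "'k \<Rightarrow> 'k \<Rightarrow> 'r"
  by (subst sum.swap, simp)+

text \<open>After renaming summation indices the cubic terms pair up into brackets of y1 with y. The
  Kronecker deltas contract a sum, giving traces, or leave an index free, giving the factor
  K.\<close>

lemma cubC: "(\<Sum>a\<in>UNIV. \<Sum>b\<in>UNIV. (y1 i b * y a j + y i b * y1 a j) * y1 b a + y1 a b * (y1 i a * y b j + y i a * y1 b j)
     - acomm (y i b * y1 b a) (y1 a j) - acomm (y1 i a) (y1 a b * y b j))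
   = acomm (\<Sum>a\<in>UNIV. y1 a a) (h i j) + acomm (\<Sum>a\<in>UNIV. h a a) (y1 i j)
     - of_nat CARD('k) * (\<Sum>a\<in>UNIV. h i a * y1 a j + y1 i a * h a j)" (is "?L = ?R")
proof -
  have s1: "(\<Sum>a\<in>UNIV. \<Sum>b\<in>UNIV. y1 i b * y a j * y1 b a) = (\<Sum>a\<in>UNIV. \<Sum>b\<in>UNIV. y1 i a * y b j * y1 a b)"
    by (rule sum.swap)
  have s2: "(\<Sum>a\<in>UNIV. \<Sum>b\<in>UNIV. y1 a b * y i a * y1 b j) = (\<Sum>a\<in>UNIV. \<Sum>b\<in>UNIV. y1 b a * y i b * y1 a j)"
    by (rule sum.swap)
  have "?L = (\<Sum>a\<in>UNIV. \<Sum>b\<in>UNIV. y1 i b * y a j * y1 b a) + (\<Sum>a\<in>UNIV. \<Sum>b\<in>UNIV. y1 a b * y i a * y1 b j)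
    + (\<Sum>a\<in>UNIV. \<Sum>b\<in>UNIV. y i b * y1 a j * y1 b a + y1 a b * y1 i a * y b j
     - acomm (y i b * y1 b a) (y1 a j) - acomm (y1 i a) (y1 a b * y b j))"
    unfolding sum.distrib[symmetric] by (intro sum.cong refl) (simp add: algebra_simps)
  also have "\<dots> = (\<Sum>a\<in>UNIV. \<Sum>b\<in>UNIV. - (comm (y1 a j) (y i b) * y1 b a) + comm (y1 b a) (y i b) * y1 a j
      - y1 i a * comm (y1 a b) (y b j) + y1 a b * comm (y1 i a) (y b j))"
    unfolding s1 s2 sum.distrib[symmetric] by (intro sum.cong refl) (simp add: acomm_def comm_def algebra_simps)
  also have "\<dots> = ?R"
    using ij
    by (simp add: y1y acomm_def if_distrib[of "\<lambda>x. x * _"] if_distrib[of "\<lambda>x. _ * x"] sum.distrib sum_subtractf sum_negf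
       sum_distrib_left sum_distrib_right sumif2 algebra_simps cong: if_cong)
  finally show ?thesis .
qed

text \<open>The c = e term of \<open>Xy\<close> produces -2 e1 times the anticommutator of h_ij with
  the trace of y1, and \<open>Qt\<close> is exactly what cancels it. This is the origin of the
  products e1 e2 t t in (A4).\<close>

lemma Psi: assumes Qt: "comm (X i j) Qt = Tw (acomm (h i j) (\<Sum>a\<in>UNIV. y1 a a))"
  shows "comm (X i j) ((\<Sum>a\<in>UNIV. \<Sum>b\<in>UNIV. y1 a b * y1 b a) + E1 Qt)
   = (\<Sum>a\<in>UNIV. acomm (s i a) (y1 a j) - acomm (y1 i a) (s a j)) - E3 (\<Sum>a\<in>UNIV. acomm (h i a) (y1 a j) + acomm (y1 i a) (h a j))
    + E1 (acomm (\<Sum>a\<in>UNIV. y1 a a) (h i j) + acomm (\<Sum>a\<in>UNIV. h a a) (y1 i j)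
     - of_nat CARD('k) * (\<Sum>a\<in>UNIV. h i a * y1 a j + y1 i a * h a j))"
proof -
  have "comm (X i j) (\<Sum>a\<in>UNIV. \<Sum>b\<in>UNIV. y1 a b * y1 b a)
    = (\<Sum>a\<in>UNIV. acomm (d (G i a)) (y1 a j) - acomm (y1 i a) (d (H a j))) - E1 (Tw (acomm (h i j) (\<Sum>a\<in>UNIV. y1 a a)))
     + E1 (\<Sum>a\<in>UNIV. \<Sum>b\<in>UNIV. (y1 i b * y a j + y i b * y1 a j) * y1 b a + y1 a b * (y1 i a * y b j + y i a * y1 b j))"
    by (simp add: comm_lin Xy1 acomm_def if_distrib[of "\<lambda>x. x * _"] if_distrib[of "\<lambda>x. _ * x"] if_distrib[of E1] sum.distrib sum_subtractf sum_negf
       sum_distrib_left sum_distrib_right sumif2 algebra_simps cong: if_cong)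
  also have "(\<Sum>a\<in>UNIV. acomm (d (G i a)) (y1 a j) - acomm (y1 i a) (d (H a j)))
    = (\<Sum>a\<in>UNIV. acomm (s i a) (y1 a j) - acomm (y1 i a) (s a j)) - E3 (\<Sum>a\<in>UNIV. acomm (h i a) (y1 a j) + acomm (y1 i a) (h a j))
    + E1 (\<Sum>a\<in>UNIV. \<Sum>b\<in>UNIV. - acomm (y i b * y1 b a) (y1 a j) - acomm (y1 i a) (y1 a b * y b j))"
    by (simp add: dG dH acomm_def sum.distrib sum_subtractf sum_negf sum_distrib_left sum_distrib_right algebra_simps)
  finally show ?thesis unfolding cubC[symmetric] comm_lin(8) comm_lin(10) Qt
    by (simp add: sum.distrib sum_subtractf sum_negf algebra_simps)
qed

text \<open>The coefficient of \<open>E1\<close> in \<open>d DP\<close>, apart from the brackets of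
  X_ij with s and h.\<close>

definition "p1 = - comm (X i j) ((\<Sum>c\<in>UNIV. y j c * y1 c j) + (\<Sum>c\<in>UNIV. y1 i c * y c i)) + comm (X i j) (d (y j j * y i i))
   - d (comm (X j i) (y i j * y i j))"

lemma p1: "p1 = p0 i j + (\<Sum>b\<in>UNIV-{i,j}. pb i j b)"
proof -
  have A: "comm (X i j) (\<Sum>c\<in>UNIV. y j c * y1 c j)
     = (G i i - H j j + E1 (y i i * y j j)) * y1 i j + E1 (y j i * d (y i j * y i j))
       + (G i j - E1 (U (U (y1 i j))) + E1 (y i j * y j j)) * y1 j j + y j j * (d (G i j) - E1 (h i j + h i j) + E1 (d (y i j * y j j)))
       + (\<Sum>b\<in>UNIV-{i,j}. (G i b + E1 (y i b * y j j)) * y1 b j + E1 (y j b * d (y i j * y b j)))"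
    apply (subst comm_lin(18))
    apply (subst split)
    apply (rule arg_cong2[where f = "(+)"])
    subgoal using ij by (simp add: comm_lin Xy Xy1 algebra_simps)
    subgoal using ij by (intro sum.cong refl) (auto simp: comm_lin Xy Xy1 algebra_simps)
    done
  have B: "comm (X i j) (\<Sum>c\<in>UNIV. y1 i c * y c i)
     = (- d (H i j) - E1 (h i j + h i j) + E1 (d (y i i * y i j))) * y i i + y1 i i * (- H i j - E1 (U (U (y1 i j))) + E1 (y i i * y i j))
       + E1 (d (y i j * y i j)) * y j i + y1 i j * (G i i - H j j + E1 (y i i * y j j))
       + (\<Sum>b\<in>UNIV-{i,j}. E1 (d (y i b * y i j)) * y b i + y1 i b * (- H b j + E1 (y i i * y b j)))"
    apply (subst comm_lin(18))
    apply (subst split)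
    apply (rule arg_cong2[where f = "(+)"])
    subgoal using ij by (simp add: comm_lin Xy Xy1 algebra_simps)
    subgoal using ij by (intro sum.cong refl) (auto simp: comm_lin Xy Xy1 algebra_simps)
    done
  have C: "comm (X i j) (d (y j j * y i i)) = (d (G i j) - E1 (h i j + h i j) + E1 (d (y i j * y j j))) * y i i
      + (G i j - E1 (U (U (y1 i j))) + E1 (y i j * y j j)) * y1 i i
      + y1 j j * (- H i j - E1 (U (U (y1 i j))) + E1 (y i i * y i j)) + y j j * (- d (H i j) - E1 (h i j + h i j) + E1 (d (y i i * y i j)))"
    using ij by (simp add: comm_lin Xy Xy1 algebra_simps)
  have D: "d (comm (X j i) (y i j * y i j)) = d ((G j j - H i i + E1 (y j j * y i i)) * y i j + y i j * (G j j - H i i + E1 (y j j * y i i)))"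
    using ij by (simp add: comm_lin Xy)
  show ?thesis unfolding p1_def comm_lin(8) A B C D p0_def pb_def z0_def gh0_def acomm_def
    apply (simp add: dG dH)
    apply (simp add: H_def[of i j] H_def[of i i] H_def[of j j] split)
    apply (simp add: sum.distrib sum_subtractf sum_negf sum_distrib_left sum_distrib_right algebra_simps)
    done
qed

end
end

section \<open>The action of w and the identity behind the recursion for (A4)\<close>

context cur2 begin

context fixes i j :: 'k assumes ij: "i \<noteq> j" begin
lemmas isplit = split[OF ij] and iPsi = Psi[OF ij]
text \<open>Here w stands for T_01(E_ii - E_jj) and \<open>Qt\<close> for e2 times the square of the
  series of the (n + 1) t_0n; only the listed brackets of them enter.\<close>

context
  fixes w Qt :: 'r
  assumes dw: "d w = 0" and Fw: "comm F w = Tw (X i i - X j j)"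
    and wy1: "\<And>a b. U (U (comm w (y1 a b))) = (if a = i then U (y1 a b) - y a b else if a = j then y a b - U (y1 a b) else 0)
        - (if b = i then U (y1 a b) - y a b else if b = j then y a b - U (y1 a b) else 0)"
    and ws: "\<And>a b. U (U (comm w (s a b))) = (if a = i then U (s a b) else if a = j then - U (s a b) else 0)
        - (if b = i then U (s a b) else if b = j then - U (s a b) else 0) - comm (X i i - X j j) (y a b)"
    and Qt: "comm (X i j) Qt = Tw (acomm (h i j) (\<Sum>a\<in>UNIV. y1 a a))"
begin

definition "J x = U (U (comm w x))"
lemma J_lin: "J (x + z) = J x + J z" "J (x - z) = J x - J z" "J (E1 x) = E1 (J x)" "J (E3 x) = E3 (J x)" "J (U x) = U (J x)" "J (- x) = - J x"
  "J (x * z) = J x * z + x * J z" "J (sum f A) = (\<Sum>a\<in>A. J (f a))"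
  unfolding J_def by (simp_all add: comm_lin)
lemma dcw: "d (comm w x) = comm w (d x)" by (simp add: comm_def dw)
text \<open>2 h is \<open>del y1\<close>, and differentiation commutes with ad w because w is
  constant.\<close>

lemma Jh: "J (h a b) = (if a = i then U (h a b) - U (U (y1 a b)) else if a = j then U (U (y1 a b)) - U (h a b) else 0)
        - (if b = i then U (h a b) - U (U (y1 a b)) else if b = j then U (U (y1 a b)) - U (h a b) else 0)"
proof -
  have "J (h a b + h a b) = U (U (d (J (y1 a b))))"
    unfolding J_def del_y1[symmetric] del_def by (simp add: comm_lin(12) dcw[symmetric] del: d_U)
  also have "\<dots> = dd (J (y1 a b))" by (simp add: dd_def)
  finally have "Tw (J (h a b)) = dd (J (y1 a b))" by (simp add: J_lin)
  also have "\<dots> = Tw ((if a = i then U (h a b) - U (U (y1 a b)) else if a = j then U (U (y1 a b)) - U (h a b) else 0)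
        - (if b = i then U (h a b) - U (U (y1 a b)) else if b = j then U (U (y1 a b)) - U (h a b) else 0))"
    unfolding J_def wy1 by simp
  finally show ?thesis unfolding two_cancel .
qed
lemmas Jy1 = wy1[folded J_def]
lemmas Js = ws[folded J_def]

text \<open>What ad w moves from the share of b to that of i and j. It enters \<open>JPs0\<close>
  and \<open>JPsb\<close> with opposite signs and cancels in \<open>JPSI\<close>.\<close>

definition "Bq b = acomm (y i b * y b i + y j b * y b j) (y1 i j) + acomm (y1 i i - y1 j j) (y i b * y b j)"

lemma X_BB: "comm (X i i - X j j) (y i j) = G i j + H i j + E1 (y i j * y i i - y j j * y i j)"
   "comm (X i i - X j j) (y i i) = G i i - H i i - E1 (U (U (y1 i i - y1 j j))) + E1 (y i i * y i i - y j i * y i j)"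
   "comm (X i i - X j j) (y j j) = H j j - G j j - E1 (U (U (y1 i i - y1 j j))) + E1 (y i j * y j i - y j j * y j j)"
   "b \<noteq> i \<Longrightarrow> b \<noteq> j \<Longrightarrow> comm (X i i - X j j) (y i b) = G i b + E1 (y i b * y i i - y j b * y i j)"
   "b \<noteq> i \<Longrightarrow> b \<noteq> j \<Longrightarrow> comm (X i i - X j j) (y b j) = H b j + E1 (y i j * y b i - y j j * y b j)"
  using ij by (auto simp: comm_lin Xy algebra_simps)

lemma JPs0: "J (Ps0 i j) = Tw (U (Ps0 i j)) + Xi0 i j + E1 (\<Sum>b\<in>UNIV-{i,j}. Bq b)"
  using ij
  apply (simp add: Ps0_def Xi0_def XBij_def XBii_def XBjj_def gh0_def acomm_def J_lin Jy1 Jh Js X_BB Bq_def)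
  apply (simp add: H_def isplit)
  apply (simp add: sum.distrib sum_subtractf sum_negf sum_distrib_left sum_distrib_right algebra_simps)
  done

lemma JPsb: assumes "b \<in> UNIV - {i, j}" shows "J (Psb i j b) = Tw (U (Psb i j b)) + Xib i j b - E1 (Bq b)"
  using ij assms
  by (simp add: Psb_def Xib_def acomm_def J_lin Jy1 Jh Js X_BB Bq_def algebra_simps)

definition "Wp = (\<Sum>a\<in>UNIV. h i a * y1 a j + y1 i a * h a j)"
definition "KWi = U (U (Tw (y1 i i * y1 i j))) + Tw (h i i * y i j)"
definition "KWj = U (U (Tw (y1 i j * y1 j j))) + Tw (y i j * h j j)"
definition "KWb b = U (U (Tw (y1 i b * y1 b j))) + h i b * y b j + y i b * h b j"
lemma JWp: "J Wp = Tw (U Wp) - (KWi + KWj + (\<Sum>b\<in>UNIV-{i,j}. KWb b))"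
proof -
  have "J Wp = J (h i i * y1 i j + y1 i i * h i j) + J (h i j * y1 j j + y1 i j * h j j) + (\<Sum>b\<in>UNIV-{i,j}. J (h i b * y1 b j + y1 i b * h b j))"
    unfolding Wp_def isplit J_lin(1,8) by (simp only: add.assoc)
  also have "(\<Sum>b\<in>UNIV-{i,j}. J (h i b * y1 b j + y1 i b * h b j)) = (\<Sum>b\<in>UNIV-{i,j}. Tw (U (h i b * y1 b j + y1 i b * h b j)) - KWb b)"
    using ij by (intro sum.cong refl) (auto simp: J_lin Jy1 Jh KWb_def algebra_simps)
  finally show ?thesis using ij unfolding Wp_def isplit
    by (simp add: J_lin Jy1 Jh KWi_def KWj_def sum.distrib sum_subtractf algebra_simps)
qed

definition "PSI = comm (X i j) ((\<Sum>a\<in>UNIV. \<Sum>b\<in>UNIV. y1 a b * y1 b a) + E1 Qt)"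
lemma PSI: "PSI = Ps0 i j + (\<Sum>b\<in>UNIV-{i,j}. Psb i j b) - E1 (of_nat CARD('k) * Wp)"
  unfolding PSI_def iPsi[OF Qt] Wp_def[symmetric]
  unfolding isplit Ps0_def Psb_def
  by (simp add: acomm_def sum.distrib sum_subtractf sum_negf sum_distrib_left sum_distrib_right algebra_simps)

lemma JK: "J (of_nat n * x) = of_nat n * J x" by (induction n) (simp_all add: J_def comm_lin algebra_simps)
lemma dK: "d (of_nat n * x) = of_nat n * d x" by (induction n) (simp_all add: algebra_simps)
definition "XI = Xi0 i j + (\<Sum>b\<in>UNIV-{i,j}. Xib i j b) + E1 (of_nat CARD('k) * (KWi + KWj + (\<Sum>b\<in>UNIV-{i,j}. KWb b)))"
lemma JPSI: "J PSI = Tw (U PSI) + XI"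
proof -
  define S where "S = (\<Sum>b\<in>UNIV-{i,j}. Bq b)"
  define P where "P = (\<Sum>b\<in>UNIV-{i,j}. Psb i j b)"
  define Y where "Y = (\<Sum>b\<in>UNIV-{i,j}. Xib i j b)"
  define KW where "KW = KWi + KWj + (\<Sum>b\<in>UNIV-{i,j}. KWb b)"
  define k where "k = (of_nat CARD('k) :: 'r)"
  have Jk: "J (k * x) = k * J x" for x unfolding k_def by (rule JK)
  have "J P = (\<Sum>b\<in>UNIV-{i,j}. Tw (U (Psb i j b)) + Xib i j b - E1 (Bq b))"
    unfolding P_def J_lin(8) by (intro sum.cong refl JPsb)
  also have "\<dots> = Tw (U P) + Y - E1 S" unfolding P_def Y_def S_def by (simp add: sum.distrib sum_subtractf)
  finally have JP: "J P = Tw (U P) + Y - E1 S" .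
  have PS: "PSI = Ps0 i j + P - E1 (k * Wp)" unfolding PSI P_def k_def ..
  have XX: "XI = Xi0 i j + Y + E1 (k * KW)" unfolding XI_def Y_def KW_def k_def ..
  have W: "J Wp = Tw (U Wp) - KW" unfolding JWp KW_def ..
  have P0: "J (Ps0 i j) = Tw (U (Ps0 i j)) + Xi0 i j + E1 S" unfolding JPs0 S_def ..
  show ?thesis unfolding PS XX by (simp add: J_lin(1,2,3) P0 JP W Jk algebra_simps)
qed

lemma D4: "del (del (del (y1 i j))) = Th (Tw (Tw (Tw (U (U (r i j))))))"
  by (simp add: del_alt)

text \<open>By the Jacobi identity this is the bracket of [X_ij, X_ji] with y_ij, where [X_ij, X_ji]
  will be T_20(E_ii - E_jj).\<close>

definition "DP = comm (X i j) (comm (X j i) (y i j)) - comm (X j i) (comm (X i j) (y i j))"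

lemma FX2: "comm F (comm (X a b) z) = comm (X a b) (comm F z)"
proof -
  have "comm F (comm (X a b) z) = comm (comm F (X a b)) z + comm (X a b) (comm F z)" by (simp add: comm_def algebra_simps)
  then show ?thesis by (simp add: FX comm_lin)
qed

text \<open>The terms with s are rewritten as ad F of y, because [F, y] = 2 u^2 s, and those with h
  through \<open>del y1\<close> = 2 h.\<close>

lemma DP: "Tw (del (d DP)) = d (comm F (comm (X i j) (y j j - y i i))) - E3 (del (del (d (comm (X i j) (y i i + y j j))))) + Tw (E1 (del (p1 i j)))"
proof -
  have cji: "comm (X j i) (y i j) = G j j - H i i + E1 (y j j * y i i)" using ij by (simp add: Xy)
  have cij: "comm (X i j) (y i j) = E1 (y i j * y i j)" using ij by (simp add: Xy)
  have "d DP = comm (X i j) (d (G j j) - d (H i i)) + E1 (comm (X i j) (d (y j j * y i i))) - E1 (d (comm (X j i) (y i j * y i j)))"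
    unfolding DP_def cji cij by (simp only: d_diff dcX d_add d_E1 comm_lin(8,9,10))
  also have "d (G j j) - d (H i i) = s j j - s i i - E3 (h j j + h i i) - E1 ((\<Sum>c\<in>UNIV. y j c * y1 c j) + (\<Sum>c\<in>UNIV. y1 i c * y c i))"
    by (simp only: dG dH E3_add E1_add) (simp only: algebra_simps)
  finally have "d DP = comm (X i j) (s j j - s i i) - E3 (comm (X i j) (h i i + h j j)) + E1 (p1 i j)"
    unfolding p1_def[OF ij] by (simp only: comm_lin(8,9,10,11) E1_add E1_diff E1_minus E3_add) (simp only: algebra_simps minus_add_distrib minus_diff_eq minus_minus add_uminus_conv_diff uminus_add_conv_diff)
  then have 1: "Tw (del (d DP)) = Tw (del (comm (X i j) (s j j - s i i))) - E3 (Tw (del (comm (X i j) (h i i + h j j)))) + Tw (E1 (del (p1 i j)))"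
    by (simp only: del_simps E3_add) (simp only: algebra_simps)
  have "d (comm F (comm (X i j) (y j j - y i i))) = d (comm (X i j) (U (U (Tw (s j j - s i i)))))"
    unfolding FX2 by (simp add: comm_lin Fy algebra_simps)
  also have "\<dots> = Tw (del (comm (X i j) (s j j - s i i)))"
    unfolding del_def by (simp only: comm_lin(8,12) U_add d_add)
  finally have 2: "Tw (del (comm (X i j) (s j j - s i i))) = d (comm F (comm (X i j) (y j j - y i i)))" ..
  have "Tw (del (comm (X i j) (h i i + h j j))) = del (comm (X i j) (del (y1 i i + y1 j j)))"
    by (simp add: del_simps del_y1 comm_lin algebra_simps)
  also have "\<dots> = del (del (d (comm (X i j) (y i i + y j j))))"
    unfolding del_def by (simp only: comm_lin(12)[symmetric] dcX d_add dy)
  finally show ?thesis unfolding 1 2 by simp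
qed

lemma XE: "comm (X i j) (y i i + y j j) = - E3 (U (U (y1 i j))) - E1 (Tw (U (U (y1 i j))) + (\<Sum>b\<in>UNIV-{i,j}. y i b * y b j))"
  using ij by (simp add: comm_lin Xy H_def isplit algebra_simps)

text \<open>The leading parts cancel: the sum of \<open>G i j\<close> and \<open>H i j\<close> has
  derivative 2 s_ij up to a multiple of e1, so the whole combination is divisible by e1.\<close>

lemma Fpart: "Tw (comm F (s i j)) - Tw (d (comm F (comm (X i i - X j j) (y i j)))) + d (comm F (comm (X i j) (y j j - y i i)))
   = E1 (F0 i j + (\<Sum>b\<in>UNIV-{i,j}. Fb i j b))"
proof -
  have v: "y i j * y i i - y j j * y i j = y i i * y i j - y i j * y j j"
    using ij by (simp add: ord0[OF ij] algebra_simps)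
  have z: "comm (X i i - X j j) (y i j) = G i j + H i j + E1 (y i i * y i j - y i j * y j j)"
    unfolding X_BB v ..
  have z': "comm (X i j) (y j j - y i i) = G i j + H i j - E1 (y i i * y i j - y i j * y j j)"
    using ij by (simp add: comm_lin Xy algebra_simps)
  have "d (G i j) + d (H i j) = Tw (s i j) + E1 (\<Sum>c\<in>UNIV. y1 i c * y c j - y i c * y1 c j)"
    by (simp add: dG dH sum_subtractf algebra_simps)
  then have gh: "comm F (d (G i j)) + comm F (d (H i j)) = comm F (Tw (s i j) + E1 (\<Sum>c\<in>UNIV. y1 i c * y c j - y i c * y1 c j))"
    by (simp only: comm_lin(8)[symmetric])
  have "Tw (comm F (s i j)) - Tw (d (comm F (comm (X i i - X j j) (y i j)))) + d (comm F (comm (X i j) (y j j - y i i)))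
    = Tw (comm F (s i j)) - (comm F (d (G i j)) + comm F (d (H i j))) - E1 (Th (comm F (d (y i i * y i j - y i j * y j j))))"
    unfolding z z' dcF by (simp add: comm_lin algebra_simps)
  also have "\<dots> = - E1 ((\<Sum>c\<in>UNIV. comm F (y1 i c * y c j - y i c * y1 c j)) + Th (comm F (d (y i i * y i j - y i j * y j j))))"
    unfolding gh by (simp add: comm_lin algebra_simps)
  also have "\<dots> = E1 (F0 i j + (\<Sum>b\<in>UNIV-{i,j}. Fb i j b))"
    unfolding isplit F0_def Fb_def
    by (simp add: comm_lin Fy Fs2 del_simps del_sy sum.distrib sum_subtractf sum_negf algebra_simps)
  finally show ?thesis .
qed

lemma cardB: "(of_nat CARD('k) :: 'r) = of_nat (card (UNIV - {i, j})) + 1 + 1"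
proof -
  have "card (UNIV - {i,j} :: 'k set) = CARD('k) - 2" using ij by (simp add: card_Diff_subset)
  moreover have "card {i,j} \<le> CARD('k)" by (rule card_mono) auto
  then have "CARD('k) \<ge> 2" using ij by simp
  ultimately have "CARD('k) = card (UNIV - {i,j} :: 'k set) + 1 + 1" by simp
  then show ?thesis by (metis of_nat_1 of_nat_add)
qed

lemma Vsplit: "V i j = Vt i j i + Vt i j j + (\<Sum>b\<in>UNIV-{i,j}. Vt i j b)"
  unfolding V_def isplit Vt_def by simp

lemma KWcomb: "Tw (U (U (h i i * y1 i j + y1 i i * h i j + (h i j * y1 j j + y1 i j * h j j)))) - del (KWi + KWj) + Th (Vt i j i + Vt i j j) + del (wp i j) = 0"
  using ij ij[symmetric]
  by (simp add: KWi_def KWj_def Vt_def wp_def del_alt ord0[OF ij] algebra_simps)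

lemma KWbV: "Tw (U (U (h i b * y1 b j + y1 i b * h b j))) - del (KWb b) = - Th (Vt i j b)"
  by (simp add: KWb_def Vt_def del_alt algebra_simps)

lemma delK: "del (of_nat n * x) = of_nat n * del x" by (induction n) (simp_all add: del_alt algebra_simps)

text \<open>All terms with e1 are collected here. \<open>V\<close> and \<open>wp\<close> occur with
  total multiplicity proportional to (K - 2) + 2 - K = 0: from the other indices, from i and j, and
  from the factor K produced by \<open>cubC\<close>.\<close>

lemma Theta: "F0 i j + (\<Sum>b\<in>UNIV-{i,j}. Fb i j b) + E3 (del (del (d (Tw (U (U (y1 i j))) + (\<Sum>b\<in>UNIV-{i,j}. y i b * y b j)))))
    + Tw (del (p1 i j)) - Tw (U (U PSI)) - del XI = E1 (del (del (del (y1 i j)))) + of_nat CARD('k) * E3 (del (del (del (y1 i j))))" (is "?L = ?R")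
proof -
  define N where "N = (of_nat (card (UNIV - {i, j})) :: 'r)"
  define R where "R = U (U (r i j))"
  define DD where "DD = U (U (\<Sum>b\<in>UNIV-{i,j}. y1 i b * y1 b j))"
  define VB where "VB = (\<Sum>b\<in>UNIV-{i,j}. Vt i j b)"
  define W where "W = U (U (h i i * y1 i j + y1 i i * h i j + (h i j * y1 j j + y1 i j * h j j)))"
  define B :: "'k set" where "B = UNIV - {i, j}"
  have N: "sum (\<lambda>b. c) B = N * c" for c :: 'r unfolding N_def B_def by simp
  have "?L = (F0 i j + E3 (del (del (d (Tw (U (U (y1 i j))))))) + Tw (del (p0 i j)) - Tw (U (U (Ps0 i j))) - del (Xi0 i j))
    + (\<Sum>b\<in>B. Fb i j b + E3 (del (del (d (y i b * y b j)))) + Tw (del (pb i j b)) - Tw (U (U (Psb i j b))) - del (Xib i j b))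
    + E1 (of_nat CARD('k) * ((Tw (U (U Wp)) - del (KWi + KWj + (\<Sum>b\<in>B. KWb b)))))"
    unfolding p1[OF ij] PSI XI_def B_def
    by (simp add: del_simps delK sum.distrib sum_subtractf algebra_simps)
  also have "(\<Sum>b\<in>B. Fb i j b + E3 (del (del (d (y i b * y b j)))) + Tw (del (pb i j b)) - Tw (U (U (Psb i j b))) - del (Xib i j b))
     = (\<Sum>b\<in>B. E3 (Th (Tw (Tw (Tw R)))) + E1 (Th (V i j) + Th (Tw (Vt i j b)) + del (wp i j)) + E1 (Tw (del (U (U (y1 i b * y1 b j))))))"
  proof (rule sum.cong[OF refl])
    fix b assume "b \<in> B" then have b: "b \<noteq> i" "b \<noteq> j" unfolding B_def by auto
    show "Fb i j b + E3 (del (del (d (y i b * y b j)))) + Tw (del (pb i j b)) - Tw (U (U (Psb i j b))) - del (Xib i j b)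
      = E3 (Th (Tw (Tw (Tw R)))) + E1 (Th (V i j) + Th (Tw (Vt i j b)) + del (wp i j)) + E1 (Tw (del (U (U (y1 i b * y1 b j)))))"
      using Tb[OF b ij] unfolding R_def by (simp only: diff_eq_eq)
  qed
  also have "\<dots> = N * (E3 (Th (Tw (Tw (Tw R)))) + E1 (Th (V i j) + del (wp i j))) + E1 (Th (Tw VB)) + E1 (Tw (del DD))"
    unfolding VB_def DD_def B_def[symmetric]
    by (simp only: sum.distrib E1_add N) (simp add: sum.distrib del_simps del_def[symmetric] N algebra_simps del: d_U)
  also have "F0 i j + E3 (del (del (d (Tw (U (U (y1 i j))))))) + Tw (del (p0 i j)) - Tw (U (U (Ps0 i j))) - del (Xi0 i j)
    = Tw (del (comm (s i j) (y i i + y j j))) + E3 (Tw (Tw (Tw (Th (Tw R))) + Tw (Tw R)))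
     + E1 (Th (Tw (Vt i j i + Vt i j j)) + Tw (del (wp i j)) + Tw (Tw (Tw (Tw R)))) + E1 (Th (Tw (Tw (Tw R))))"
  proof -
    have "del (del (d (Tw (U (U (y1 i j)))))) = Tw (Th (Tw (Tw (Tw R))))"
      unfolding R_def D4[symmetric] by (simp only: d_add del_def[symmetric] del_simps)
    then show ?thesis using T0[OF ij] unfolding R_def by (simp only: diff_eq_eq)
  qed
  also have "Tw (del (comm (s i j) (y i i + y j j))) = - E3 (Tw (Tw (Tw R))) - E1 (Tw (Tw (Tw (Tw R)))) - E1 (Tw (del DD))"
  proof -
    have "comm (s i j) (y i i + y j j) = - E3 (U (U (m i j))) - E1 (Tw (U (U (m i j)))) - E1 DD"
      unfolding S1E[OF ij] isplit DD_def by (simp add: algebra_simps)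
    moreover have "del (U (U (m i j))) = Tw (Tw R)" unfolding R_def by (simp add: del_alt algebra_simps)
    ultimately show ?thesis by (simp add: del_simps)
  qed
  also have "Tw (U (U Wp)) - del (KWi + KWj + (\<Sum>b\<in>B. KWb b)) = - Th (Vt i j i + Vt i j j) - del (wp i j) - Th VB"
  proof -
    have "Tw (U (U Wp)) - del (KWi + KWj + (\<Sum>b\<in>B. KWb b)) = (Tw W - del (KWi + KWj))
       + (\<Sum>b\<in>B. Tw (U (U (h i b * y1 b j + y1 i b * h b j))) - del (KWb b))"
      unfolding Wp_def isplit B_def[symmetric] W_def by (simp add: del_simps sum.distrib sum_subtractf algebra_simps)
    also have "\<dots> = (Tw W - del (KWi + KWj)) - Th VB"
      unfolding KWbV VB_def B_def[symmetric] by (simp add: sum_negf sum.distrib sum_subtractf)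
    also have "Tw W - del (KWi + KWj) = - Th (Vt i j i + Vt i j j) - del (wp i j)"
      using KWcomb unfolding W_def[symmetric] by (simp add: algebra_simps)
    finally show ?thesis by simp
  qed
  finally have L: "?L = - E3 (Tw (Tw (Tw R))) - E1 (Tw (Tw (Tw (Tw R)))) - E1 (Tw (del DD)) + E3 (Tw (Tw (Tw (Th (Tw R))) + Tw (Tw R)))
     + E1 (Th (Tw (Vt i j i + Vt i j j)) + Tw (del (wp i j)) + Tw (Tw (Tw (Tw R)))) + E1 (Th (Tw (Tw (Tw R))))
     + (N * (E3 (Th (Tw (Tw (Tw R)))) + E1 (Th (V i j) + del (wp i j))) + E1 (Th (Tw VB)) + E1 (Tw (del DD)))
     + E1 (of_nat CARD('k) * (- Th (Vt i j i + Vt i j j) - del (wp i j) - Th VB))" .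
  show ?thesis unfolding L cardB N_def[symmetric] Vsplit VB_def[symmetric] D4 R_def[symmetric]
    by (simp add: algebra_simps)
qed

definition "Z = comm F (comm (X i i - X j j) (y i j))"
lemma part1: "- Tw (U (d (comm F (comm F (y i j)))) - Tw (comm F (comm F (y i j)))) + U (U (d (comm w (comm F (comm F (y i j))))))
   = U (U (Tw (Tw (comm F (s i j) - d Z))))"
proof -
  let ?f = "comm F (s i j)"
  have A: "comm F (comm F (y i j)) = U (U (Tw ?f))" by (simp add: Fy comm_lin)
  have "J ?f = comm F (J (s i j)) - Tw (comm (X i i - X j j) (U (U (s i j))))"
  proof -
    have e: "comm w ?f = comm F (comm w (s i j)) - comm (comm F w) (s i j)" by (simp add: comm_def algebra_simps)
    show ?thesis unfolding J_def e Fw comm_lin(1,12) by simp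
  qed
  also have "comm F (J (s i j)) = Tw (U ?f) - Z" using ij unfolding Js Z_def by (simp add: comm_lin)
  also have "Tw (comm (X i i - X j j) (U (U (s i j)))) = Z"
    unfolding Z_def comm_lin(2,9) FX2 Fy by (simp add: comm_lin algebra_simps)
  finally have Jf: "J ?f = Tw (U ?f) - Z - Z" by simp
  have cw: "comm w (U (U (Tw ?f))) = Tw (Tw (U ?f) - Z - Z)" unfolding Jf[symmetric] J_def by (simp add: comm_lin)
  show ?thesis unfolding A cw by (simp add: algebra_simps)
qed

text \<open>The terms with derivatives of \<open>PSI\<close> cancel, because ad w, multiplied by
  u^2, acts on it as 2u plus a remainder, and \<open>L\<close> contains -2 u d/du.\<close>

lemma part2: "- Tw (U (d (U (U (U (U PSI))))) - Tw (U (U (U (U PSI))))) + U (U (d (comm w (U (U (U (U PSI)))))))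
   = U (U (Tw (U (U PSI)) + del XI))"
proof -
  have "comm w (U (U (U (U PSI)))) = U (U (J PSI))" unfolding J_def by (simp add: comm_lin)
  then show ?thesis unfolding JPSI by (simp add: del_def algebra_simps)
qed

text \<open>The series of the brackets [X_ij, N (N-1) (N-2) t_{0,N-3}]: its coefficient at u^(N+1)
  is N (N-1) (N-2) (N-3) T_{0,N-4}(E_ij).\<close>

definition "KC = (let v = U (U (U (U (y1 i j)))); w = d (d (d v)) in U (U (U (U w))))"
definition "eu x = U (d x)"
lemma eu: "d (U x) = x + eu x" "eu (U x) = U x + U (eu x)" "U (d x) = eu x" "eu (a + b) = eu a + eu b" "eu (a - b) = eu a - eu b" "eu (- a) = - eu a"
  "eu (y a' b') = U (y1 a' b')"
  by (simp_all add: eu_def)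
lemma part3: "- Tw (U (d KC) - Tw KC) + U (U (d (comm w KC))) = - U (U (Th (Tw (del (del (del (y1 i j)))))))"
proof -
  define q where "q = eu (y1 i j) + Tw (y1 i j)"
  define b where "b = eu q + Th q"
  define c where "c = eu b + Tw (Tw b)"
  have "d (d (d (U (U (U (U (y1 i j))))))) = U c"
    unfolding c_def b_def q_def by (simp add: eu algebra_simps del: d_U)
  then have KC: "KC = U (U (U (U (U c))))" unfolding KC_def Let_def by simp
  have "d (d (d (U (U (U (y1 i j)))))) - d (d (d (U (U (y i j))))) = eu b"
    unfolding b_def q_def by (simp add: eu algebra_simps del: d_U)
  moreover have "comm w KC = U (U (U (U (d (d (d (U (U (J (y1 i j))))))))))"
    unfolding KC_def Let_def J_def by (simp only: comm_lin(12) dcw[symmetric])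
  moreover have "J (y1 i j) = Tw (U (y1 i j) - y i j)" using ij unfolding Jy1 by simp
  ultimately have w: "comm w KC = Tw (U (U (U (U (eu b)))))"
    by (simp del: d_U)
  have "del (del (del (y1 i j))) = U (U (U c))"
    unfolding del_def c_def b_def q_def by (simp add: eu algebra_simps del: d_U)
  then show ?thesis unfolding w unfolding KC unfolding c_def by (simp add: eu algebra_simps del: d_U)
qed

text \<open>The constant e1^2 - e2 e3 of (A4), rewritten with e2 = - K e1 - e3.\<close>

definition "Ek x = E1 (E1 x) + of_nat CARD('k) * E1 (E3 x) + E3 (E3 x)"
lemma cK: "comm x (of_nat n * z) = of_nat n * comm x z" for x z :: 'r by (induction n) (simp_all add: comm_lin algebra_simps)
lemma Ek: "Ek (a + b) = Ek a + Ek b" "Ek (a - b) = Ek a - Ek b" "Ek (- a) = - Ek a" "Ek (U a) = U (Ek a)" "Ek (d a) = d (Ek a)" "Ek (comm w a) = comm w (Ek a)"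
       apply (simp add: Ek_def algebra_simps)
      apply (simp add: Ek_def algebra_simps)
     apply (simp add: Ek_def algebra_simps)
    apply (simp add: Ek_def algebra_simps)
   apply (simp only: Ek_def dK d_add d_E1 d_E3)
  apply (simp only: Ek_def cK comm_lin(8,10,11))
  done

text \<open>\<open>XE\<close> contributes the e3^2-term and \<open>Theta\<close> the terms e1^2 and
  K e1 e3; together they are \<open>Ek\<close>.\<close>

lemma bracket: "Tw (comm F (s i j)) - Tw (d Z) + Tw (del (d DP)) - E1 (Tw (U (U PSI)) + del XI) - Ek (del (del (del (y1 i j)))) = 0"
proof -
  define S where "S = Tw (U (U (y1 i j))) + (\<Sum>b\<in>UNIV-{i,j}. y i b * y b j)"
  define D where "D = del (del (del (y1 i j)))"
  have "d (comm (X i j) (y i i + y j j)) = - E3 (del (y1 i j)) - E1 (d S)"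
    unfolding XE S_def[symmetric] by (simp only: d_diff d_minus d_E3 d_E1 del_def)
  then have X: "E3 (del (del (d (comm (X i j) (y i i + y j j))))) = - E3 (E3 D) - E1 (E3 (del (del (d S))))"
    by (simp add: del_simps D_def)
  have "Tw (comm F (s i j)) - Tw (d Z) + Tw (del (d DP)) = (Tw (comm F (s i j)) - Tw (d Z) + d (comm F (comm (X i j) (y j j - y i i))))
     + E3 (E3 D) + E1 (E3 (del (del (d S)))) + Tw (E1 (del (p1 i j)))"
    unfolding DP X by (simp only: algebra_simps minus_add_distrib minus_diff_eq minus_minus add_uminus_conv_diff uminus_add_conv_diff)
  also have "Tw (comm F (s i j)) - Tw (d Z) + d (comm F (comm (X i j) (y j j - y i i))) = E1 (F0 i j + (\<Sum>b\<in>UNIV-{i,j}. Fb i j b))"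
    unfolding Z_def by (rule Fpart)
  finally have "Tw (comm F (s i j)) - Tw (d Z) + Tw (del (d DP)) - E1 (Tw (U (U PSI)) + del XI)
    = E1 (F0 i j + (\<Sum>b\<in>UNIV-{i,j}. Fb i j b) + E3 (del (del (d S))) + Tw (del (p1 i j)) - Tw (U (U PSI)) - del XI) + E3 (E3 D)"
    by (simp only: E1_add E1_diff) (simp only: algebra_simps minus_add_distrib minus_diff_eq minus_minus add_uminus_conv_diff uminus_add_conv_diff)
  also have "F0 i j + (\<Sum>b\<in>UNIV-{i,j}. Fb i j b) + E3 (del (del (d S))) + Tw (del (p1 i j)) - Tw (U (U PSI)) - del XI
     = E1 D + of_nat CARD('k) * E3 D"
    unfolding S_def D_def by (rule Theta)
  finally show ?thesis unfolding D_def[symmetric] Ek_def by simp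
qed

text \<open>If a_N is the coefficient of x at u^(N+1), then the coefficient of \<open>L x\<close> at
  u^(N+2) is (N + 1) [w, a_N] - 2 N a_{N+1}, the homogeneous part of the recursion for N
  [t_30, T_{0,N-1}(E_ij)].\<close>

definition "L x = - Tw (U (d x) - Tw x) + U (U (d (comm w x)))"
lemma L_lin: "L (a + b) = L a + L b" "L (a - b) = L a - L b" "L (E1 a) = E1 (L a)" "L (Ek a) = Ek (L a)"
  by (simp add: L_def comm_lin algebra_simps, simp add: L_def comm_lin algebra_simps, simp add: L_def comm_lin algebra_simps)
    (simp only: L_def Ek)

text \<open>The coefficient of \<open>u\<^bsup>N + 2\<^esup>\<close> of this identity relates the commutators of \<open>T\<^sub>1\<^sub>0(E\<^sub>i\<^sub>j)\<close> with the
  right-hand sides of (A4) for \<open>N\<close> and \<open>N + 1\<close>.\<close>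

theorem main: "L (Th (comm F (comm F (y i j))) + Ek KC - E1 (Th (Tw (U (U (U (U PSI))))))) + Th (Tw (Tw (U (U (d (U (U (d DP)))))))) = 0"
proof -
  define D where "D = del (del (del (y1 i j)))"
  define f where "f = comm F (s i j) - d Z"
  define x where "x = Tw (U (U PSI)) + del XI"
  define P where "P = del (d DP)"
  have 1: "L (comm F (comm F (y i j))) = U (U (Tw (Tw f)))" unfolding L_def f_def by (rule part1)
  have 2: "L (U (U (U (U PSI)))) = U (U x)" unfolding L_def x_def by (rule part2)
  have 3: "L KC = - U (U (Th (Tw D)))" unfolding L_def D_def by (rule part3)
  have 4: "Ek (- U (U (Th (Tw D)))) = - U (U (Th (Tw (Ek D))))" by (simp only: Ek U_add)
  have "Tw f + Tw P - E1 x - Ek D = 0" using bracket unfolding f_def x_def P_def D_def by (simp only: algebra_simps)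
  then have 6: "Th (Tw (U (U (Tw f + Tw P - E1 x - Ek D)))) = 0" by simp
  have 5: "U (U (d (U (U (d DP))))) = U (U P)" unfolding P_def del_def ..
  show ?thesis using 6 unfolding L_lin 1 2 3 4 5 by (simp add: algebra_simps)
qed

end
end
end

section \<open>The smaller presentation\<close>

lemma cst_simps [simp]: "cst 0 = 0" "cst 1 = 1" "cst (a + b) = cst a + cst b" "cst (a - b) = cst a - cst b" "cst (a * b) = cst a * cst b"
    "cst (- a) = - cst a" "cst (of_nat n) = of_nat n" "cst (numeral w) = numeral w"
  by (simp_all add: cst_def one_pCons of_nat_poly numeral_poly)

lemma of_base_0 [simp]: "of_base 0 = 0" unfolding of_base_def by transfer (simp add: Zero_fract_def)
lemma of_base_1 [simp]: "of_base 1 = 1" unfolding of_base_def by (simp add: lfrac_arith)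
lemma of_base_add [simp]: "of_base (a + b) = of_base a + of_base b" unfolding of_base_def by (simp add: lfrac_arith)
lemma of_base_mult [simp]: "of_base (a * b) = of_base a * of_base b" unfolding of_base_def by (simp add: lfrac_arith)
lemma of_base_minus [simp]: "of_base (- a) = - of_base a" by (rule minus_unique[symmetric]) (simp flip: of_base_add)
lemma of_base_diff [simp]: "of_base (a - b) = (of_base a - of_base b :: 'a::finite laurent)" using of_base_add[of a "-b" , where ?'a = 'a] by simp

lemma mscale_simps: "mscale 1 X = X" "mscale 0 X = 0" "mscale c 0 = 0"
  by (simp_all add: mscale_def vec_eq_iff)

lemma matrix_mul_sum: "A ** (\<Sum>x\<in>S. B x) = (\<Sum>x\<in>S. A ** (B x :: complex^'n::finite^'n))" for A :: "complex^'n^'n"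
proof -
  have "A ** 0 = (0 :: complex^'n^'n)" by (simp add: matrix_matrix_mult_def vec_eq_iff)
  then show ?thesis by (induction S rule: infinite_finite_induct) (simp_all add: matrix_add_ldistrib)
qed

lemma trace_elemM: "trace (elemM a b :: complex^'k::finite^'k) = (if a = b then 1 else 0)"
proof (cases "a = b")
  case False
  then show ?thesis by (auto simp: trace_def elemM_def intro!: sum.neutral)
qed (simp add: trace_def elemM_def)

lemma mat1_elem: "(mat 1 :: complex^'k::finite^'k) = (\<Sum>a\<in>UNIV. elemM a a)"
proof -
  have "(\<Sum>a\<in>UNIV. if i = a \<and> j = a then 1 else 0) = (if i = j then 1 else (0::complex))" for i j :: 'k
    by (cases "i = j") (auto intro!: sum.neutral)
  then show ?thesis by (simp add: vec_eq_iff mat_def elemM_def)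
qed

lemma mcomm_elem: "mcomm (elemM a b) (elemM c d) = (if b = c then elemM a d else 0) - (if a = d then elemM c b else (0::complex^'k::finite^'k))"
  by (auto simp: mcomm_def elemM_mult)

text \<open>An arbitrary ring in which the smaller relations hold, so that the argument runs with
  elements rather than with classes of words. The instance of interest is the quotient
  \<open>sq\<close>.\<close>

locale small_alg =
  fixes \<iota> :: "'k::finite laurent \<Rightarrow> 'b::ring_1" and T0 :: "nat \<Rightarrow> complex^'k^'k \<Rightarrow> 'b" and T1 :: "complex^'k^'k \<Rightarrow> 'b"
    and t20 t11 t02 :: 'b
  assumes card: "CARD('k) > 1"
    and sm: "structure_map \<iota>"
    and lin0: "T0 n (mscale a X + mscale b Y) = \<iota> (of_base (cst a)) * T0 n X + \<iota> (of_base (cst b)) * T0 n Y"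
    and lin1: "T1 (mscale a X + mscale b Y) = \<iota> (of_base (cst a)) * T1 X + \<iota> (of_base (cst b)) * T1 Y"
    and unit02: "T0 2 (mat 1) = \<iota> (of_base eps2) * t02"
    and S1: "comm (T0 m X) (T0 n Y) = T0 (m + n) (mcomm X Y)"
    and S2: "comm t20 t11 = 2 * t20" "comm t20 t02 = 4 * t11" "comm t02 t11 = - 2 * t02"
      "comm t20 (T0 0 X) = 0" "comm t20 (T0 1 X) = 2 * T1 X" "comm t20 (T1 X) = 0" "comm t02 (T1 X) = - 2 * T0 1 X"
    and S3: "comm (T1 X) (T0 n Y) =
    \<iota> (of_base (cst (1 / of_nat (2 * n + 2)))) * comm t20 (T0 (n + 1) (mcomm X Y))
    - \<iota> (of_base (eps3 TYPE('k) * cst (of_nat n / 2))) * T0 (n - 1) (macomm X Y)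
    - \<iota> (of_base (of_nat n * eps1 * cst (trace Y))) * T0 (n - 1) X
    + \<iota> (of_base eps1) * (\<Sum>m<n. \<iota> (of_base (cst (of_nat (m + 1) / of_nat (n + 1)))) *
        tens (\<lambda>c. \<iota> (of_base (cst c))) (T0 m) (T0 (n - 1 - m)) (kron (mcomm X Y) (mat 1) ** Omega))
    + \<iota> (of_base eps1) * (\<Sum>m<n.
        tens (\<lambda>c. \<iota> (of_base (cst c))) (T0 m) (T0 (n - 1 - m))
          ((kron X Y - kron (X ** Y) (mat 1)) ** Omega))"
begin

definition "k z = \<iota> (of_base (cst z))"
definition "e1 = \<iota> (of_base eps1)"
definition "e2 = \<iota> (of_base eps2)"
definition "e3 = \<iota> (of_base (eps3 TYPE('k)))"

lemma i_add[simp]: "\<iota> (x + y) = \<iota> x + \<iota> y" and i_mult[simp]: "\<iota> (x * y) = \<iota> x * \<iota> y" and i_1[simp]: "\<iota> 1 = 1"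
  and i_cent: "\<iota> x * z = z * \<iota> x"
  using sm unfolding structure_map_def by blast+
lemma i_cent2: "z * (\<iota> x * v) = \<iota> x * (z * v)"
  unfolding mult.assoc[symmetric] i_cent[of x z, symmetric] ..
lemma i_0[simp]: "\<iota> 0 = 0" using structure_map_0[OF sm] .
lemma i_minus[simp]: "\<iota> (- x) = - \<iota> x" using i_add[of x "-x"] by (simp add: minus_unique)
lemma i_diff[simp]: "\<iota> (x - y) = \<iota> x - \<iota> y" using i_add[of x "-y"] by simp

lemma k_simps[simp]: "k 0 = 0" "k 1 = 1" "k (a + b) = k a + k b" "k (a * b) = k a * k b" "k (- a) = - k a" "k (a - b) = k a - k b"
  by (simp_all add: k_def)
lemma k_of_nat[simp]: "k (of_nat n) = of_nat n" by (induction n) (simp_all)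
lemma k_numeral[simp]: "k (numeral n) = numeral n" using k_of_nat[of "numeral n"] by simp
lemma k_inv: "of_nat n \<noteq> (0::complex) \<Longrightarrow> of_nat n * (k (1 / of_nat n) * x) = x"
  by (simp add: k_of_nat[symmetric] mult.assoc[symmetric] k_simps(4)[symmetric] del: k_of_nat k_simps(4))
lemma cents: "z * k a = k a * z" "z * e1 = e1 * z" "z * e2 = e2 * z" "z * e3 = e3 * z"
   "z * (k a * v) = k a * (z * v)" "z * (e1 * v) = e1 * (z * v)" "z * (e2 * v) = e2 * (z * v)" "z * (e3 * v) = e3 * (z * v)"
  unfolding k_def e1_def e2_def e3_def by (rule i_cent[symmetric] i_cent2)+
lemma char0b: "0 < n \<Longrightarrow> of_nat n * x = 0 \<Longrightarrow> x = (0::'b)"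
proof -
  assume n: "0 < n" and "of_nat n * x = 0"
  then have "k (1 / of_nat n) * (of_nat n * x) = 0" by simp
  then have "of_nat n * (k (1 / of_nat n) * x) = 0" unfolding cents(5) .
  then show ?thesis using k_inv[of n x] n by simp
qed
lemma e123: "e3 = - (of_nat CARD('k) * e1) - e2"
proof -
  have "\<iota> (of_base (of_nat n)) = of_nat n" for n by (induction n) simp_all
  then show ?thesis unfolding e3_def eps3_def e1_def e2_def by simp
qed

lemma T_lin: "T0 n (X + Y) = T0 n X + T0 n Y" "T0 n (mscale a X) = k a * T0 n X" "T0 n 0 = 0" "T0 n (X - Y) = T0 n X - T0 n Y"
   "T0 n (- X) = - T0 n X" "T0 n (sum f A) = (\<Sum>x\<in>A. T0 n (f x))"
  "T1 (X + Y) = T1 X + T1 Y" "T1 (mscale a X) = k a * T1 X" "T1 0 = 0" "T1 (X - Y) = T1 X - T1 Y"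
   "T1 (- X) = - T1 X" "T1 (sum f A) = (\<Sum>x\<in>A. T1 (f x))"
proof -
  show a0: "T0 n (X + Y) = T0 n X + T0 n Y" for X Y using lin0[of n 1 X 1 Y] by (simp add: mscale_simps)
  show b0: "T0 n (mscale a X) = k a * T0 n X" for a X using lin0[of n a X 0 0] by (simp add: mscale_simps k_def)
  show c0: "T0 n 0 = 0" using b0[of 0 0] by (simp add: mscale_simps)
  show d0: "T0 n (- X) = - T0 n X" for X using a0[of X "-X"] c0 by (simp add: minus_unique)
  show "T0 n (X - Y) = T0 n X - T0 n Y" using a0[of X "-Y"] d0[of Y] by simp
  show "T0 n (sum f A) = (\<Sum>x\<in>A. T0 n (f x))" by (induction A rule: infinite_finite_induct) (auto simp: a0 c0)
  show a1: "T1 (X + Y) = T1 X + T1 Y" for X Y using lin1[of 1 X 1 Y] by (simp add: mscale_simps)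
  show b1: "T1 (mscale a X) = k a * T1 X" for a X using lin1[of a X 0 0] by (simp add: mscale_simps k_def)
  show c1: "T1 0 = 0" using b1[of 0 0] by (simp add: mscale_simps)
  show d1: "T1 (- X) = - T1 X" for X using a1[of X "-X"] c1 by (simp add: minus_unique)
  show "T1 (X - Y) = T1 X - T1 Y" using a1[of X "-Y"] d1[of Y] by simp
  show "T1 (sum f A) = (\<Sum>x\<in>A. T1 (f x))" by (induction A rule: infinite_finite_induct) (auto simp: a1 c1)
qed

definition "tn m n Z = tens k (T0 m) (T0 n) Z"
lemma tn: "tens (\<lambda>c. \<iota> (of_base (cst c))) (T0 m) (T0 n) Z = tn m n Z" unfolding tn_def k_def ..
lemma tn_kron: "tn m n (kron A B) = T0 m A * T0 n B"
  unfolding tn_def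
proof (rule tens_kron)
  show "structure_map k" unfolding structure_map_def by (intro conjI allI k_simps cents(1)[symmetric])
qed (rule lin0[folded k_def])+
lemma tn_add: "tn m n (Z + Z') = tn m n Z + tn m n Z'" "tn m n (Z - Z') = tn m n Z - tn m n Z'"
  unfolding tn_def tens_def by (simp_all add: sum.distrib sum_subtractf algebra_simps)
lemma tn_0: "tn m n 0 = 0" unfolding tn_def tens_def by simp
lemma tn_sum: "tn m n (sum f A) = (\<Sum>x\<in>A. tn m n (f x))"
  by (induction A rule: infinite_finite_induct) (auto simp: tn_add tn_0)
lemma tn_Omega: "tn m n (kron A B ** Omega) = (\<Sum>a\<in>UNIV. \<Sum>b\<in>UNIV. T0 m (A ** elemM a b) * T0 n (B ** elemM b a))"
  unfolding Omega_def by (simp add: matrix_mul_sum kron_mult tn_sum tn_kron)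

abbreviation "Y n a b \<equiv> T0 n (elemM a b)"
abbreviation "XX a b \<equiv> T1 (elemM a b)"
definition "Tone n X = k (1 / of_nat (2 * n + 2)) * comm t20 (T0 (n + 1) X)"

lemma Yc: "comm (Y m a b) (Y n c d) = (if b = c then Y (m + n) a d else 0) - (if a = d then Y (m + n) c b else 0)"
  unfolding S1 mcomm_elem by (simp add: T_lin)

lemma XY: "comm (XX a b) (Y n c e) = (if b = c then Tone n (elemM a e) else 0) - (if a = e then Tone n (elemM c b) else 0)
   - e3 * k (of_nat n / 2) * ((if b = c then Y (n - 1) a e else 0) + (if a = e then Y (n - 1) c b else 0))
   - (if c = e then of_nat n * e1 * Y (n - 1) a b else 0)
   + e1 * (\<Sum>m<n. k (of_nat (m + 1) / of_nat (n + 1)) * ((if b = c then \<Sum>x\<in>UNIV. Y m a x * Y (n - 1 - m) x e else 0) - (if a = e then \<Sum>x\<in>UNIV. Y m c x * Y (n - 1 - m) x b else 0)))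
   + e1 * (\<Sum>m<n. Y m a e * Y (n - 1 - m) c b - (if b = c then \<Sum>x\<in>UNIV. Y m a x * Y (n - 1 - m) x e else 0))"
proof -
  \<comment> \<open>Right multiplication by \<open>Omega\<close> exchanges the column indices of the
    two tensor factors; the identity matrix contributes a sum over diagonal units.\<close>
  have O1: "tn m m' (kron (elemM a b) (mat 1) ** Omega) = (\<Sum>x\<in>UNIV. Y m a x * Y m' x b)" for m m' a b
    unfolding tn_Omega by (simp add: elemM_mult if_distrib[of "T0 _"] if_distrib[of "\<lambda>x. x * _"] T_lin sum.swap[of _ UNIV UNIV] cong: if_cong)
  have O2: "tn m m' (kron (elemM a b) (elemM c d) ** Omega) = Y m a d * Y m' c b" for m m' a b c d
    unfolding tn_Omega by (simp add: elemM_mult if_distrib[of "T0 _"] if_distrib[of "\<lambda>x. x * _"] if_distrib[of "\<lambda>x. _ * x"] T_lin cong: if_cong)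
  have O3: "kron (A - B) C = kron A C - kron B C" "kron 0 C = (0 :: complex^('k \<times> 'k)^('k \<times> 'k))" for A B C :: "complex^'k^'k"
    by (simp_all add: kron_def vec_eq_iff algebra_simps)
  have O4: "(P - P') ** W = P ** W - P' ** W" "0 ** W = 0" for P P' W :: "complex^('k\<times>'k)^('k\<times>'k)"
    by (simp_all add: matrix_matrix_mult_def vec_eq_iff algebra_simps sum_subtractf)
  have m1: "tn m m' (kron (mcomm (elemM a b) (elemM c e)) (mat 1) ** Omega) = (if b = c then \<Sum>x\<in>UNIV. Y m a x * Y m' x e else 0) - (if a = e then \<Sum>x\<in>UNIV. Y m c x * Y m' x b else 0)" for m m'
    by (simp add: mcomm_elem O3 O4 tn_add O1 tn_0)
  have m2: "tn m m' ((kron (elemM a b) (elemM c e) - kron (elemM a b ** elemM c e) (mat 1)) ** Omega)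
    = Y m a e * Y m' c b - (if b = c then \<Sum>x\<in>UNIV. Y m a x * Y m' x e else 0)" for m m'
    by (simp add: O4 tn_add O2 O1 elemM_mult O3 tn_0)
  have cs: "comm t20 (x - y) = comm t20 x - comm t20 y" for x y by (simp add: comm_def algebra_simps)
  have "\<iota> (of_base (of_nat n)) = of_nat n" for n by (induction n) simp_all
  then have o: "\<iota> (of_base (of_nat n * eps1 * cst z)) = of_nat n * e1 * k z" for n z unfolding e1_def k_def by simp
  have p: "\<iota> (of_base (eps3 TYPE('k) * cst z)) = e3 * k z" for z unfolding e3_def k_def by simp
  have t: "k (1 / of_nat (2 * n + 2)) * comm t20 (T0 (n + 1) (mcomm (elemM a b) (elemM c e))) = (if b = c then Tone n (elemM a e) else 0) - (if a = e then Tone n (elemM c b) else 0)"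
    unfolding mcomm_elem Tone_def T_lin(4) cs by (simp add: T_lin comm_def right_diff_distrib)
  have ma: "T0 q (macomm (elemM a b) (elemM c e)) = (if b = c then Y q a e else 0) + (if a = e then Y q c b else 0)" for q
    unfolding macomm_def elemM_mult T_lin(1) by (auto simp: T_lin)
  have tr: "of_nat n * e1 * k (if c = e then 1 else 0) * z = (if c = e then of_nat n * e1 * z else 0)" for z by simp
  show ?thesis
    unfolding S3 o p ma trace_elemM k_def[symmetric] e1_def[symmetric] t tr tn_def[symmetric] m1 m2 ..
qed
end

text \<open>This compares coefficients in (1 - x)^(-p-1) (1 - x)^(-q-1); the proof uses Pascal's
  rule on the first factor.\<close>

lemma sum_choose_conv: "(\<Sum>m\<le>n. ((m + p) choose p) * ((n - m + q) choose q)) = (n + p + q + 1) choose (p + q + 1)"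
proof (induction p arbitrary: n)
  case 0
  have "(\<Sum>m\<le>n. (n - m + q) choose q) = (\<Sum>m\<le>n. (m + q) choose q)"
    by (rule sum.reindex_bij_witness[of _ "\<lambda>m. n - m" "\<lambda>m. n - m"]) auto
  also have "\<dots> = (\<Sum>m\<le>n. (q + m) choose m)"
    by (intro sum.cong refl) (metis add.commute binomial_symmetric diff_add_inverse le_add1)
  also have "\<dots> = (n + q + 1) choose (q + 1)"
    unfolding sum_choose_lower using binomial_symmetric[of n "Suc (q + n)"] by (simp add: add.commute)
  finally show ?case by simp
next
  case (Suc p)
  show ?case
  proof (induction n)
    case (Suc n)
    have "(\<Sum>m\<le>Suc n. ((m + Suc p) choose Suc p) * ((Suc n - m + q) choose q))
       = (\<Sum>m\<le>Suc n. ((m + p) choose p) * ((Suc n - m + q) choose q)) + (\<Sum>m\<le>Suc n. ((m + p) choose Suc p) * ((Suc n - m + q) choose q))"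
      by (simp add: sum.distrib algebra_simps del: sum.atMost_Suc)
    also have "(\<Sum>m\<le>Suc n. ((m + p) choose Suc p) * ((Suc n - m + q) choose q)) = (\<Sum>m\<le>n. ((m + Suc p) choose Suc p) * ((n - m + q) choose q))"
      by (subst sum.atMost_Suc_shift) simp
    finally show ?case unfolding \<open>\<And>n. _ = (n + p + q + 1) choose (p + q + 1)\<close> Suc.IH by simp
  qed simp
qed

section \<open>The generating series over an algebra with the smaller presentation\<close>

context small_alg begin

definition "yb q a b = Abs_fps (\<lambda>n. of_nat ((n + q) choose q) * Y n a b)"
definition "UU x = fps_X * x" for x :: "'b fps"
abbreviation "dV \<equiv> fps_deriv :: 'b fps \<Rightarrow> _"
abbreviation "EE1 \<equiv> \<lambda>x. fps_const e1 * x"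
abbreviation "EE3 \<equiv> \<lambda>x. fps_const e3 * x"
definition "fy a b = UU (yb 0 a b)"
definition "fh a b = UU (yb 2 a b)"
definition "fr a b = UU (yb 4 a b)"
definition "fs a b = Abs_fps (\<lambda>n. of_nat (n + 1) * Tone n (elemM a b))"
text \<open>Defined by termwise integration with constant term 0, because the fractions with
  denominator n + 1 in (A3') are integration factors.\<close>

definition "fG a b = Abs_fps (\<lambda>n. if n = 0 then 0 else k (1 / of_nat n) *
   fps_nth (fs a b - EE3 (fh a b) - EE1 (\<Sum>c\<in>UNIV. fy a c * yb 1 c b)) (n - 1))"
abbreviation "fX a b \<equiv> fps_const (XX a b)"
abbreviation "fF \<equiv> fps_const t20"

lemma UU_nth: "fps_nth (UU x) n = (if n = 0 then 0 else fps_nth x (n - 1))" by (simp add: UU_def)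
lemma e1_comm: "fps_const e1 * z = z * fps_const e1" and e3_comm: "fps_const e3 * z = z * fps_const e3"
  by (simp_all add: fps_eq_iff cents)
lemma e13_comm: "e3 * (e1 * z) = e1 * (e3 * z)" by (metis cents(6))

lemma dring: "dring dV UU EE1 EE3"
proof
  fix x z :: "'b fps" and n :: nat
  show "UU (x + z) = UU x + UU z" by (simp add: UU_def distrib_left)
  show "UU x * z = UU (x * z)" by (simp add: UU_def mult.assoc)
  show "x * UU z = UU (x * z)" unfolding UU_def by (metis fps_mult_fps_X_commute mult.assoc)
  show "x * EE1 z = EE1 (x * z)" by (metis e1_comm mult.assoc)
  show "x * EE3 z = EE3 (x * z)" by (metis e3_comm mult.assoc)
  show "dV (UU x) = x + UU (dV x)" by (simp add: UU_def)
  show "UU (EE1 x) = EE1 (UU x)" "UU (EE3 x) = EE3 (UU x)" unfolding UU_def by (metis fps_mult_fps_X_commute mult.assoc)+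
  show "EE3 (EE1 x) = EE1 (EE3 x)" by (simp add: fps_eq_iff e13_comm)
  show "x = 0" if "UU x = 0"
  proof (rule fps_ext)
    fix n
    show "fps_nth x n = fps_nth 0 n" using arg_cong[OF that, of "\<lambda>x. fps_nth x (Suc n)"] by (simp add: UU_nth)
  qed
  show "x = 0" if "0 < n" "of_nat n * x = 0"
  proof (rule fps_ext)
    fix m
    have "of_nat n * fps_nth x m = 0" using arg_cong[OF that(2), of "\<lambda>x. fps_nth x m"] by (simp flip: fps_of_nat)
    from char0b[OF that(1) this] show "fps_nth x m = fps_nth 0 m" by simp
  qed
qed (simp_all add: distrib_left mult.assoc add.commute)

lemma nat_left: "x * (of_nat n * z) = of_nat n * (x * (z::'b))" by (metis mult.assoc mult_of_nat_commute)

lemma nat_comm: "comm (of_nat m * x) (of_nat n * z) = of_nat m * of_nat n * comm x (z::'b)"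
  unfolding comm_def right_diff_distrib mult.assoc nat_left[of x n] nat_left[of z m] by (metis nat_left)

lemma comm_nth: "fps_nth (comm x z) n = (\<Sum>m\<le>n. comm (fps_nth x m) (fps_nth (z :: 'b fps) (n - m)))"
proof -
  have "(\<Sum>m\<le>n. fps_nth z m * fps_nth x (n - m)) = (\<Sum>m\<le>n. fps_nth z (n - m) * fps_nth x m)"
    by (rule sum.reindex_bij_witness[of _ "\<lambda>m. n - m" "\<lambda>m. n - m"]) auto
  then show ?thesis by (simp add: comm_def fps_mult_nth sum_subtractf atMost_atLeast0)
qed
lemma comm_const_nth: "fps_nth (comm (fps_const x) z) n = comm x (fps_nth (z :: 'b fps) n)"
  by (simp add: comm_def)

lemma yb_nth: "fps_nth (yb q a b) n = of_nat ((n + q) choose q) * Y n a b" by (simp add: yb_def)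

text \<open>The bracket of Y_m with Y_n depends only on m + n, so the binomial weights convolve by
  \<open>sum_choose_conv\<close>.\<close>

lemma yb_comm: "comm (yb p a b) (yb q c e) = (if b = c then yb (p + q + 1) a e else 0) - (if a = e then yb (p + q + 1) c b else 0)"
proof (rule fps_ext)
  fix n
  let ?Z = "(if b = c then Y n a e else 0) - (if a = e then Y n c b else 0)"
  have "fps_nth (comm (yb p a b) (yb q c e)) n = (\<Sum>m\<le>n. of_nat (((m + p) choose p) * ((n - m + q) choose q)) * ?Z)"
    unfolding comm_nth yb_nth nat_comm Yc by (intro sum.cong refl) simp
  also have "\<dots> = of_nat ((n + p + q + 1) choose (p + q + 1)) * ?Z"
    unfolding sum_choose_conv[symmetric] of_nat_sum sum_distrib_right ..
  also have "\<dots> = fps_nth ((if b = c then yb (p + q + 1) a e else 0) - (if a = e then yb (p + q + 1) c b else 0)) n"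
    by (simp add: yb_nth algebra_simps)
  finally show "fps_nth (comm (yb p a b) (yb q c e)) n = \<dots>" .
qed

lemma comm_UU: "comm (UU x) z = UU (comm x z)" "comm x (UU z) = UU (comm x z)"
  using fps_mult_fps_X_commute[of x] fps_mult_fps_X_commute[of z] unfolding comm_def UU_def
  by (simp_all add: right_diff_distrib mult.assoc[symmetric])  (simp_all add: mult.assoc)
lemma UU_if: "UU 0 = 0" "UU (- x) = - UU x" "UU (x - z) = UU x - UU z" "UU (if P then x else 0) = (if P then UU x else 0)"
  by (simp_all add: UU_def right_diff_distrib)

end

context small_alg begin

lemma k_of_nat_inv: "of_nat (Suc n) * (k (1 / of_nat (Suc n)) * x) = x"
  by (rule k_inv) (simp del: of_nat_Suc)

lemma F_T0: "comm t20 (T0 (Suc n) X) = of_nat (2 * Suc n) * Tone n X"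
proof -
  have "of_nat (2 * Suc n) * (k (1 / of_nat (2 * Suc n)) * comm t20 (T0 (Suc n) X)) = comm t20 (T0 (Suc n) X)"
    by (rule k_inv) (simp del: of_nat_Suc of_nat_mult)
  then show ?thesis unfolding Tone_def by simp
qed
lemma Tone_0: "Tone 0 X = T1 X"
proof -
  have "of_nat 2 * Tone 0 X = of_nat 2 * T1 X" using F_T0[of 0 X] S2(5)[of X] by simp
  then have "of_nat 2 * (Tone 0 X - T1 X) = 0" by (simp add: algebra_simps)
  then show ?thesis using char0b[of 2] by fastforce
qed

lemma dG_ser: "dV (fG a b) = fs a b - EE3 (fh a b) - EE1 (\<Sum>c\<in>UNIV. fy a c * yb 1 c b)"
proof (rule fps_ext)
  fix n
  show "fps_nth (dV (fG a b)) n = fps_nth (fs a b - EE3 (fh a b) - EE1 (\<Sum>c\<in>UNIV. fy a c * yb 1 c b)) n"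
    unfolding fps_deriv_nth fG_def using k_of_nat_inv[of n] by simp
qed

lemma binom_facts: "(n + 2) * ((n + 1) choose 1) = 2 * ((n + 2) choose 2)" "(n + 3) * ((n + 2) choose 2) = 3 * ((n + 3) choose 3)"
   "(n + 4) * ((n + 3) choose 3) = 4 * ((n + 4) choose 4)"
  using Suc_times_binomial[of 1 "Suc n"] Suc_times_binomial[of 2 "n + 2"] Suc_times_binomial[of 3 "n+3"]
  by (simp_all add: eval_nat_numeral)

lemma natprod: "n * A = 2 * C \<Longrightarrow> of_nat n * (of_nat A * z) = of_nat C * z + of_nat C * (z::'b)"
   "n * A = 3 * C \<Longrightarrow> of_nat n * (of_nat A * z) = of_nat C * z + of_nat C * z + of_nat C * z"
   "n * A = 4 * C \<Longrightarrow> of_nat n * (of_nat A * z) = of_nat C * z + of_nat C * z + of_nat C * z + of_nat C * z"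
proof -
  assume "n * A = 2 * C"
  then have "n * A = C + C" by simp
  then show "of_nat n * (of_nat A * z) = of_nat C * z + of_nat C * z" by (metis of_nat_mult of_nat_add mult.assoc distrib_right)
next
  assume "n * A = 3 * C"
  then have "n * A = C + C + C" by simp
  then show "of_nat n * (of_nat A * z) = of_nat C * z + of_nat C * z + of_nat C * z" by (metis of_nat_mult of_nat_add mult.assoc distrib_right)
next
  assume "n * A = 4 * C"
  then have "n * A = C + C + C + C" by simp
  then show "of_nat n * (of_nat A * z) = of_nat C * z + of_nat C * z + of_nat C * z + of_nat C * z" by (metis of_nat_mult of_nat_add mult.assoc distrib_right)
qed

lemma d_ser: "dV (fy a b) = yb 1 a b" "dV (UU (UU (yb 1 a b))) = fh a b + fh a b"
   "dV (UU (UU (fh a b))) = UU (UU (yb 3 a b + yb 3 a b + yb 3 a b))"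
   "dV (UU (UU (UU (UU (yb 3 a b))))) = UU (UU (fr a b + fr a b + fr a b + fr a b))"
proof -
  note [simp] = of_nat_1[unfolded One_nat_def] UU_nth yb_nth eval_nat_numeral and [simp del] = of_nat_Suc mult_Suc mult_Suc_right binomial_Suc_Suc
  show "dV (fy a b) = yb 1 a b" by (rule fps_ext) (simp add: fy_def)
  show "dV (UU (UU (yb 1 a b))) = fh a b + fh a b"
  proof (rule fps_ext)
    fix n show "fps_nth (dV (UU (UU (yb 1 a b)))) n = fps_nth (fh a b + fh a b) n"
    proof (cases n)
      case (Suc m)
      show ?thesis unfolding fh_def Suc using natprod(1)[OF binom_facts(1)[of m], of "Y m a b"] by simp
    qed (simp add: fh_def)
  qed
  show "dV (UU (UU (fh a b))) = UU (UU (yb 3 a b + yb 3 a b + yb 3 a b))"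
  proof (rule fps_ext)
    fix n show "fps_nth (dV (UU (UU (fh a b)))) n = fps_nth (UU (UU (yb 3 a b + yb 3 a b + yb 3 a b))) n"
    proof (cases "n \<ge> 2")
      case True
      then obtain m where n: "n = m + 2" using le_Suc_ex by (metis add.commute)
      show ?thesis unfolding fh_def n using natprod(2)[OF binom_facts(2)[of m], of "Y m a b"] by simp
    qed (auto simp: fh_def)
  qed
  show "dV (UU (UU (UU (UU (yb 3 a b))))) = UU (UU (fr a b + fr a b + fr a b + fr a b))"
  proof (rule fps_ext)
    fix n show "fps_nth (dV (UU (UU (UU (UU (yb 3 a b)))))) n = fps_nth (UU (UU (fr a b + fr a b + fr a b + fr a b))) n"
    proof (cases "n \<ge> 3")
      case True
      then obtain m where n: "n = m + 3" using le_Suc_ex by (metis add.commute)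
      show ?thesis unfolding fr_def n using natprod(3)[OF binom_facts(3)[of m], of "Y m a b"] by simp
    qed (auto simp: fr_def)
  qed
qed

lemma y_ser_nth: "fps_nth (fy a b) n = (if n = 0 then 0 else Y (n - 1) a b)"
  by (simp add: fy_def UU_nth yb_nth)
lemma F_ser: "comm fF (fX a b) = 0" "comm fF (fy a b) = UU (UU (fs a b + fs a b))"
proof -
  show "comm fF (fX a b) = 0" using S2(6) by (auto simp: fps_eq_iff comm_const_nth comm_def)
  show "comm fF (fy a b) = UU (UU (fs a b + fs a b))"
  proof (rule fps_ext)
    fix n show "fps_nth (comm fF (fy a b)) n = fps_nth (UU (UU (fs a b + fs a b))) n"
    proof (cases "n \<ge> 2")
      case True
      then obtain m where n: "n = m + 2" using le_Suc_ex by (metis add.commute)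
      show ?thesis unfolding n comm_const_nth y_ser_nth UU_nth using F_T0[of m "elemM a b"]
        by (simp add: fs_def distrib_left distrib_right mult_2 add_ac)
    next
      case False
      then consider "n = 0" | "n = 1" by linarith
      then show ?thesis by cases (simp_all add: comm_const_nth y_ser_nth UU_nth S2(4), simp add: comm_def)
    qed
  qed
qed

interpretation C: cur dV UU EE1 EE3 fy "\<lambda>a b. yb 1 a b" fh "\<lambda>a b. yb 3 a b" fr fG fs fX fF
proof (intro cur.intro cur_axioms.intro)
  show "dring dV UU EE1 EE3" by (rule dring)
qed (rule d_ser F_ser dG_ser | simp add: fy_def fh_def fr_def comm_UU yb_comm UU_if eval_nat_numeral)+

lemma ysum_nth: "fps_nth (fy a c * yb 1 c b) n = (\<Sum>m<n. of_nat (n - m) * (Y m a c * Y (n - 1 - m) c b))"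
proof -
  have "fps_nth (fy a c * yb 1 c b) n = (\<Sum>m\<le>n. (if m = 0 then 0 else Y (m - 1) a c) * (of_nat (n - m + 1) * Y (n - m) c b))"
    by (simp add: fps_mult_nth y_ser_nth yb_nth atMost_atLeast0)
  also have "\<dots> = (\<Sum>m<n. Y m a c * (of_nat (n - m) * Y (n - 1 - m) c b))"
    by (cases n) (simp, simp add: lessThan_Suc_atMost sum.atMost_Suc_shift Suc_diff_le del: sum.atMost_Suc)
  finally show ?thesis unfolding nat_left .
qed
lemma yy_nth: "fps_nth (fy a b * fy c e) (Suc n) = (\<Sum>m<n. Y m a b * Y (n - 1 - m) c e)"
proof -
  have "fps_nth (fy a b * fy c e) (Suc n) = (\<Sum>m\<le>Suc n. (if m = 0 then 0 else Y (m - 1) a b) * (if n < m then 0 else Y (n - m) c e))"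
    by (simp add: fps_mult_nth y_ser_nth atMost_atLeast0 Suc_diff_le cong: sum.cong)
      (intro sum.cong refl, auto simp: Suc_diff_le)
  also have "\<dots> = (\<Sum>m\<le>n. Y m a b * (if n < Suc m then 0 else Y (n - Suc m) c e))"
    by (simp add: sum.atMost_Suc_shift del: sum.atMost_Suc)
  also have "\<dots> = (\<Sum>m<n. Y m a b * Y (n - 1 - m) c e)"
    by (rule sum.mono_neutral_cong_right) auto
  finally show ?thesis .
qed

lemma if_nth: "fps_nth (if P then x else z) n = (if P then fps_nth x n else fps_nth z n)" by simp

lemma G_ser_nth: "fps_nth (fG a b) (Suc n) = Tone n (elemM a b) - e3 * k (of_nat n / 2) * Y (n - 1) a b
   - e1 * (\<Sum>m<n. k (of_nat (n - m) / of_nat (n + 1)) * (\<Sum>x\<in>UNIV. Y m a x * Y (n - 1 - m) x b))"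
proof -
  have 1: "k (1 / of_nat (Suc n)) * (of_nat (Suc n) * z) = z" for z
    using k_of_nat_inv[of n z] by (metis cents(5))
  have 2: "k (1 / of_nat (Suc n)) * (of_nat q * z) = k (of_nat q / of_nat (Suc n)) * z" for q z
    unfolding k_of_nat[symmetric] mult.assoc[symmetric] k_simps(4)[symmetric] by simp
  have 3: "k (1 / of_nat (Suc n)) * fps_nth (fh a b) n = k (of_nat n / 2) * Y (n - 1) a b"
  proof (cases n)
    case (Suc m)
    have "of_nat (2 * (Suc (Suc m) choose 2)) = (of_nat (Suc (Suc m) * Suc m) :: complex)"
      using binom_facts(1)[of m] by (simp only: choose_one) (simp add: eval_nat_numeral)
    then have "of_nat (Suc (Suc m) choose 2) / of_nat (Suc (Suc m)) = (of_nat (Suc m) / 2 :: complex)"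
      by (simp only: of_nat_mult) (simp add: field_simps del: of_nat_Suc)
    moreover have "fps_nth (fh a b) (Suc m) = of_nat (Suc (Suc m) choose 2) * Y m a b"
      by (simp add: fh_def UU_nth yb_nth eval_nat_numeral del: binomial_Suc_Suc of_nat_Suc)
    ultimately show ?thesis unfolding Suc by (simp only: 2[unfolded Suc] diff_Suc_1)
  qed (simp add: fh_def UU_nth)
  have 4: "fps_nth (\<Sum>c\<in>UNIV. fy a c * yb 1 c b) n = (\<Sum>m<n. of_nat (n - m) * (\<Sum>x\<in>UNIV. Y m a x * Y (n - 1 - m) x b))"
    unfolding fps_sum_nth ysum_nth by (subst sum.swap) (simp only: sum_distrib_left)
  have 5: "k (1 / of_nat (Suc n)) * (e1 * z) = e1 * (k (1 / of_nat (Suc n)) * z)"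
      "k (1 / of_nat (Suc n)) * (e3 * z) = e3 * (k (1 / of_nat (Suc n)) * z)" for z by (rule cents)+
  have 6: "k (1 / of_nat (Suc n)) * sum f A = (\<Sum>x\<in>A. k (1 / of_nat (Suc n)) * f x)" for f :: "nat \<Rightarrow> _" and A by (rule sum_distrib_left)
  have "fps_nth (fG a b) (Suc n) = k (1 / of_nat (Suc n)) * (of_nat (Suc n) * Tone n (elemM a b) - e3 * fps_nth (fh a b) n
     - e1 * (\<Sum>m<n. of_nat (n - m) * (\<Sum>x\<in>UNIV. Y m a x * Y (n - 1 - m) x b)))"
    by (simp only: fG_def fps_nth_Abs_fps fps_sub_nth fps_mult_left_const_nth fs_def nat.simps if_False diff_Suc_1 Suc_eq_plus1[symmetric] 4)
  then show ?thesis unfolding right_diff_distrib 1 unfolding 5 3 6 2 mult.assoc Suc_eq_plus1[symmetric] .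
qed

lemma H_ser_nth: "fps_nth (C.H a b) (Suc n) = Tone n (elemM a b) + e3 * k (of_nat n / 2) * Y (n - 1) a b
   + e1 * (\<Sum>m<n. k (of_nat (m + 1) / of_nat (n + 1)) * (\<Sum>x\<in>UNIV. Y m a x * Y (n - 1 - m) x b))"
proof -
  have 1: "e3 * fps_nth (UU (UU (yb 1 a b))) (Suc n) = e3 * k (of_nat n) * Y (n - 1) a b"
    by (cases n) (simp_all add: UU_nth yb_nth mult.assoc)
  have 2: "fps_nth (\<Sum>c\<in>UNIV. fy a c * fy c b) (Suc n) = (\<Sum>m<n. \<Sum>x\<in>UNIV. Y m a x * Y (n - 1 - m) x b)"
    unfolding fps_sum_nth yy_nth by (rule sum.swap)
  \<comment> \<open>\<open>H\<close> adds all products with weight 1 to those of \<open>G\<close>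
    with weight -(n - m)/(n + 1); the weights (m + 1)/(n + 1) of (A3') are what results.\<close>
  have 3: "k (of_nat (m + 1) / of_nat (n + 1)) * z = z - k (of_nat (n - m) / of_nat (n + 1)) * z" if "m < n" for m z
  proof -
    have "of_nat (m + 1) / of_nat (n + 1) = 1 - (of_nat (n - m) / of_nat (n + 1) :: complex)"
      using that by (simp add: field_simps of_nat_diff del: of_nat_Suc) (simp add: algebra_simps)
    then show ?thesis by (simp only: k_simps left_diff_distrib mult_1)
  qed
  have 4: "e3 * k (of_nat n) * z = e3 * k (of_nat n / 2) * z + e3 * k (of_nat n / 2) * z" for z
  proof -
    have "of_nat n = of_nat n / 2 + (of_nat n / 2 :: complex)" by simp
    then show ?thesis by (metis k_simps(3) distrib_right distrib_left)
  qed
  have 5: "(\<Sum>m<n. k (of_nat (m + 1) / of_nat (n + 1)) * f m) = sum f {..<n} - (\<Sum>m<n. k (of_nat (n - m) / of_nat (n + 1)) * f m)" for f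
    unfolding sum_subtractf[symmetric] by (intro sum.cong refl 3) simp
  have "fps_nth (C.H a b) (Suc n) = fps_nth (fG a b) (Suc n) + e3 * fps_nth (UU (UU (yb 1 a b))) (Suc n)
     + e1 * fps_nth (\<Sum>c\<in>UNIV. fy a c * fy c b) (Suc n)" by (simp only: C.H_def fps_add_nth fps_mult_left_const_nth)
  then show ?thesis unfolding 1 2 G_ser_nth 5 4 right_diff_distrib by simp
qed

lemma G_ser_0: "fps_nth (fG a b) 0 = 0" by (simp add: fG_def)
lemma H_ser_0: "fps_nth (C.H a b) 0 = 0"
  unfolding C.H_def fps_add_nth fps_mult_left_const_nth UU_nth fps_sum_nth fps_mult_nth_0 y_ser_nth G_ser_0 by simp
lemma UUy_nth: "fps_nth (UU (UU (yb 1 a b))) (Suc n) = of_nat n * Y (n - 1) a b"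
  by (cases n) (simp_all add: UU_nth yb_nth)

lemma Xy_ser: "comm (fX a b) (fy c e) = (if b = c then fG a e else 0) - (if a = e then C.H c b else 0)
     - (if c = e then EE1 (UU (UU (yb 1 a b))) else 0) + EE1 (fy a e * fy c b)"
proof (rule fps_ext)
  fix n
  show "fps_nth (comm (fX a b) (fy c e)) n = fps_nth ((if b = c then fG a e else 0) - (if a = e then C.H c b else 0)
     - (if c = e then EE1 (UU (UU (yb 1 a b))) else 0) + EE1 (fy a e * fy c b)) n"
  proof (cases n)
    case 0
    show ?thesis
      unfolding 0 fps_add_nth fps_sub_nth if_nth fps_mult_left_const_nth fps_zero_nth UU_nth comm_const_nth y_ser_nth
        H_ser_0 G_ser_0 fps_mult_nth_0 by (simp add: comm_def)
  next
    case (Suc n')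
    have 3: "k (of_nat (n' - m) / of_nat (n' + 1)) * z = z - k (of_nat (m + 1) / of_nat (n' + 1)) * z" if "m < n'" for m z
    proof -
      have "of_nat (n' - m) / of_nat (n' + 1) = 1 - (of_nat (m + 1) / of_nat (n' + 1) :: complex)"
        using that by (simp add: field_simps of_nat_diff del: of_nat_Suc) (simp add: algebra_simps)
      then show ?thesis by (simp only: k_simps left_diff_distrib mult_1)
    qed
    have 5: "(\<Sum>m<n'. k (of_nat (n' - m) / of_nat (n' + 1)) * f m) = sum f {..<n'} - (\<Sum>m<n'. k (of_nat (m + 1) / of_nat (n' + 1)) * f m)" for f
      unfolding sum_subtractf[symmetric] by (intro sum.cong refl 3) simp
    have 6: "e1 * (of_nat n' * z) = of_nat n' * e1 * z" for z by (metis mult.assoc mult_of_nat_commute)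
    have "comm (XX a b) (Y n' c e) = (if b = c then fps_nth (fG a e) (Suc n') else 0) - (if a = e then fps_nth (C.H c b) (Suc n') else 0)
     - (if c = e then e1 * (of_nat n' * Y (n' - 1) a b) else 0) + e1 * (\<Sum>m<n'. Y m a e * Y (n' - 1 - m) c b)"
      unfolding XY G_ser_nth H_ser_nth 5 6
      by (cases "b = c"; cases "a = e")
         (simp_all only: simp_thms if_True if_False mult_minus_right sum_negf right_diff_distrib distrib_left sum_subtractf mult_zero_right sum.neutral_const
             diff_0_right diff_0 add_0_left add_0_right,
          simp_all only: add_ac diff_conv_add_uminus minus_add_distrib minus_minus minus_diff_eq)
    then show ?thesis unfolding Suc fps_add_nth fps_sub_nth if_nth fps_mult_left_const_nth fps_zero_nth UUy_nth yy_nth comm_const_nth y_ser_nth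
      by (simp only: nat.simps if_False diff_Suc_1)
  qed
qed

lemmas cur_ser = C.cur_axioms
end

section \<open>Central scalars, the inverses of e2 and e3, and brackets with T_0n(1)\<close>

context small_alg begin

definition central :: "'b \<Rightarrow> bool" where "central c \<longleftrightarrow> (\<forall>z. c * z = z * c)"
lemma central_simps[simp]: "central (\<iota> p)" "central (k c)" "central e1" "central e2" "central e3" "central (of_nat n)" "central (numeral w)"
proof -
  show i: "central (\<iota> p)" for p unfolding central_def by (rule allI) (rule i_cent)
  show "central (k c)" "central e1" "central e2" "central e3" unfolding k_def e1_def e2_def e3_def by (rule i)+
  show n: "central (of_nat n)" for n unfolding central_def by (rule allI) (rule mult_of_nat_commute)
  show "central (numeral w)" using n[of "numeral w"] by simp
qed
lemma central_mult[simp]: "central c \<Longrightarrow> central c' \<Longrightarrow> central (c * c')"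
  unfolding central_def by (metis mult.assoc)
lemma comm_c: assumes "central c" shows "comm (c * x) z = c * comm x z" "comm z (c * x) = c * comm z x" "comm c z = 0" "comm z c = 0"
proof -
  have c: "z * (c * x) = c * (z * x)" for z x using assms unfolding central_def by (metis mult.assoc)
  show "comm (c * x) z = c * comm x z" "comm z (c * x) = c * comm z x"
    unfolding comm_def right_diff_distrib mult.assoc c by simp_all
  show "comm c z = 0" "comm z c = 0" using assms unfolding central_def comm_def by simp_all
qed
lemma c_left: "central c \<Longrightarrow> z * (c * x) = c * (z * x)" unfolding central_def by (metis mult.assoc)
lemma comm_lin: "comm (x + y) z = comm x z + comm y z" "comm (x - y) z = comm x z - comm y z" "comm (- x) z = - comm x z" "comm 0 z = 0"
  "comm z (x + y) = comm z x + comm z y" "comm z (x - y) = comm z x - comm z y" "comm z (- x) = - comm z x" "comm z 0 = 0"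
  "comm (sum f A) z = (\<Sum>a\<in>A. comm (f a) z)" "comm z (sum f A) = (\<Sum>a\<in>A. comm z (f a))" for x y z :: 'b
  by (simp_all add: comm_def algebra_simps sum_distrib_left sum_distrib_right sum_subtractf)
lemma comm_mult: "comm z (x * y) = comm z x * y + x * comm z y" "comm (x * y) z = comm x z * y + x * comm y z" for x y z :: 'b
  by (simp_all add: comm_def algebra_simps)
lemma jac: "comm (comm x y) z = comm x (comm y z) - comm y (comm x z)" for x y z :: 'b
  by (simp add: comm_def algebra_simps)
lemma jac2: "comm z (comm x y) = comm (comm z x) y + comm x (comm z y)" for x y z :: 'b
  by (simp add: comm_def algebra_simps)
lemma nat_cancel: assumes "0 < n" "of_nat n * x = of_nat n * z" shows "x = (z::'b)"
  using char0b[of n "x - z"] assms by (simp add: right_diff_distrib)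

definition "e2i = \<iota> (lfrac 1 (1, 0))"
definition "e3i = \<iota> (lfrac 1 (0, 1))"
lemma e2i: "e2i * e2 = 1" and e3i: "e3i * e3 = 1"
proof -
  have "lfrac 1 (1, 0) * of_base eps2 = (1 :: 'k laurent)" "lfrac 1 (0, 1) * of_base (eps3 TYPE('k)) = (1 :: 'k laurent)"
    unfolding of_base_def lfrac_arith(2,3)[symmetric] unfolding lfrac_arith(2) lfrac_arith(3)[symmetric] lfrac_eq_iff
    by (simp_all add: den_def)
  then show "e2i * e2 = 1" "e3i * e3 = 1"
    unfolding e2i_def e3i_def e2_def e3_def i_mult[symmetric] by simp_all
qed
lemma central_inv[simp]: "central e2i" "central e3i" by (simp_all add: e2i_def e3i_def)
lemma e2i': "e2i * (e2 * x) = x" "e2 * (e2i * x) = x" and e3i': "e3i * (e3 * x) = x"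
  using e2i e3i c_left[of e2 e2i x] by (simp_all flip: mult.assoc)

definition "tz n = e2i * T0 n (mat 1)"
lemma T0_one: "T0 n (mat 1) = e2 * tz n" by (simp add: tz_def e2i')
lemma T0_one_sum: "T0 n (mat 1) = (\<Sum>a\<in>UNIV. Y n a a)" unfolding mat1_elem T_lin ..

lemma nat_e: "e3 * k (of_nat n / 2) * (x + x) = of_nat n * (e3 * x)"
proof -
  have "k (of_nat n) = k (of_nat n / 2) + k (of_nat n / 2)"
    by (subst k_simps(3)[symmetric]) (rule arg_cong[of _ _ k], simp)
  then have "k (of_nat n / 2) * (x + x) = of_nat n * x" unfolding k_of_nat by (simp only: distrib_left distrib_right)
  then show ?thesis unfolding mult.assoc by (simp only: c_left[OF central_simps(6)])
qed

lemma mcomm_1: "mcomm (mat 1) Z = 0" "mcomm Z (mat 1) = 0" "macomm (mat 1) Z = Z + Z" "macomm Z (mat 1) = Z + (Z :: complex^'k^'k)"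
  by (simp_all add: mcomm_def macomm_def)
lemma kron_0: "kron 0 Z = (0 :: complex^('k \<times> 'k)^('k \<times> 'k))" by (simp add: kron_def vec_eq_iff)
lemma mat_0: "0 ** Z = (0 :: complex^'n::finite^'n)" by (simp add: matrix_matrix_mult_def vec_eq_iff)
lemma tens_0: "tens (\<lambda>c. \<iota> (of_base (cst c))) f g 0 = 0" by (simp add: tens_def)
lemma i_nat: "\<iota> (of_base (of_nat n)) = of_nat n" by (induction n) simp_all

text \<open>For Y = 1 both \<open>Omega\<close> sums of (A3') vanish, since [X, 1] = 0 and X tensor
  1 cancels against itself. The remaining constants combine by - e3 - K e1 = e2.\<close>

lemma X_T0one: "comm (T1 X) (T0 n (mat 1)) = of_nat n * (e2 * T0 (n - 1) X)"
proof -
  have t: "trace (mat 1 :: complex^'k^'k) = of_nat CARD('k)" by (simp add: trace_def mat_def)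
  have k1: "\<iota> (of_base (eps3 TYPE('k) * cst (of_nat n / 2))) = e3 * k (of_nat n / 2)" unfolding e3_def k_def by simp
  have k2: "\<iota> (of_base (of_nat n * eps1 * cst (of_nat CARD('k)))) = of_nat n * e1 * of_nat CARD('k)" unfolding e1_def by (simp add: i_nat)
  have "comm (T1 X) (T0 n (mat 1)) = - (of_nat n * (e3 * T0 (n - 1) X)) - of_nat n * (e1 * (of_nat CARD('k) * T0 (n - 1) X))"
    unfolding S3 mcomm_1 t k1 k2 T_lin kron_0 mat_0 tens_0 nat_e by (simp add: comm_lin mat_0 tens_0 mult.assoc)
  also have "\<dots> = of_nat n * ((- e3 - of_nat CARD('k) * e1) * T0 (n - 1) X)"
    using c_left[of "of_nat CARD('k)" e1 "T0 (n-1) X"] by (simp add: right_diff_distrib left_diff_distrib mult.assoc)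
  also have "- e3 - of_nat CARD('k) * e1 = e2" unfolding e123 by simp
  finally show ?thesis .
qed
lemma X_tz: "comm (T1 X) (tz n) = of_nat n * T0 (n - 1) X"
  unfolding tz_def comm_c(2)[OF central_inv(1)] X_T0one by (simp add: c_left[of "of_nat n"] e2i')

end

section \<open>The remaining hypotheses of the series identity\<close>

context small_alg begin

lemma cur2_ser: "cur2 dV UU EE1 EE3 fy (yb 1) fh (yb 3) fr fG fs fX fF"
  by (intro cur2.intro cur2_axioms.intro cur_ser Xy_ser)

interpretation C: cur2 dV UU EE1 EE3 fy "yb 1" fh "yb 3" fr fG fs fX fF by (rule cur2_ser)

text \<open>The series of the (n + 1) t_0n; e2 times it is the trace of y1
  (\<open>tr_y1\<close>).\<close>

definition "ftau = Abs_fps (\<lambda>n. of_nat (n + 1) * tz n)"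
definition "fQt = fps_const e2 * (ftau * ftau)"

lemma X_tau: "comm (fX a b) ftau = fh a b + fh a b"
proof (rule fps_ext)
  fix n show "fps_nth (comm (fX a b) ftau) n = fps_nth (fh a b + fh a b) n"
  proof (cases n)
    case (Suc m)
    have "fps_nth (comm (fX a b) ftau) n = of_nat (m + 2) * (of_nat ((m + 1) choose 1) * Y m a b)"
      unfolding comm_const_nth ftau_def fps_nth_Abs_fps comm_c(2)[OF central_simps(6)] X_tz Suc by (simp add: eval_nat_numeral)
    also have "\<dots> = of_nat ((m + 2) choose 2) * Y m a b + of_nat ((m + 2) choose 2) * Y m a b"
      by (rule natprod(1)[OF binom_facts(1)])
    also have "\<dots> = fps_nth (fh a b + fh a b) n" unfolding Suc fh_def fps_add_nth UU_nth yb_nth by simp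
    finally show ?thesis .
  qed (simp add: comm_const_nth ftau_def X_tz fh_def UU_nth)
qed
lemma tr_y1: "(\<Sum>a\<in>UNIV. yb 1 a a) = fps_const e2 * ftau"
  by (rule fps_ext)
    (simp only: fps_sum_nth yb_nth fps_mult_left_const_nth ftau_def fps_nth_Abs_fps sum_distrib_left[symmetric] T0_one_sum[symmetric] T0_one c_left[OF central_simps(6), symmetric] choose_one)

lemma fc2: "z * (fps_const e2 * x) = fps_const e2 * (z * x)" for x z :: "'b fps"
proof -
  have "fps_const e2 * z = z * fps_const e2" using central_simps(4) by (simp add: fps_eq_iff central_def)
  then show ?thesis by (metis mult.assoc)
qed
lemma X_Qt: "comm (fX i j) fQt = C.acomm (fh i j) (\<Sum>a\<in>UNIV. yb 1 a a) + C.acomm (fh i j) (\<Sum>a\<in>UNIV. yb 1 a a)"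
proof -
  have "comm (fX i j) fQt = fps_const e2 * (comm (fX i j) ftau * ftau + ftau * comm (fX i j) ftau)"
  proof -
    have "fX i j * (fps_const e2 * z) = fps_const e2 * (fX i j * z)" for z by (rule fc2)
    then show ?thesis unfolding fQt_def comm_def by (simp only: algebra_simps)
  qed
  then show ?thesis unfolding X_tau tr_y1 C.acomm_def fc2 by (simp only: algebra_simps fc2)
qed

context fixes i j :: 'k assumes ij: "i \<noteq> j" begin
definition "ww = Y 1 i i - Y 1 j j"

lemma ww_Y: "comm ww (Y n a b) = (if a = i then Y (n + 1) a b else if a = j then - Y (n + 1) a b else 0) - (if b = i then Y (n + 1) a b else if b = j then - Y (n + 1) a b else 0)"
  using ij unfolding ww_def comm_lin Yc by (auto simp: add.commute)
lemma F_ww: "comm t20 ww = 2 * (XX i i - XX j j)"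
  unfolding ww_def comm_lin S2 by (simp add: right_diff_distrib)
lemma Fw_ser: "comm fF (fps_const ww) = (fX i i - fX j j) + (fX i i - fX j j)"
proof -
  have "comm fF (fps_const ww) = fps_const (comm t20 ww)" by (simp add: comm_def)
  then show ?thesis unfolding F_ww by (simp add: mult_2)
qed
text \<open>w turns Y_n into a multiple of Y_{n+1}, and an index shift makes u^2 times the sum of
  the (n + 1) Y_{n+1} u^n equal to u y1 - y.\<close>

lemma wy1_ser: "UU (UU (comm (fps_const ww) (yb 1 a b))) = (if a = i then UU (yb 1 a b) - fy a b else if a = j then fy a b - UU (yb 1 a b) else 0)
        - (if b = i then UU (yb 1 a b) - fy a b else if b = j then fy a b - UU (yb 1 a b) else 0)"
proof (rule fps_ext)
  fix n
  have 0: "fps_nth (UU (UU (comm (fps_const ww) (yb 1 a b)))) (Suc (Suc m)) = of_nat (Suc m) * comm ww (Y m a b)" for m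
    unfolding UU_nth comm_const_nth yb_nth comm_c(2)[OF central_simps(6)] by simp
  have 1: "fps_nth (UU (yb 1 a b) - fy a b) (Suc (Suc m)) = of_nat (Suc m) * Y (m + 1) a b"
     "fps_nth (fy a b - UU (yb 1 a b)) (Suc (Suc m)) = - (of_nat (Suc m) * Y (m + 1) a b)" for m
    unfolding fps_sub_nth UU_nth y_ser_nth yb_nth by (simp_all add: distrib_right)
  show "fps_nth (UU (UU (comm (fps_const ww) (yb 1 a b)))) n = fps_nth ((if a = i then UU (yb 1 a b) - fy a b else if a = j then fy a b - UU (yb 1 a b) else 0)
        - (if b = i then UU (yb 1 a b) - fy a b else if b = j then fy a b - UU (yb 1 a b) else 0)) n"
  proof (cases "n \<ge> 2")
    case True
    then obtain m where n: "n = Suc (Suc m)" by (metis add_2_eq_Suc le_Suc_ex)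
    show ?thesis unfolding n fps_sub_nth[of "if _ then _ else _"] if_nth 0 1 fps_zero_nth ww_Y right_diff_distrib
      by (simp only: if_distrib[of "\<lambda>x. of_nat (Suc m) * x"] mult_minus_right mult_zero_right cong: if_cong)
  next
    case False
    then consider "n = 0" | "n = 1" by linarith
    then show ?thesis
    proof cases
      case 2
      have "fps_nth (UU (yb 1 a b) - fy a b) 1 = 0" "fps_nth (fy a b - UU (yb 1 a b)) 1 = 0" for a b by (simp_all add: UU_nth y_ser_nth yb_nth)
      note z = this
      show ?thesis unfolding 2 fps_sub_nth[of "if _ then _ else _"] if_nth z by (simp add: UU_nth)
    qed (simp add: UU_nth y_ser_nth)
  qed
qed

lemma s_nth: "2 * fps_nth (fs a b) n = comm t20 (Y (n + 1) a b)"
  using F_T0[of n "elemM a b"] by (simp add: fs_def mult.assoc distrib_left distrib_right mult_2)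
lemma XB_Y0: "comm (XX i i - XX j j) (Y 0 a b) = (if a = i then XX a b else if a = j then - XX a b else 0) - (if b = i then XX a b else if b = j then - XX a b else 0)"
  using ij unfolding comm_lin XY by (auto simp: Tone_0)
text \<open>The Jacobi identity for t_20, w and Y_{m+1}: the last term comes from [t_20, w] = 2
  (X_ii - X_jj). The coefficients at 1 and u lie outside this argument and are checked
  separately.\<close>

lemma ws_ser: "UU (UU (comm (fps_const ww) (fs a b))) = (if a = i then UU (fs a b) else if a = j then - UU (fs a b) else 0)
        - (if b = i then UU (fs a b) else if b = j then - UU (fs a b) else 0) - comm (fX i i - fX j j) (fy a b)"
proof (rule fps_ext)
  fix n
  have c: "fps_nth (comm (fX i i - fX j j) z) n = comm (XX i i - XX j j) (fps_nth z n)" for z n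
    using comm_const_nth[of "XX i i - XX j j" z n] by simp
  show "fps_nth (UU (UU (comm (fps_const ww) (fs a b)))) n = fps_nth ((if a = i then UU (fs a b) else if a = j then - UU (fs a b) else 0)
        - (if b = i then UU (fs a b) else if b = j then - UU (fs a b) else 0) - comm (fX i i - fX j j) (fy a b)) n"
  proof (cases "n \<ge> 2")
    case True
    then obtain m where n: "n = Suc (Suc m)" by (metis add_2_eq_Suc le_Suc_ex)
    have u: "fps_nth (UU (fs a b)) (Suc (Suc m)) = fps_nth (fs a b) (m + 1)" by (simp add: UU_nth)
    have "of_nat 2 * comm ww (fps_nth (fs a b) m) = comm ww (comm t20 (Y (m + 1) a b))"
      unfolding s_nth[symmetric] using comm_c(2)[OF central_simps(7), of ww "num.Bit0 num.One"] by simp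
    also have "\<dots> = comm t20 (comm ww (Y (m + 1) a b)) - comm (comm t20 ww) (Y (m + 1) a b)"
      unfolding jac2[of t20] by simp
    also have "\<dots> = comm t20 (comm ww (Y (m + 1) a b)) - 2 * comm (XX i i - XX j j) (Y (m + 1) a b)"
      unfolding F_ww comm_c(1)[OF central_simps(7)] ..
    also have "comm t20 (comm ww (Y (m + 1) a b)) = 2 * ((if a = i then fps_nth (fs a b) (m + 1) else if a = j then - fps_nth (fs a b) (m + 1) else 0)
        - (if b = i then fps_nth (fs a b) (m + 1) else if b = j then - fps_nth (fs a b) (m + 1) else 0))"
      unfolding ww_Y comm_lin if_distrib[of "comm t20"] s_nth[of a b "m + 1", symmetric] right_diff_distrib if_distrib[of "\<lambda>x. 2 * x"] by simp
    finally have "of_nat 2 * comm ww (fps_nth (fs a b) m) = of_nat 2 * ((if a = i then fps_nth (fs a b) (m + 1) else if a = j then - fps_nth (fs a b) (m + 1) else 0)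
        - (if b = i then fps_nth (fs a b) (m + 1) else if b = j then - fps_nth (fs a b) (m + 1) else 0) - comm (XX i i - XX j j) (Y (m + 1) a b))"
      by (simp add: right_diff_distrib)
    from nat_cancel[OF _ this] have "comm ww (fps_nth (fs a b) m) = (if a = i then fps_nth (fs a b) (m + 1) else if a = j then - fps_nth (fs a b) (m + 1) else 0)
        - (if b = i then fps_nth (fs a b) (m + 1) else if b = j then - fps_nth (fs a b) (m + 1) else 0) - comm (XX i i - XX j j) (Y (m + 1) a b)" by simp
    then show ?thesis unfolding n fps_sub_nth if_nth c u fps_neg_nth fps_zero_nth y_ser_nth
      by (simp add: UU_nth comm_const_nth)
  next
    case False
    then consider "n = 0" | "n = 1" by linarith
    then show ?thesis
    proof cases
      case 2
      have z: "fps_nth (UU (fs a b)) 1 = XX a b" for a b by (simp add: UU_nth fs_def Tone_0)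
      have "fps_nth (comm (fX i i - fX j j) (fy a b)) 1 = comm (XX i i - XX j j) (Y 0 a b)" unfolding c y_ser_nth by simp
      then show ?thesis unfolding 2 fps_sub_nth if_nth fps_neg_nth fps_zero_nth z unfolding XB_Y0
        by (simp add: UU_nth)
    next
      case 1
      have z: "fps_nth (comm (fX i i - fX j j) (fy a b)) 0 = 0" unfolding c y_ser_nth by (simp add: comm_lin)
      show ?thesis unfolding 1 fps_sub_nth if_nth fps_neg_nth fps_zero_nth z by (simp add: UU_nth)
    qed
  qed
qed

lemmas main_ser = C.main[OF ij fps_deriv_const Fw_ser wy1_ser ws_ser X_Qt]
end

end

section \<open>Weights\<close>

context small_alg begin

abbreviation "FF \<equiv> comm t20"
definition nil :: "'b \<Rightarrow> bool" where "nil x \<longleftrightarrow> (\<exists>n. (FF ^^ n) x = 0)"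

lemma FF_pow: "(FF ^^ n) (x + y) = (FF ^^ n) x + (FF ^^ n) y" "(FF ^^ n) 0 = 0" "central c \<Longrightarrow> (FF ^^ n) (c * x) = c * (FF ^^ n) x"
  by (induction n) (simp_all add: comm_lin comm_c)

lemma FF_pow_mono: "(FF ^^ n) x = 0 \<Longrightarrow> (FF ^^ (n + m)) x = 0"
  by (induction m) (simp_all add: comm_lin)

text \<open>By the Leibniz rule each term applies ad t_20 at least a times to x or at least b times
  to y.\<close>

lemma FF_pow_mult: "(FF ^^ a) x = 0 \<Longrightarrow> (FF ^^ b) y = 0 \<Longrightarrow> (FF ^^ (a + b)) (x * y) = 0"
proof (induction "a + b" arbitrary: a b x y)
  case 0
  then show ?case by simp
next
  case step: (Suc n)
  show ?case
  proof (cases "a = 0 \<or> b = 0")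
    case True
    then have "x * y = 0" using step.prems by auto
    then show ?thesis by (simp add: FF_pow)
  next
    case False
    then obtain a' b' where ab: "a = Suc a'" "b = Suc b'" using not0_implies_Suc by metis
    have "(FF ^^ a') (FF x) = 0" "(FF ^^ b') (FF y) = 0"
      using step.prems unfolding ab funpow_Suc_right by simp_all
    then have "(FF ^^ (a' + b)) (FF x * y) = 0" "(FF ^^ (a + b')) (x * FF y) = 0"
      using step.hyps(1)[of a' b "FF x" y] step.hyps(1)[of a b' x "FF y"] step.hyps(2) step.prems ab by simp_all
    moreover have "a + b = Suc (a' + b)" "a + b' = a' + b" using ab by simp_all
    ultimately show ?thesis by (simp only: funpow_Suc_right o_apply comm_mult FF_pow add_0_left)
  qed
qed

text \<open>Weight vectors of ad t_11 on which ad t_20 is nilpotent. Both conditions pass to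
  products, with weights adding, and hence to commutators; nilpotence is what later makes the
  sl_2-strings finite.\<close>

definition good :: "int \<Rightarrow> 'b \<Rightarrow> bool" where "good w x \<longleftrightarrow> comm t11 x = of_int w * x \<and> nil x"

lemma central_int[simp]: "central (of_int z)" unfolding central_def by (rule allI) (rule mult_of_int_commute)
lemma good_0: "good w 0" unfolding good_def nil_def by (auto simp: comm_lin intro: exI[of _ 0])
lemma good_add: "good w x \<Longrightarrow> good w y \<Longrightarrow> good w (x + y)"
  unfolding good_def nil_def comm_lin distrib_left FF_pow using FF_pow_mono by (metis add.commute add_0_left)
lemma good_c: "central c \<Longrightarrow> good w x \<Longrightarrow> good w (c * x)"
proof -
  assume c: "central c" and g: "good w x"
  then obtain n where "(FF ^^ n) x = 0" unfolding good_def nil_def by blast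
  then have "(FF ^^ n) (c * x) = 0" by (simp add: FF_pow(3)[OF c])
  moreover have "comm t11 (c * x) = of_int w * (c * x)"
    using g unfolding good_def comm_c(2)[OF c] c_left[OF c, of "of_int w"] by simp
  ultimately show "good w (c * x)" unfolding good_def nil_def by blast
qed
lemma good_minus: "good w x \<Longrightarrow> good w (- x)" using good_c[OF central_int[of "- 1"], of w x] by simp
lemma good_diff: "good w x \<Longrightarrow> good w y \<Longrightarrow> good w (x - y)" using good_add[of w x "- y"] good_minus[of w y] by simp
lemma good_sum: "(\<And>a. a \<in> A \<Longrightarrow> good w (f a)) \<Longrightarrow> good w (sum f A)"
  by (induction A rule: infinite_finite_induct) (auto intro: good_0 good_add)
lemma good_mult: assumes "good w x" "good v y" "u = w + v" shows "good u (x * y)"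
proof -
  have "comm t11 (x * y) = of_int u * (x * y)"
    using assms unfolding good_def comm_mult by (simp add: c_left[OF central_int] distrib_right mult.assoc)
  then show ?thesis using assms FF_pow_mult unfolding good_def nil_def by blast
qed
lemma good_comm: "good w x \<Longrightarrow> good v y \<Longrightarrow> u = w + v \<Longrightarrow> good u (comm x y)"
  unfolding comm_def by (intro good_diff good_mult[of w x v y] good_mult[of v y w x]) simp_all

text \<open>(A2') gives no bracket of t_11 with the T_0n; 4 t_11 = [t_20, t_02] supplies it.\<close>

lemma t11_four: "of_nat 4 * comm t11 z = FF (comm t02 z) - comm t02 (FF z)"
proof -
  have "of_nat 4 * comm t11 z = comm (comm t20 t02) z" unfolding S2(2) using comm_c(1)[OF central_simps(7)] by simp
  then show ?thesis unfolding jac .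
qed
lemma t02_eq: "t02 = tz 2" unfolding tz_def unit02 e2_def[symmetric] by (simp add: e2i')
lemma t02_T0: "comm t02 (T0 n X) = 0"
  unfolding t02_eq tz_def comm_c(1)[OF central_inv(1)] S1 mcomm_1 by (simp add: T_lin)

lemma good_T00: "good 0 (T0 0 X)"
proof -
  have "of_nat 4 * comm t11 (T0 0 X) = of_nat 4 * 0" unfolding t11_four t02_T0 S2 comm_lin by simp
  from nat_cancel[OF _ this] have "comm t11 (T0 0 X) = 0" by simp
  then show ?thesis unfolding good_def nil_def using S2(4)[of X] by (auto intro: exI[of _ 1])
qed
lemma good_T01: "good 1 (T0 1 X)"
proof -
  have "of_nat 4 * comm t11 (T0 1 X) = of_nat 4 * T0 1 X" unfolding t11_four t02_T0 S2 comm_lin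
    by (simp add: comm_c S2(7)[unfolded One_nat_def] flip: mult.assoc)
  from nat_cancel[OF _ this] have 1: "comm t11 (T0 1 X) = T0 1 X" by simp
  have "(FF ^^ 2) (T0 1 X) = FF (FF (T0 1 X))" by (simp add: numeral_2_eq_2)
  also have "\<dots> = 0" unfolding S2(5) comm_c(2)[OF central_simps(7)] S2(6) by simp
  finally show ?thesis unfolding good_def nil_def using 1 by auto
qed
lemma good_X: "good (- 1) (T1 X)"
proof -
  have n: "FF (- 2 * x) = - 2 * FF x" for x by (simp add: comm_lin comm_c)
  have "of_nat 4 * comm t11 (T1 X) = of_nat 4 * (- T1 X)" unfolding t11_four S2 comm_lin n
    by (simp flip: mult.assoc)
  from nat_cancel[OF _ this] have 1: "comm t11 (T1 X) = - T1 X" by simp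
  show ?thesis unfolding good_def nil_def using 1 S2(6)[of X] by (auto intro: exI[of _ 1])
qed

lemma Y_off: "a \<noteq> b \<Longrightarrow> Y (Suc n) a b = comm (Y 1 a a) (Y n a b)" unfolding Yc by simp
lemma Y_diff: "a \<noteq> b \<Longrightarrow> Y (Suc n) a a - Y (Suc n) b b = comm (Y 1 a b) (Y n b a)" unfolding Yc by simp

lemma good_off: "a \<noteq> b \<Longrightarrow> good (int n) (Y n a b)"
proof (induction n)
  case (Suc n)
  show ?case unfolding Y_off[OF Suc.prems] by (rule good_comm[OF good_T01 Suc.IH[OF Suc.prems]]) simp
qed (use good_T00 in simp)

lemma good_dif: assumes "a \<noteq> b" shows "good (int n) (Y n a a - Y n b b)"
proof (cases n)
  case (Suc m)
  show ?thesis unfolding Suc Y_diff[OF assms] by (rule good_comm[OF good_T01 good_off]) (use assms in simp_all)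
qed (use good_T00 good_diff in simp)

text \<open>(A3') expanded in the bracket of X_ii - X_jj with Y_ii - Y_jj. The trace terms with e1
  cancel between equal and mixed indices and the products Y_ii Y_ii drop out, so the right-hand side
  involves traceless matrices only.\<close>

lemma HR: assumes ij: "i \<noteq> j"
  shows "of_nat n * (e3 * (Y (n - 1) i i + Y (n - 1) j j)) = - comm (XX i i - XX j j) (Y n i i - Y n j j)
    - e1 * (\<Sum>m<n. (\<Sum>x\<in>UNIV-{i}. Y m i x * Y (n - 1 - m) x i) + (\<Sum>x\<in>UNIV-{j}. Y m j x * Y (n - 1 - m) x j)
       + Y m i j * Y (n - 1 - m) j i + Y m j i * Y (n - 1 - m) i j)"
proof -
  have r: "Y m i i * Y q i i - (\<Sum>x\<in>UNIV. Y m i x * Y q x i) = - (\<Sum>x\<in>UNIV-{i}. Y m i x * Y q x i)" for m q i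
    by (subst sum.remove[of UNIV i]) simp_all
  have a: "comm (XX i i) (Y n i i) = - (of_nat n * (e3 * Y (n - 1) i i)) - of_nat n * e1 * Y (n - 1) i i
     + e1 * (\<Sum>m<n. - (\<Sum>x\<in>UNIV-{i}. Y m i x * Y (n - 1 - m) x i))" for i
    using XY[of i i n i i] by (simp only: simp_thms if_True diff_self mult_zero_right sum.neutral_const add_0_right nat_e r diff_0)
  have b: "comm (XX i i) (Y n j j) = - (of_nat n * e1 * Y (n - 1) i i) + e1 * (\<Sum>m<n. Y m i j * Y (n - 1 - m) j i)" if "i \<noteq> j" for i j
    using XY[of i i n j j] that that[symmetric]
    by (simp only: simp_thms if_True if_False diff_self mult_zero_right sum.neutral_const add_0_right diff_0_right diff_0)
  show ?thesis unfolding comm_lin a b[OF ij] b[OF ij[symmetric]]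
    by (simp add: sum.distrib sum_negf distrib_left right_diff_distrib)
qed

lemma nat_k: "0 < n \<Longrightarrow> k (1 / of_nat n) * (of_nat n * x) = x"
  using k_inv[of n x] c_left[of "of_nat n" "k (1 / of_nat n)" x] by simp
lemma good_cancel: "0 < n \<Longrightarrow> good w (of_nat n * x) \<Longrightarrow> good w x"
  using good_c[of "k (1 / of_nat n)" w "of_nat n * x"] by (simp only: nat_k central_simps)

lemma good_Y: "good (int n) (Y n a b)"
proof (cases "a = b")
  case True
  \<comment> \<open>K > 1 provides the second index needed for a nonzero traceless diagonal
    matrix.\<close>
  obtain j where ij: "a \<noteq> j"
    using card by (metis (full_types) UNIV_eq_I card_1_singleton_iff less_irrefl singletonI One_nat_def)
  \<comment> \<open>\<open>HR\<close> is used at n + 1, where the trace part on its left has index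
    n.\<close>
  have "good (int n) (of_nat (n + 1) * (e3 * (Y n a a + Y n j j)))"
  proof -
    have p: "good (int n) (Y m b c * Y (n - m) c b)" if "m \<in> {..<n + 1}" "b \<noteq> c" for m b c
      by (rule good_mult[OF good_off good_off]) (use that in auto)
    have q: "good (int n) (comm (XX a a - XX j j) (Y (n + 1) a a - Y (n + 1) j j))"
      by (rule good_comm[OF good_diff[OF good_X good_X] good_dif[OF ij]]) simp
    show ?thesis unfolding HR[OF ij, of "n + 1", unfolded add_diff_cancel_right']
      by (intro good_diff good_minus good_c[OF central_simps(3)] good_sum good_add p q) (use ij in auto)
  qed
  from good_cancel[OF _ this] have "good (int n) (e3 * (Y n a a + Y n j j))" by simp
  then have "good (int n) (e3i * (e3 * (Y n a a + Y n j j)))" by (rule good_c[OF central_inv(2)])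
  then have "good (int n) (Y n a a + Y n j j)" unfolding e3i' .
  from good_add[OF this good_dif[OF ij]] have "good (int n) ((Y n a a + Y n j j) + (Y n a a - Y n j j))" .
  also have "(Y n a a + Y n j j) + (Y n a a - Y n j j) = of_nat 2 * Y n a a" by (simp add: mult_2)
  finally show ?thesis using True good_cancel[of 2] by simp
qed (rule good_off)

lemma good_T0: "good (int n) (T0 n X)"
  by (subst mat_decomp) (simp only: T_lin, intro good_sum good_c central_simps good_Y)

lemma int_cancel: assumes "c \<noteq> 0" "of_int c * x = (0::'b)" shows "x = 0"
proof -
  have "of_nat (nat \<bar>c\<bar>) * x = 0"
    using assms(2) by (cases "c \<ge> 0") (simp_all add: of_nat_nat)
  then show ?thesis using assms(1) char0b[of "nat \<bar>c\<bar>" x] by simp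
qed

section \<open>Strings for sl_2 and the construction of T_nm\<close>

context fixes N :: nat and x :: 'b assumes gx: "good (int N) x" and Ex: "comm t02 x = 0" begin
lemma sl2_H: "comm t11 ((FF ^^ j) x) = of_int (int N - 2 * int j) * (FF ^^ j) x"
proof (induction j)
  case (Suc j)
  have h: "comm t11 t20 = - (2 * t20)" using S2(1) by (simp add: comm_def algebra_simps)
  have "comm t11 ((FF ^^ Suc j) x) = FF (comm t11 ((FF ^^ j) x)) - 2 * FF ((FF ^^ j) x)"
    using jac2[of t11 t20 "(FF ^^ j) x"] by (simp add: h comm_lin comm_c)
  then show ?case unfolding Suc.IH comm_c(2)[OF central_int] by (simp add: algebra_simps)
qed (use gx in \<open>simp add: good_def\<close>)
text \<open>The coefficients c_j satisfy c_0 = -4 N and c_j = c_{j-1} - 4 (N - 2 j), because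
  [t_20, t_02] = 4 t_11 acts by the weight N - 2 j.\<close>

lemma sl2_E: "comm t02 ((FF ^^ Suc j) x) = of_int (- 4 * (int j + 1) * (int N - int j)) * (FF ^^ j) x"
proof (induction j)
  case 0
  have "comm t02 (FF x) = - (of_nat 4 * comm t11 x)" unfolding t11_four Ex comm_lin by simp
  then show ?case using gx by (simp add: good_def mult.assoc)
next
  case (Suc j)
  have "comm t02 ((FF ^^ Suc (Suc j)) x) = FF (comm t02 ((FF ^^ Suc j) x)) - of_nat 4 * comm t11 ((FF ^^ Suc j) x)"
    using t11_four[of "(FF ^^ Suc j) x"] by simp
  also have "\<dots> = of_int (- 4 * (int j + 1) * (int N - int j)) * (FF ^^ Suc j) x - of_int (4 * (int N - 2 * int (Suc j))) * (FF ^^ Suc j) x"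
    unfolding Suc.IH comm_c(2)[OF central_int] sl2_H by (simp only: of_int_mult of_int_numeral of_nat_numeral mult.assoc funpow.simps o_apply)
  also have "\<dots> = of_int (- 4 * (int j + 1) * (int N - int j) - 4 * (int N - 2 * int (Suc j))) * (FF ^^ Suc j) x"
    unfolding left_diff_distrib[symmetric] of_int_diff[symmetric] ..
  also have "- 4 * (int j + 1) * (int N - int j) - 4 * (int N - 2 * int (Suc j)) = - 4 * (int (Suc j) + 1) * (int N - int (Suc j))"
    by (simp add: algebra_simps)
  finally show ?case .
qed
text \<open>Nilpotence makes the string end. t_02 maps the zero vector after the end to a multiple
  of the last nonzero one, and by \<open>sl2_E\<close> that multiple can vanish only at j =
  N.\<close>

lemma sl2_0: "(FF ^^ Suc N) x = 0"
proof (rule ccontr)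
  assume nz: "(FF ^^ Suc N) x \<noteq> 0"
  define m where "m = (LEAST m. (FF ^^ m) x = 0)"
  obtain m0 where "(FF ^^ m0) x = 0" using gx unfolding good_def nil_def by blast
  then have m: "(FF ^^ m) x = 0" unfolding m_def by (rule LeastI)
  have "m > Suc N" using nz FF_pow_mono[OF m, of "Suc N - m"] by (cases "m \<le> Suc N") auto
  then obtain m' where m': "m = Suc m'" "m' > N" by (cases m) auto
  have "of_int (- 4 * (int m' + 1) * (int N - int m')) * (FF ^^ m') x = 0"
    using sl2_E[of m'] m unfolding m' by (simp add: comm_lin)
  then have "(FF ^^ m') x = 0" by (rule int_cancel[rotated]) (use m' in simp)
  then have "m \<le> m'" unfolding m_def by (rule Least_le)
  then show False using m' by simp
qed
end

text \<open>The constant is forced by [t_20, T_{n,m+1}] = 2 (m + 1) T_{n+1,m}, starting from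
  T_{0,n+m}.\<close>

definition "TT n m X = k (fact m / (fact (n + m) * 2 ^ n)) * (FF ^^ n) (T0 (n + m) X)"
definition "tt n m = e2i * TT n m (mat 1)"

lemma nk: "of_nat n * (k c * x) = k (of_nat n * c) * x"
  unfolding k_simps k_of_nat by (simp add: mult.assoc)
lemma TT_0: "TT 0 m X = T0 m X" by (simp add: TT_def)
lemma TT_1: "TT 1 m X = Tone m X"
proof -
  have "of_nat (2 * m + 2) = (2 * of_nat (Suc m) :: complex)" by simp
  then have "fact m / (fact (1 + m) * 2 ^ 1) = (1 / of_nat (2 * m + 2) :: complex)" by (simp add: field_simps del: of_nat_Suc mult_Suc mult_Suc_right)
  moreover have "(FF ^^ 1) (T0 (1 + m) X) = FF (T0 (m + 1) X)" by simp
  ultimately show ?thesis unfolding TT_def Tone_def by (simp only:)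
qed
lemma F_TT: "FF (TT n (Suc m) X) = of_nat (2 * Suc m) * TT (Suc n) m X"
proof -
  have "of_nat (2 * Suc m) * (fact m / (fact (Suc n + m) * 2 ^ Suc n)) = (fact (Suc m) / (fact (n + Suc m) * 2 ^ n) :: complex)"
    by (simp add: field_simps del: of_nat_Suc mult_Suc mult_Suc_right)
  then show ?thesis unfolding TT_def nk comm_c(2)[OF central_simps(2)] by simp
qed
lemma F_TT0: "FF (TT n 0 X) = 0"
  using sl2_0[OF good_T0 t02_T0, of n X] unfolding TT_def comm_c(2)[OF central_simps(2)] by simp
lemma E_TT0: "comm t02 (TT 0 m X) = 0" unfolding TT_0 t02_T0 ..
lemma E_TT: "comm t02 (TT (Suc n) m X) = - (of_nat (2 * Suc n) * TT n (Suc m) X)"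
proof -
  have z: "of_int (- 4 * (int n + 1) * (int (Suc n + m) - int n)) = - (of_nat (4 * Suc n * Suc m) :: 'b)"
  proof -
    have "- 4 * (int n + 1) * (int (Suc n + m) - int n) = - int (4 * Suc n * Suc m)" by (simp add: algebra_simps)
    then show ?thesis by (simp only: of_int_minus of_int_of_nat_eq)
  qed
  have "of_nat (4 * Suc n * Suc m) * (fact m / (fact (Suc n + m) * 2 ^ Suc n)) = (of_nat (2 * Suc n) * (fact (Suc m) / (fact (n + Suc m) * 2 ^ n)) :: complex)"
    by (simp add: field_simps del: of_nat_Suc mult_Suc mult_Suc_right)
  then have "k (fact m / (fact (Suc n + m) * 2 ^ Suc n)) * (of_nat (4 * Suc n * Suc m) * z) = k (of_nat (2 * Suc n) * (fact (Suc m) / (fact (n + Suc m) * 2 ^ n))) * z" for z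
    unfolding c_left[OF central_simps(6)] nk by simp
  from this[of "(FF ^^ n) (T0 (Suc n + m) X)"] show ?thesis
    unfolding TT_def nk comm_c(2)[OF central_simps(2)] sl2_E[OF good_T0 t02_T0] z
    unfolding mult_minus_left mult_minus_right by (simp only: add_Suc add_Suc_right)
qed
lemma H_TT: "comm t11 (TT n m X) = of_int (int m - int n) * TT n m X"
  unfolding TT_def comm_c(2)[OF central_simps(2)] sl2_H[OF good_T0 t02_T0] c_left[OF central_int] by simp

lemma tt_02: "tt 0 2 = t02" unfolding tt_def TT_0 t02_eq tz_def ..
text \<open>A consistency check: t_11 and t_20 are generators, whereas \<open>tt\<close> is built
  from T_0n(1). The homomorphism out of the localisation has to match them.\<close>

lemma TT_11: "TT 1 1 (mat 1) = e2 * t11" and TT_20: "TT 2 0 (mat 1) = e2 * t20"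
proof -
  have "of_nat 4 * TT 1 1 (mat 1) = FF (TT 0 2 (mat 1))" using F_TT[of 0 1 "mat 1"] by (simp add: numeral_2_eq_2)
  also have "\<dots> = of_nat 4 * (e2 * t11)" unfolding TT_0 T0_one t02_eq[symmetric] comm_c(2)[OF central_simps(4)] S2 by (simp add: c_left)
  finally show 1: "TT 1 1 (mat 1) = e2 * t11" by (rule nat_cancel[rotated]) simp
  have "of_nat 2 * TT 2 0 (mat 1) = FF (TT 1 1 (mat 1))" using F_TT[of 1 0 "mat 1"] by (simp add: numeral_2_eq_2)
  also have "\<dots> = of_nat 2 * (e2 * t20)" unfolding 1 comm_c(2)[OF central_simps(4)] S2 by (simp add: c_left)
  finally show "TT 2 0 (mat 1) = e2 * t20" by (rule nat_cancel[rotated]) simp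
qed
lemma tt_11: "tt 1 1 = t11" and tt_20: "tt 2 0 = t20" unfolding tt_def TT_11 TT_20 e2i' by simp_all

text \<open>An element z that commutes with t_20 passes through the powers of ad t_20, so its action
  on the T_0N determines that on all T_nm. It will be T_10(X) with A = 1, or T_10(1) with A = B, or
  T_00(X) with c = 0.\<close>

context fixes z z' :: 'b and c :: 'b and A B :: "complex^'k^'k"
  assumes c: "central c" and zF: "FF z = 0" and zT: "\<And>N. comm z (T0 N A) = of_nat N * (c * T0 (N - 1) B)"
begin
lemma op_F: "comm z ((FF ^^ n) y) = (FF ^^ n) (comm z y)"
proof (induction n)
  case (Suc n)
  have "comm z t20 = 0" using zF by (simp add: comm_def)
  then show ?case using jac2[of z t20 "(FF ^^ n) y"] by (simp add: comm_lin Suc.IH)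
qed simp
lemma op_TT: "comm z (TT n m A) = of_nat m * (c * TT n (m - 1) B)"
proof -
  have 1: "comm z (TT n m A) = k (fact m / (fact (n + m) * 2 ^ n)) * (of_nat (n + m) * (c * (FF ^^ n) (T0 (n + m - 1) B)))"
    unfolding TT_def comm_c(2)[OF central_simps(2)] op_F zT FF_pow(3)[OF central_simps(6)] FF_pow(3)[OF c] ..
  show ?thesis
  proof (cases m)
    case 0
    show ?thesis
    proof (cases n)
      case (Suc n')
      \<comment> \<open>For m = 0 the factor on the right vanishes; on the left it is the end of the
        string, (ad t_20)^n T_{0,n-1} = 0.\<close>
      then show ?thesis using 1 sl2_0[OF good_T0 t02_T0, of n' B] 0 by simp
    qed (use 1 0 in simp)
  next
    case (Suc m')
    have "of_nat (n + Suc m') * (fact (Suc m') / (fact (n + Suc m') * 2 ^ n)) = (of_nat (Suc m') * (fact m' / (fact (n + m') * 2 ^ n)) :: complex)"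
      by (simp add: field_simps del: of_nat_Suc mult_Suc mult_Suc_right)
    then have "k (fact (Suc m') / (fact (n + Suc m') * 2 ^ n)) * (of_nat (n + Suc m') * y) = of_nat (Suc m') * (k (fact m' / (fact (n + m') * 2 ^ n)) * y)" for y
      unfolding c_left[OF central_simps(6)] nk by simp
    moreover have "n + Suc m' - 1 = n + m'" by simp
    ultimately show ?thesis unfolding 1 unfolding Suc diff_Suc_1 TT_def by (simp only: c_left[OF c])
  qed
qed
text \<open>The companion for z', obtained by bracketing \<open>op_TT\<close> with t_02; for z =
  T_10(X) it concerns z' = T_01(X).\<close>

lemma op_TT': assumes z': "comm t02 z = - (2 * z')" shows "comm z' (TT n m A) = - (of_nat n * (c * TT (n - 1) m B))"
proof -
  have e: "- (of_nat 2 * comm z' u) = comm t02 (comm z u) - comm z (comm t02 u)" for u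
    using jac2[of t02 z u] z' by (simp add: comm_lin comm_c)
  have "of_nat 2 * comm z' (TT n m A) = of_nat 2 * (- (of_nat n * (c * TT (n - 1) m B)))"
  proof (cases n)
    case 0
    show ?thesis using e[of "TT 0 m A"] unfolding 0 op_TT E_TT0 comm_lin comm_c(2)[OF central_simps(6)] comm_c(2)[OF c] by simp
  next
    case (Suc n')
    have "comm t02 (comm z (TT n m A)) = - (of_nat m * (of_nat (2 * n) * (c * TT n' m B)))"
      unfolding op_TT Suc comm_c(2)[OF central_simps(6)] comm_c(2)[OF c] E_TT by (cases m) (simp_all add: c_left[OF c] c_left[OF central_simps(6), of c])
    moreover have "comm z (comm t02 (TT n m A)) = - (of_nat (2 * n) * (of_nat (Suc m) * (c * TT n' m B)))"
      unfolding Suc E_TT comm_lin comm_c(2)[OF central_simps(6)] op_TT by simp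
    ultimately have h: "- (of_nat 2 * comm z' (TT n m A)) = of_nat (2 * n) * (c * TT n' m B)"
      unfolding e c_left[OF central_simps(6)[of m], of "of_nat (2 * n)", symmetric] by (simp add: distrib_right distrib_left del: of_nat_mult)
    have "of_nat 2 * comm z' (TT n m A) = - (of_nat (2 * n) * (c * TT n' m B))" unfolding h[symmetric] by simp
    then show ?thesis by (simp add: Suc mult.assoc del: of_nat_Suc mult_Suc mult_Suc_right)
  qed
  then show ?thesis by (rule nat_cancel[rotated]) simp
qed
end

text \<open>For X = 1 and a matrix unit, reversing m turns the last sum of (A3') into commutators.
  By (A1') they give a multiple of T_{0,n-1}(1), which cancels the trace term, and K copies of the
  unit; then - e3 - K e1 = e2.\<close>

lemma one_T0: "comm (T1 (mat 1)) (T0 n Z) = of_nat n * (e2 * T0 (n - 1) Z)"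
proof -
  have el: "comm (T1 (mat 1)) (Y n c d) = of_nat n * (e2 * Y (n - 1) c d)" for c d
  proof -
    have O1: "tn m m' (kron (elemM a b) (mat 1) ** Omega) = (\<Sum>x\<in>UNIV. Y m a x * Y m' x b)" for m m' a b
      unfolding tn_Omega by (simp add: elemM_mult if_distrib[of "T0 _"] if_distrib[of "\<lambda>x. x * _"] T_lin sum.swap[of _ UNIV UNIV] cong: if_cong)
    have O2: "tn m m' (kron (mat 1) (elemM a b) ** Omega) = (\<Sum>x\<in>UNIV. Y m x b * Y m' a x)" for m m' a b
      unfolding tn_Omega by (simp add: elemM_mult if_distrib[of "T0 _"] if_distrib[of "\<lambda>x. _ * x"] T_lin cong: if_cong)
    have O4: "(P - P') ** W = P ** W - P' ** W" for P P' W :: "complex^('k\<times>'k)^('k\<times>'k)"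
      by (simp add: matrix_matrix_mult_def vec_eq_iff algebra_simps sum_subtractf)
    have k1: "\<iota> (of_base (eps3 TYPE('k) * cst (of_nat n / 2))) = e3 * k (of_nat n / 2)" unfolding e3_def k_def by simp
    have k2: "\<iota> (of_base (of_nat n * eps1 * cst (if c = d then 1 else 0))) * z = (if c = d then of_nat n * (e1 * z) else 0)" for z unfolding e1_def by (simp add: i_nat mult.assoc)
    have sw: "(\<Sum>m<n. \<Sum>b\<in>UNIV. Y m c b * Y (n - 1 - m) b d) = (\<Sum>m<n. \<Sum>b\<in>UNIV. Y (n - 1 - m) c b * Y m b d)"
      by (rule sum.reindex_bij_witness[of _ "\<lambda>m. n - 1 - m" "\<lambda>m. n - 1 - m"]) auto
    have "(\<Sum>m<n. (\<Sum>b\<in>UNIV. Y m b d * Y (n - 1 - m) c b) - (\<Sum>b\<in>UNIV. Y m c b * Y (n - 1 - m) b d))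
       = (\<Sum>m<n. \<Sum>b\<in>UNIV. comm (Y m b d) (Y (n - 1 - m) c b))"
      unfolding sum_subtractf sw comm_def by simp
    also have "\<dots> = (\<Sum>m<n. (if c = d then T0 (n - 1) (mat 1) else 0) - of_nat CARD('k) * Y (n - 1) c d)"
      unfolding Yc by (intro sum.cong refl) (auto simp: sum_subtractf T0_one_sum)
    also have "\<dots> = of_nat n * ((if c = d then T0 (n - 1) (mat 1) else 0) - of_nat CARD('k) * Y (n - 1) c d)" by simp
    finally have 5: "(\<Sum>m<n. (\<Sum>b\<in>UNIV. Y m b d * Y (n - 1 - m) c b) - (\<Sum>b\<in>UNIV. Y m c b * Y (n - 1 - m) b d)) = \<dots>" .
    have "comm (T1 (mat 1)) (Y n c d) = - (of_nat n * (e3 * Y (n - 1) c d)) - (if c = d then of_nat n * (e1 * T0 (n - 1) (mat 1)) else 0)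
        + e1 * (of_nat n * ((if c = d then T0 (n - 1) (mat 1) else 0) - of_nat CARD('k) * Y (n - 1) c d))"
      unfolding S3 mcomm_1 k1 trace_elemM k2 T_lin kron_0 mat_0 tens_0 nat_e 5[symmetric] tn e1_def[symmetric]
        O4 tn_add O2 matrix_mul_lid O1 by (simp add: comm_lin)
    also have "\<dots> = of_nat n * ((- e3 - of_nat CARD('k) * e1) * Y (n - 1) c d)"
      using c_left[of "of_nat CARD('k)" e1 "Y (n-1) c d"] c_left[of "of_nat n" e1]
      by (simp add: right_diff_distrib left_diff_distrib mult.assoc)
    also have "- e3 - of_nat CARD('k) * e1 = e2" unfolding e123 by simp
    finally show ?thesis .
  qed
  show ?thesis
    by (subst (1 2) mat_decomp[of Z]) (simp only: T_lin comm_lin comm_c[OF central_simps(2)] el sum_distrib_left c_left[OF central_simps(2), of e2] c_left[OF central_simps(2), of "of_nat n"])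
qed

end

section \<open>The relation (A4)\<close>

context small_alg begin

lemma tt_0: "tt 0 n = tz n" unfolding tt_def TT_0 tz_def ..
lemma TT_one: "TT n m (mat 1) = e2 * tt n m" unfolding tt_def e2i' ..
lemma nm: "of_nat a * (of_nat b * x) = of_nat (a * b) * (x::'b)" by (simp add: mult.assoc)

lemma X_tt: "comm (T1 X) (tt n m) = of_nat m * TT n (m - 1) X"
  unfolding tt_def comm_c(2)[OF central_inv(1)]
  by (subst op_TT[of e2 "T1 X" "mat 1" X]) (simp_all only: central_simps S2 X_T0one c_left[OF central_inv(1), of "of_nat m", symmetric] c_left[OF central_simps(6), of e2i] e2i')
lemma T01_tt: "comm (T0 1 X) (tt n m) = - (of_nat n * TT (n - 1) m X)"
  unfolding tt_def comm_c(2)[OF central_inv(1)]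
  by (subst op_TT'[of e2 "T1 X" "mat 1" X]) (simp_all only: central_simps S2 X_T0one mult_minus_left mult_minus_right c_left[OF central_simps(6), of e2i] e2i')
lemma T00_tt: "comm (T0 0 X) (tt n m) = 0"
  unfolding tt_def comm_c(2)[OF central_inv(1)]
  by (subst op_TT[of 0 "T0 0 X" "mat 1" X]) (simp_all add: central_def S2 S1 mcomm_1 T_lin)
lemma one_TT: "comm (T1 (mat 1)) (TT n m X) = of_nat m * (e2 * TT n (m - 1) X)"
  by (rule op_TT) (simp_all add: S2 one_T0)

text \<open>(ad t_20)^2 applied to [T_01(X), T_01(Z)] = T_02([X, Z]). ad t_20 sends T_01 to 2 T_10
  and kills T_10, so the Leibniz rule gives 2 * 2 * 2 = 8 on the left; on the right T_02 becomes 8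
  T_20.\<close>

lemma X_X: "comm (T1 X) (T1 Z) = TT 2 0 (mcomm X Z)"
proof -
  have "(8 :: 'b) = 1 + 1 + (1 + 1) + (1 + 1 + (1 + 1))" by simp
  then have "x + x + (x + x) + (x + x + (x + x)) = 8 * x" for x :: 'b by (simp only: distrib_right mult_1)
  then have "FF (FF (comm (T0 1 X) (T0 1 Z))) = of_nat 8 * comm (T1 X) (T1 Z)"
    unfolding jac2[of t20] S2 comm_lin comm_c[OF central_simps(7)] by (simp add: comm_lin comm_c S2 mult_2 flip: mult.assoc)
  moreover have "FF (FF (T0 2 W)) = of_nat 8 * TT 2 0 W" for W
    using F_TT[of 0 1 W] F_TT[of 1 0 W] by (simp add: TT_0 numeral_2_eq_2 comm_c comm_lin)
  ultimately have "of_nat 8 * comm (T1 X) (T1 Z) = of_nat 8 * TT 2 0 (mcomm X Z)" by (simp only: S1 one_add_one)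
  then show ?thesis by (rule nat_cancel[rotated]) simp
qed

definition "ek x = e1 * (e1 * x) - e2 * (e3 * x)"
lemma ek_alt: "ek x = e1 * (e1 * x) + of_nat CARD('k) * (e1 * (e3 * x)) + e3 * (e3 * x)"
proof -
  have "e2 = - (of_nat CARD('k) * e1) - e3" unfolding e123 by simp
  then show ?thesis unfolding ek_def by (simp add: left_diff_distrib mult.assoc)
qed
lemma ek_comm: "comm z (ek x) = ek (comm z x)" unfolding ek_def by (simp add: comm_lin comm_c)
lemma ek_c: "central c \<Longrightarrow> ek (c * x) = c * ek x" unfolding ek_def by (simp add: right_diff_distrib c_left[of c])
lemma ek_0: "ek 0 = 0" unfolding ek_def by simp

definition "YY m q = (\<Sum>a\<in>UNIV. \<Sum>b\<in>UNIV. Y m a b * Y q b a)"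
definition "Qc p = (\<Sum>m\<le>p. of_nat ((m + 1) * (p + 1 - m)) * (YY m (p - m) + e1 * (e2 * (tz m * tz (p - m)))))"
text \<open>The value 0 below 3 extends the right-hand side of (A4) to all N, where N (N-1) (N-2)
  vanishes as well. The induction can then start at N = 1.\<close>

definition "Qt N = (if 3 \<le> N then Qc (N - 3) else 0)"
text \<open>Four times the right-hand side of (A4), to avoid denominators.\<close>

definition "RHS4 N = of_nat (12 * N) * tt 2 (N - 1) + ek (of_nat (N * (N - 1) * (N - 2)) * tz (N - 3)) - of_nat 6 * (e1 * Qt N)"
definition "R4 N = of_nat 4 * comm (tt 3 0) (tz N) - RHS4 N"

definition "fQ = (\<Sum>a\<in>UNIV. \<Sum>b\<in>UNIV. yb 1 a b * yb 1 b a)"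
interpretation C: cur2 dV UU EE1 EE3 fy "yb 1" fh "yb 3" fr fG fs fX fF by (rule cur2_ser)
declare C.E1_mult [simp del] C.E3_mult [simp del] C.UE [simp del] C.d_U [simp del]

lemma nat_mult_nat: "(of_nat a * x) * (of_nat b * y) = of_nat (a * b) * (x * (y::'b))"
  by (simp add: mult.assoc c_left[OF central_simps(6), of x])
lemma Q_nth: "fps_nth (fQ + EE1 fQt) p = Qc p" and fQ_nth: "fps_nth fQ p = (\<Sum>m\<le>p. of_nat ((m + 1) * (p + 1 - m)) * YY m (p - m))"
proof -
  have "fps_nth fQ p = (\<Sum>a\<in>UNIV. \<Sum>b\<in>UNIV. \<Sum>m\<le>p. of_nat ((m + 1) * (p + 1 - m)) * (Y m a b * Y (p - m) b a))"
    unfolding fQ_def fps_sum_nth fps_mult_nth yb_nth atMost_atLeast0 nat_mult_nat by (intro sum.cong refl) (simp add: Suc_diff_le)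
  also have "\<dots> = (\<Sum>m\<le>p. \<Sum>a\<in>UNIV. \<Sum>b\<in>UNIV. of_nat ((m + 1) * (p + 1 - m)) * (Y m a b * Y (p - m) b a))"
    by (rule trans[OF sum.cong[OF refl sum.swap] sum.swap])
  finally show 1: "fps_nth fQ p = (\<Sum>m\<le>p. of_nat ((m + 1) * (p + 1 - m)) * YY m (p - m))"
    unfolding YY_def sum_distrib_left .
  have "fps_nth (ftau * ftau) p = (\<Sum>m\<le>p. of_nat ((m + 1) * (p + 1 - m)) * (tz m * tz (p - m)))"
    unfolding fps_mult_nth ftau_def fps_nth_Abs_fps atMost_atLeast0 nat_mult_nat by (intro sum.cong refl) (simp add: Suc_diff_le)
  then have 2: "fps_nth (EE1 fQt) p = (\<Sum>m\<le>p. of_nat ((m + 1) * (p + 1 - m)) * (e1 * (e2 * (tz m * tz (p - m)))))"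
    unfolding fQt_def fps_mult_left_const_nth by (simp only: sum_distrib_left c_left[OF central_simps(6)])
  show "fps_nth (fQ + EE1 fQt) p = Qc p"
    unfolding fps_add_nth 1 2 Qc_def sum.distrib[symmetric] distrib_left ..
qed

lemma UU4_nth: "fps_nth (UU (UU (UU (UU x)))) n = (if n < 4 then 0 else fps_nth x (n - 4))"
  by (simp add: UU_nth eval_nat_numeral)

context fixes i j :: 'k assumes ij: "i \<noteq> j" begin
lemmas ser_ass = fps_deriv_const Fw_ser[OF ij] wy1_ser[OF ij] ws_ser[OF ij] X_Qt
lemma KC_nth: "fps_nth (C.KC i j) (Suc N) = of_nat (N * (N - 1) * (N - 2) * (N - 3)) * Y (N - 4) i j"
proof (cases "N \<ge> 4")
  case True
  then obtain p where N: "N = p + 4" using le_Suc_ex by (metis add.commute)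
  have "fps_nth (UU (UU (UU (UU (yb 1 i j))))) (p + 4) = of_nat (p + 1) * Y p i j"
    unfolding UU4_nth yb_nth by simp
  moreover have "fps_nth (C.KC i j) (Suc (p + 4)) = of_nat (p + 2) * (of_nat (p + 3) * (of_nat (p + 4) * fps_nth (UU (UU (UU (UU (yb 1 i j))))) (p + 4)))"
    unfolding C.KC_def[OF ij ser_ass] Let_def UU4_nth[of _ "Suc _"] by (simp add: eval_nat_numeral del: of_nat_Suc C.d_U)
  moreover have "(p + 2) * ((p + 3) * ((p + 4) * (p + 1))) = (p + 4) * (p + 4 - 1) * (p + 4 - 2) * (p + 4 - 3)" by (simp add: algebra_simps)
  ultimately show ?thesis unfolding N by (simp only: nm add_diff_cancel_right')
next
  case False
  then have "N * (N - 1) * (N - 2) * (N - 3) = 0" by auto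
  moreover have "fps_nth (C.KC i j) (Suc N) = 0"
  proof (cases "N = 3")
    case True
    then show ?thesis unfolding C.KC_def[OF ij ser_ass] Let_def UU4_nth[of _ "Suc _"] by (simp add: UU4_nth del: C.d_U)
  next
    case False
    then show ?thesis unfolding C.KC_def[OF ij ser_ass] Let_def UU4_nth[of _ "Suc _"] using \<open>\<not> 4 \<le> N\<close> by simp
  qed
  ultimately show ?thesis by (simp only: of_nat_0 mult_zero_left)
qed

lemma Ek_nth: "fps_nth (C.Ek x) n = ek (fps_nth x n)"
  unfolding C.Ek_def[OF ij ser_ass] ek_alt by simp

definition "aa N = comm (XX i j) (RHS4 N)"
lemma FF_Y: "FF (FF (Y N i j)) = of_nat (4 * N * (N - 1)) * TT 2 (N - 2) (elemM i j)"
proof (cases "N \<ge> 2")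
  case True
  then obtain p where N: "N = Suc (Suc p)" by (metis add_2_eq_Suc le_Suc_ex)
  have 1: "FF (Y (Suc (Suc p)) i j) = of_nat (2 * Suc (Suc p)) * TT (Suc 0) (Suc p) (elemM i j)"
    using F_TT[of 0 "Suc p" "elemM i j"] unfolding TT_0 .
  have 2: "2 * Suc (Suc p) * (2 * Suc p) = 4 * Suc (Suc p) * Suc p" "Suc (Suc p) - 2 = p" "Suc (Suc p) - 1 = Suc p" by (simp_all add: algebra_simps)
  show ?thesis unfolding N by (simp only: 1 comm_c(2)[OF central_simps(6)] F_TT nm 2 numeral_2_eq_2[symmetric])
next
  case False
  then consider "N = 0" | "N = 1" by linarith
  then show ?thesis using S2(4) S2(5)[of "elemM i j"] S2(6)[of "elemM i j"] by cases (simp_all add: comm_lin comm_c)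
qed
lemma aa_alt: "aa N = of_nat 3 * FF (FF (Y N i j)) + ek (of_nat (N * (N - 1) * (N - 2) * (N - 3)) * Y (N - 4) i j)
   - of_nat 6 * (e1 * (if 3 \<le> N then comm (XX i j) (Qc (N - 3)) else 0))"
proof -
  have 1: "of_nat (12 * N) * (of_nat (N - 1) * z) = of_nat 3 * (of_nat (4 * N * (N - 1)) * z)" for z :: 'b
    unfolding nm by (rule arg_cong[of _ _ "\<lambda>x. of_nat x * _"]) simp
  show ?thesis unfolding aa_def RHS4_def comm_lin comm_c(2)[OF central_simps(6)] comm_c(2)[OF central_simps(3)] ek_comm X_tt X_tz FF_Y 1 nm Qt_def
    by (simp add: comm_lin numeral_2_eq_2 if_distrib[of "comm _"] mult.assoc del: of_nat_mult cong: if_cong)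
qed

definition "fA = C.Th (comm fF (comm fF (fy i j))) + C.Ek (C.KC i j) - EE1 (C.Th (C.Tw (UU (UU (UU (UU (C.PSI i j fQt)))))))"
lemma three: "x + x + x = of_nat 3 * x" and six: "x + x + (x + x) + (x + x) = of_nat 6 * (x::'b)"
proof -
  have "of_nat 3 = (1 + 1 + 1 :: 'b)" "of_nat 6 = (1 + 1 + (1 + 1) + (1 + 1) :: 'b)" by simp_all
  then show "x + x + x = of_nat 3 * x" "x + x + (x + x) + (x + x) = of_nat 6 * x" by (simp_all only: distrib_right mult_1)
qed
lemma A_nth: "fps_nth fA (Suc N) = aa N"
proof -
  have 1: "fps_nth (UU (UU (UU (UU (C.PSI i j fQt))))) (Suc N) = (if 3 \<le> N then comm (XX i j) (Qc (N - 3)) else 0)"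
    unfolding UU4_nth C.PSI_def[OF ij ser_ass] fQ_def[symmetric] comm_const_nth Q_nth by (auto simp: Suc_diff_le eval_nat_numeral)
  show ?thesis unfolding fA_def fps_add_nth fps_sub_nth fps_mult_left_const_nth comm_const_nth y_ser_nth Ek_nth KC_nth 1 aa_alt six
    unfolding three
    by (simp only: nat.simps if_False diff_Suc_1 c_left[OF central_simps(6), of e1])
qed
definition "DPn M = comm (XX i j) (comm (XX j i) (Y M i j)) - comm (XX j i) (comm (XX i j) (Y M i j))"
lemma DP_nth: "fps_nth (C.DP i j) (Suc M) = DPn M"
  unfolding C.DP_def[OF ij ser_ass] DPn_def fps_sub_nth comm_const_nth y_ser_nth by simp

text \<open>The series identity read off at u^(M+3). The factor 2 (M + 1) is 2 ((M + 3) - 2), from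
  the Euler part of \<open>L\<close>.\<close>

lemma main_coeff: "of_nat (2 * Suc M) * aa (Suc (Suc M)) = of_nat (Suc (Suc M)) * comm (ww i j) (aa (Suc M)) + of_nat (12 * Suc (Suc M) * Suc M) * DPn M"
proof -
  let ?N = "Suc (Suc (Suc M))"
  have 0: "fps_nth (C.L (fps_const (ww i j)) fA + C.Th (C.Tw (C.Tw (UU (UU (dV (UU (UU (dV (C.DP i j)))))))))) ?N = 0"
    using main_ser[OF ij] unfolding fA_def by simp
  have 1: "fps_nth (C.L (fps_const (ww i j)) fA) ?N = - (of_nat (2 * Suc M) * aa (Suc (Suc M))) + of_nat (Suc (Suc M)) * comm (ww i j) (aa (Suc M))"
  proof -
    have "fps_nth (C.L (fps_const (ww i j)) fA) ?N = - ((of_nat ?N * aa (Suc (Suc M)) - (aa (Suc (Suc M)) + aa (Suc (Suc M)))) + (of_nat ?N * aa (Suc (Suc M)) - (aa (Suc (Suc M)) + aa (Suc (Suc M)))))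
       + of_nat (Suc (Suc M)) * comm (ww i j) (aa (Suc M))"
      unfolding C.L_def[OF ij ser_ass] fps_add_nth fps_sub_nth fps_neg_nth UU_nth
      by (simp add: A_nth comm_const_nth del: of_nat_Suc)
    moreover have "of_nat ?N * x - (x + x) = of_nat (Suc M) * x" for x :: 'b by (simp add: algebra_simps)
    moreover have "of_nat (Suc M) * x + of_nat (Suc M) * x = of_nat (2 * Suc M) * x" for x :: 'b
      unfolding distrib_right[symmetric] of_nat_add[symmetric] mult_2 ..
    ultimately show ?thesis by (simp only:)
  qed
  have 2: "fps_nth (UU (UU (dV (UU (UU (dV (C.DP i j))))))) ?N = of_nat (Suc (Suc M) * Suc M) * DPn M"
    unfolding UU_nth by (simp add: UU_nth DP_nth nm mult.commute[where 'a = nat] del: of_nat_Suc of_nat_mult C.d_U mult_Suc mult_Suc_right)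
  have 12: "x + x + (x + x) + (x + x + (x + x)) + (x + x + (x + x)) = of_nat 12 * x" for x :: 'b
  proof -
    have "of_nat 12 = (1 + 1 + (1 + 1) + (1 + 1 + (1 + 1)) + (1 + 1 + (1 + 1)) :: 'b)" by simp
    then show ?thesis by (simp only: distrib_right mult_1)
  qed
  have neg: "a = b + c" if "- a + b + c = 0" for a b c :: 'b using that by (simp add: add.assoc add_eq_0_iff)
  have 3: "of_nat 12 * (of_nat (Suc (Suc M) * Suc M) * x) = of_nat (12 * Suc (Suc M) * Suc M) * x" for x :: 'b
    unfolding nm mult.assoc[of 12] ..
  from 0 show ?thesis unfolding fps_add_nth 1 2 12 3 by (rule neg)
qed

lemma el_comm: "mcomm (elemM i j) (elemM j i) = (elemM i i - elemM j j :: complex^'k^'k)"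
  using ij by (simp add: mcomm_elem)
lemma DPn_alt: "DPn M = comm (TT 2 0 (elemM i i - elemM j j)) (Y M i j)"
  unfolding DPn_def jac[symmetric] X_X el_comm ..
lemma D_ww: "comm (tt 3 0) (ww i j) = of_nat 3 * TT 2 0 (elemM i i - elemM j j)"
proof -
  have "ww i j = T0 1 (elemM i i - elemM j j)" unfolding ww_def[OF ij] T_lin ..
  moreover have "comm (tt 3 0) z = - comm z (tt 3 0)" for z by (simp add: comm_def)
  ultimately show ?thesis unfolding \<open>ww i j = _\<close> using T01_tt[of "elemM i i - elemM j j" 3 0] by simp
qed

lemma D_X: "comm (XX a b) (comm (tt 3 0) z) = comm (tt 3 0) (comm (XX a b) z)"
  using jac2[of "XX a b" "tt 3 0" z] X_tt[of "elemM a b" 3 0] by (simp add: comm_lin)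

text \<open>X_ij commutes with t_30, so the claim says that \<open>aa N\<close> equals 4 N
  [t_30, Y_{N-1}]. Both sequences obey \<open>main_coeff\<close>, the second because 2 Y_{M+1} =
  [w, Y_M].\<close>

lemma X_R: "comm (XX i j) (R4 (Suc M)) = 0"
proof (induction M)
  case 0
  have "comm (tt 3 0) (Y 0 i j) = - comm (Y 0 i j) (tt 3 0)" by (simp add: comm_def)
  then have 1: "comm (tt 3 0) (Y 0 i j) = 0" unfolding T00_tt by simp
  show ?case unfolding R4_def RHS4_def Qt_def comm_lin comm_c(2)[OF central_simps(6)] D_X X_tz X_tt by (simp add: 1 ek_0 comm_lin)
next
  case (Suc M)
  define D where "D = comm (tt 3 0)"
  have a: "aa N = of_nat 4 * (of_nat N * D (Y (N - 1) i j))" if "comm (XX i j) (R4 N) = 0" for N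
    using that unfolding R4_def comm_lin comm_c(2)[OF central_simps(6)] D_X X_tz aa_def[symmetric] D_def by simp
  have w: "of_nat 2 * Y (Suc M) i j = comm (ww i j) (Y M i j)" unfolding ww_Y[OF ij] using ij by (simp add: mult_2)
  have "of_nat 2 * D (Y (Suc M) i j) = D (of_nat 2 * Y (Suc M) i j)" unfolding D_def comm_c(2)[OF central_simps(6)] ..
  also have "\<dots> = of_nat 3 * DPn M + comm (ww i j) (D (Y M i j))"
    unfolding w unfolding D_def jac2[of "tt 3 0"] D_ww comm_c(1)[OF central_simps(6)] DPn_alt ..
  finally have d: "of_nat 2 * D (Y (Suc M) i j) = of_nat 3 * DPn M + comm (ww i j) (D (Y M i j))" .
  have n1: "Suc (Suc M) * (4 * Suc M) = 4 * Suc (Suc M) * Suc M" "Suc (Suc M) * 4 * Suc M = 4 * Suc (Suc M) * Suc M"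
    "12 * Suc (Suc M) * Suc M = 4 * Suc (Suc M) * Suc M * 3" by (simp_all add: algebra_simps)
  have "of_nat (2 * Suc M) * aa (Suc (Suc M)) = of_nat (4 * Suc (Suc M) * Suc M) * (of_nat 3 * DPn M + comm (ww i j) (D (Y M i j)))"
    unfolding main_coeff a[OF Suc.IH] comm_c(2)[OF central_simps(6)] distrib_left nm
    by (simp only: diff_Suc_1 n1 add.commute)
  also have "\<dots> = of_nat (2 * Suc M) * (of_nat (4 * Suc (Suc M)) * D (Y (Suc M) i j))"
    unfolding d[symmetric] nm by (rule arg_cong[of _ _ "\<lambda>x. of_nat x * _"]) simp
  finally have "aa (Suc (Suc M)) = of_nat (4 * Suc (Suc M)) * D (Y (Suc M) i j)" by (rule nat_cancel[rotated]) simp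
  then show ?case unfolding R4_def comm_lin comm_c(2)[OF central_simps(6)] D_X X_tz aa_def[symmetric] D_def nm by simp
qed
end

end

section \<open>The defect of (A4) commutes with all T_0m(X) and with T_10(1), and vanishes\<close>

context small_alg begin

lemma sumif: "(\<Sum>a\<in>UNIV. \<Sum>b\<in>UNIV. if d = a then f a b else 0) = (\<Sum>b\<in>UNIV. f d b)" for f :: "'k \<Rightarrow> 'k \<Rightarrow> 'b" and d
  by (subst sum.swap) simp
text \<open>Invariance of the tensor \<open>Omega\<close> under the adjoint action of gl_K.\<close>

lemma YY_00: "comm (Y 0 c d) (YY m q) = 0"
proof -
  have "comm (Y 0 c d) (YY m q) = (\<Sum>a\<in>UNIV. \<Sum>b\<in>UNIV. (if d = a then Y m c b * Y q b a else 0) - (if c = b then Y m a d * Y q b a else 0)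
      + ((if d = b then Y m a b * Y q c a else 0) - (if c = a then Y m a b * Y q b d else 0)))"
    unfolding YY_def comm_lin comm_mult Yc by (intro sum.cong refl) (auto simp: left_diff_distrib right_diff_distrib)
  also have "\<dots> = 0" unfolding sum.distrib sum_subtractf sumif by simp
  finally show ?thesis .
qed

lemma T_tz: "comm (T0 n X) (tz m) = 0"
  unfolding tz_def comm_c(2)[OF central_inv(1)] S1 mcomm_1 T_lin by simp
lemma T00_R: "comm (Y 0 c d) (R4 N) = 0"
proof -
  have "comm (Y 0 c d) (Qc p) = 0" for p
    unfolding Qc_def comm_lin comm_c(2)[OF central_simps(6)] comm_c(2)[OF central_simps(3)] comm_c(2)[OF central_simps(4)]
    unfolding comm_mult YY_00 T_tz by simp
  then have "comm (Y 0 c d) (Qt N) = 0" unfolding Qt_def by (simp add: comm_lin)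
  then show ?thesis
    unfolding R4_def RHS4_def comm_lin comm_c(2)[OF central_simps(6)] comm_c(2)[OF central_simps(3)] ek_comm jac2[of "Y 0 c d"] T00_tt T_tz
    by (simp add: comm_lin ek_0)
qed

context fixes i j :: 'k assumes ij: "i \<noteq> j" begin
interpretation C: cur2 dV UU EE1 EE3 fy "yb 1" fh "yb 3" fr fG fs fX fF by (rule cur2_ser)
declare C.E1_mult [simp del] C.E3_mult [simp del] C.UE [simp del] C.d_U [simp del]
abbreviation "fw \<equiv> fps_const (ww i j)"
abbreviation "EB \<equiv> elemM i i - elemM j j :: complex^'k^'k"
definition "Zf a = (\<Sum>b\<in>UNIV. yb 1 a b * fy b a - fy a b * yb 1 b a)"
definition "dl a x = (if a = i then x else 0) - (if a = j then x else (0::'b fps))"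
lemma dl: "dl a x * z = dl a (x * z)" "z * dl a x = dl a (z * x)" "dl a (x - z) = dl a x - dl a z"
   "(\<Sum>a\<in>UNIV. \<Sum>b\<in>UNIV. dl a (g a b)) = (\<Sum>b\<in>UNIV. g i b) - (\<Sum>b\<in>UNIV. g j b)"
   "(\<Sum>a\<in>UNIV. \<Sum>b\<in>UNIV. dl b (g a b)) = (\<Sum>a\<in>UNIV. g a i) - (\<Sum>a\<in>UNIV. g a j)"
proof -
  show "dl a (x - z) = dl a x - dl a z" by (simp add: dl_def)
  show "dl a x * z = dl a (x * z)" "z * dl a x = dl a (z * x)" by (simp_all add: dl_def left_diff_distrib right_diff_distrib)
  show b: "(\<Sum>a\<in>UNIV. \<Sum>b\<in>UNIV. dl b (g a b)) = (\<Sum>a\<in>UNIV. g a i) - (\<Sum>a\<in>UNIV. g a j)" for g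
    by (simp add: dl_def sum_subtractf)
  show "(\<Sum>a\<in>UNIV. \<Sum>b\<in>UNIV. dl a (g a b)) = (\<Sum>b\<in>UNIV. g i b) - (\<Sum>b\<in>UNIV. g j b)"
    by (subst sum.swap) (rule b)
qed
text \<open>The expressions \<open>q a b\<close> are antisymmetric, so the row and column
  contributions of w add up instead of cancelling.\<close>

lemma w_fQ: "UU (UU (comm fw fQ)) = (Zf i - Zf j) + (Zf i - Zf j)"
proof -
  define q where "q a b = yb 1 a b * fy b a - fy a b * yb 1 b a" for a b
  have J: "UU (UU (comm fw (yb 1 a b))) = dl a (UU (yb 1 a b) - fy a b) - dl b (UU (yb 1 a b) - fy a b)" for a b
    unfolding wy1_ser[OF ij] dl_def using ij by auto
  have m: "UU (UU (comm fw (x * z))) = UU (UU (comm fw x)) * z + x * UU (UU (comm fw z))" for x z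
    by (simp add: comm_def algebra_simps)
  have 1: "UU (UU (comm fw (yb 1 a b * yb 1 b a))) = dl a (q a b) - dl b (q a b)" for a b
    unfolding m J q_def left_diff_distrib right_diff_distrib dl by (simp add: algebra_simps)
  have u: "UU (sum f UNIV) = (\<Sum>a\<in>UNIV. UU (f a))" for f :: "'k \<Rightarrow> 'b fps" by (rule C.U_sum)
  have cs: "comm fw (sum f UNIV) = (\<Sum>a\<in>UNIV. comm fw (f a))" for f :: "'k \<Rightarrow> 'b fps" by (rule C.comm_lin)
  have "UU (UU (comm fw fQ)) = (\<Sum>a\<in>UNIV. \<Sum>b\<in>UNIV. dl a (q a b) - dl b (q a b))"
    unfolding fQ_def cs u 1 ..
  also have "\<dots> = (\<Sum>b\<in>UNIV. q i b) - (\<Sum>b\<in>UNIV. q j b) - ((\<Sum>a\<in>UNIV. q a i) - (\<Sum>a\<in>UNIV. q a j))"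
    unfolding sum_subtractf dl ..
  finally have 2: "UU (UU (comm fw fQ)) = \<dots>" .
  have 3: "q a c = - q c a" for a c
  proof -
    have "q a c + q c a = comm (yb 1 a c) (fy c a) + comm (yb 1 c a) (fy a c)"
      unfolding q_def comm_def by (simp add: algebra_simps)
    also have "\<dots> = 0" unfolding C.y1y by simp
    finally show ?thesis by (simp add: eq_neg_iff_add_eq_0)
  qed
  show ?thesis unfolding 2 Zf_def q_def[symmetric] 3[of _ i] 3[of _ j] by (simp add: sum_negf)
qed
text \<open>By the Jacobi identity its coefficient at u^(n+1), multiplied by n + 1, is
  [T_20(E_ii - E_jj), t_{0,n+1}]; see \<open>T20_tz\<close>.\<close>

definition "gB = comm (fX i j) (fy j i) - comm (fX j i) (fy i j)"
lemma gB: "dV gB + dV gB = (fs i i - fs j j) + (fs i i - fs j j) + ((fs i i - fs j j) + (fs i i - fs j j)) + EE1 (UU (UU (comm fw fQ)))"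
proof -
  have "fy i i * fy j j = fy j j * fy i i" using C.yy[of i i j j] ij by (simp add: comm_def)
  then have g: "gB = (fG i i + C.H i i) - (fG j j + C.H j j)"
    unfolding gB_def C.Xy using ij by (simp add: algebra_simps)
  have d: "dV (fG a a + C.H a a) = fs a a + fs a a + EE1 (Zf a)" for a
    unfolding C.d_add C.dG C.dH Zf_def sum_subtractf by (simp add: algebra_simps)
  show ?thesis unfolding g C.d_diff d w_fQ by (simp add: algebra_simps)
qed
lemma gB_nth: "fps_nth gB (Suc n) = comm (XX i j) (Y n j i) - comm (XX j i) (Y n i j)"
  unfolding gB_def fps_sub_nth comm_const_nth y_ser_nth by simp
lemma T20_tz: "comm (TT 2 0 EB) (tz (Suc n)) = of_nat (Suc n) * fps_nth gB (Suc n)"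
proof -
  have "comm (TT 2 0 EB) (tz (Suc n)) = comm (comm (XX i j) (XX j i)) (tz (Suc n))" unfolding X_X el_comm[OF ij] ..
  then show ?thesis unfolding jac X_tz comm_c(2)[OF central_simps(6)] gB_nth by (simp add: right_diff_distrib)
qed
lemma ww_T: "ww i j = T0 1 EB" unfolding ww_def[OF ij] T_lin ..
lemma ww_Qt: "comm (ww i j) (Qt (Suc n)) = fps_nth (UU (UU (comm fw fQ))) n"
proof -
  have "comm (ww i j) (Qc p) = comm (ww i j) (fps_nth fQ p)" for p
    unfolding Qc_def fQ_nth ww_T comm_lin comm_c(2)[OF central_simps(6)] comm_c(2)[OF central_simps(3)] comm_c(2)[OF central_simps(4)]
    unfolding comm_mult T_tz by simp
  then show ?thesis unfolding Qt_def UU_nth comm_const_nth by (auto simp: comm_lin eval_nat_numeral)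
qed
lemma T20_eq: "of_nat 2 * comm (TT 2 0 EB) (tz (Suc n)) = of_nat (4 * Suc n) * TT 1 n EB + e1 * comm (ww i j) (Qt (Suc n))"
proof -
  have "TT 1 n EB = Tone n (elemM i i) - Tone n (elemM j j)" unfolding TT_1 Tone_def T_lin comm_lin right_diff_distrib ..
  then have s: "fps_nth (fs i i - fs j j) n = of_nat (Suc n) * TT 1 n EB" by (simp add: fs_def right_diff_distrib)
  have four: "x + x + (x + x) = of_nat 4 * x" and two: "x + x = of_nat 2 * x" for x :: 'b
  proof -
    have "of_nat 4 = (1 + 1 + (1 + 1) :: 'b)" "of_nat 2 = (1 + 1 :: 'b)" by simp_all
    then show "x + x + (x + x) = of_nat 4 * x" "x + x = of_nat 2 * x" by (simp_all only: distrib_right mult_1)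
  qed
  have "fps_nth (dV gB + dV gB) n = of_nat 2 * comm (TT 2 0 EB) (tz (Suc n))"
    unfolding T20_tz fps_add_nth fps_deriv_nth two by simp
  moreover have "fps_nth (dV gB + dV gB) n = of_nat (4 * Suc n) * TT 1 n EB + e1 * comm (ww i j) (Qt (Suc n))"
    unfolding gB fps_add_nth s four fps_mult_left_const_nth ww_Qt nm ..
  ultimately show ?thesis by simp
qed
text \<open>[w, t_30] = -3 T_20(E_ii - E_jj), so everything reduces to the bracket of T_20(E_ii -
  E_jj) with t_{0,n+1}, known from \<open>T20_eq\<close>.\<close>

lemma ww_R: "comm (ww i j) (R4 (Suc n)) = 0"
proof -
  have t30: "comm (ww i j) (tt 3 0) = - (of_nat 3 * TT 2 0 EB)" unfolding ww_T T01_tt by simp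
  have "of_nat 6 * (of_nat 2 * comm (TT 2 0 EB) (tz (Suc n))) = of_nat (12 * Suc n) * (of_nat 2 * TT 1 n EB) + of_nat 6 * (e1 * comm (ww i j) (Qt (Suc n)))"
  proof -
    have "6 * (4 * Suc n) = 12 * Suc n * 2" by simp
    then show ?thesis unfolding T20_eq distrib_left nm by (simp only:)
  qed
  then have "of_nat 4 * (of_nat 3 * comm (TT 2 0 EB) (tz (Suc n))) = of_nat (12 * Suc n) * (of_nat 2 * TT 1 n EB) + of_nat 6 * (e1 * comm (ww i j) (Qt (Suc n)))"
    unfolding nm by simp
  then show ?thesis
    unfolding R4_def RHS4_def comm_lin comm_c(2)[OF central_simps(6)] comm_c(2)[OF central_simps(3)] ek_comm jac2[of "ww i j"] t30 comm_c(1)[OF central_simps(6)]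
    unfolding ww_T T_tz T01_tt diff_Suc_1 by (simp add: comm_lin ek_0 del: of_nat_Suc of_nat_mult)
qed
end

text \<open>The elements commuting with R form a subalgebra containing the central scalars.
  Membership is carried from the traceless T_0n to all T_0n by \<open>HR\<close> and the inverse of
  e3, as it was for weights.\<close>

context fixes R :: 'b
  assumes hX: "\<And>i j. i \<noteq> j \<Longrightarrow> comm (XX i j) R = 0" and hY: "\<And>c d. comm (Y 0 c d) R = 0" and hw: "\<And>i j. i \<noteq> j \<Longrightarrow> comm (ww i j) R = 0"
begin
definition "cz x \<longleftrightarrow> comm x R = 0"
lemma cz_add: "cz x \<Longrightarrow> cz y \<Longrightarrow> cz (x + y)" and cz_diff: "cz x \<Longrightarrow> cz y \<Longrightarrow> cz (x - y)" and cz_minus: "cz x \<Longrightarrow> cz (- x)" and cz_0: "cz 0"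
  and cz_mult: "cz x \<Longrightarrow> cz y \<Longrightarrow> cz (x * y)" and cz_comm: "cz x \<Longrightarrow> cz y \<Longrightarrow> cz (comm x y)" and cz_c: "central c \<Longrightarrow> cz x \<Longrightarrow> cz (c * x)"
  by (simp_all add: cz_def comm_lin comm_mult comm_c jac)
lemma cz_sum: "(\<And>a. a \<in> A \<Longrightarrow> cz (f a)) \<Longrightarrow> cz (sum f A)"
  by (induction A rule: infinite_finite_induct) (auto intro: cz_0 cz_add)
lemma cz_nat: "0 < n \<Longrightarrow> cz (of_nat n * x) \<Longrightarrow> cz x"
  using cz_c[of "k (1 / of_nat n)" "of_nat n * x"] by (simp only: nat_k central_simps)
lemma cz_e3: "cz (e3 * x) \<Longrightarrow> cz x" using cz_c[OF central_inv(2), of "e3 * x"] unfolding e3i' .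
lemma cz_Y0: "cz (Y 0 a b)" using hY by (simp add: cz_def)
lemma cz_off: "a \<noteq> b \<Longrightarrow> cz (Y n a b)"
proof (induction n)
  case (Suc n)
  have "of_nat 2 * Y (Suc n) a b = comm (ww a b) (Y n a b)" unfolding ww_Y[OF Suc.prems] using Suc.prems by (simp add: mult_2)
  moreover have "cz (comm (ww a b) (Y n a b))" using Suc hw by (intro cz_comm) (simp_all add: cz_def)
  ultimately show ?case using cz_nat[of 2] by (metis zero_less_numeral)
qed (rule cz_Y0)
lemma cz_dif: assumes "a \<noteq> b" shows "cz (Y n a a - Y n b b)"
proof (cases n)
  case (Suc m)
  show ?thesis unfolding Suc Y_diff[OF assms] by (intro cz_comm cz_off) (use assms in auto)
qed (simp add: cz_diff cz_Y0)
lemma cz_XB: assumes "i \<noteq> j" shows "cz (XX i i - XX j j)"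
proof -
  have "XX i i - XX j j = comm (XX i j) (Y 0 j i)" unfolding XY using assms by (simp add: Tone_0)
  moreover have "cz (XX i j)" using hX[OF assms] by (simp add: cz_def)
  ultimately show ?thesis by (simp add: cz_comm cz_Y0)
qed
lemma cz_Y: "cz (Y n a b)"
proof (cases "a = b")
  case True
  obtain j where ij: "a \<noteq> j"
    using card by (metis (full_types) UNIV_eq_I card_1_singleton_iff less_irrefl singletonI One_nat_def)
  have p: "cz (Y m b c * Y (n - m) c b)" if "b \<noteq> c" for m b c using that by (intro cz_mult cz_off) auto
  have q: "cz (comm (XX a a - XX j j) (Y (n + 1) a a - Y (n + 1) j j))" by (intro cz_comm cz_XB cz_dif ij)
  have "cz (of_nat (n + 1) * (e3 * (Y n a a + Y n j j)))"
    unfolding HR[OF ij, of "n + 1", unfolded add_diff_cancel_right']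
    by (intro cz_diff cz_minus cz_c[OF central_simps(3)] cz_sum cz_add p q) (use ij in auto)
  from cz_nat[OF _ this] have "cz (e3 * (Y n a a + Y n j j))" by simp
  from cz_add[OF cz_e3[OF this] cz_dif[OF ij]] have "cz ((Y n a a + Y n j j) + (Y n a a - Y n j j))" .
  also have "(Y n a a + Y n j j) + (Y n a a - Y n j j) = of_nat 2 * Y n a a" by (simp add: mult_2)
  finally show ?thesis using True cz_nat[of 2] by simp
qed (rule cz_off)

lemma cz_Tone: assumes "i \<noteq> j" shows "cz (Tone 1 (elemM i i) - Tone 1 (elemM j j))"
proof -
  have "Tone 1 (elemM i i) - Tone 1 (elemM j j) = comm (XX i j) (Y 1 j i) + e3 * k (of_nat 1 / 2) * (Y (1 - 1) i i + Y (1 - 1) j j)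
   - e1 * (\<Sum>m<1. k (of_nat (m + 1) / of_nat (1 + 1)) * ((\<Sum>x\<in>UNIV. Y m i x * Y (1 - 1 - m) x i) - (\<Sum>x\<in>UNIV. Y m j x * Y (1 - 1 - m) x j)))
   - e1 * (\<Sum>m<1. Y m i i * Y (1 - 1 - m) j j - (\<Sum>x\<in>UNIV. Y m i x * Y (1 - 1 - m) x i))"
    unfolding XY using assms by simp
  moreover have "cz (XX i j)" using hX[OF assms] by (simp add: cz_def)
  moreover have "central (e3 * k z)" for z by (intro central_mult central_simps)
  ultimately show ?thesis by (simp only:) (intro cz_diff cz_add cz_comm cz_Y cz_c cz_sum cz_mult[of "Y _ _ _"] central_simps | assumption)+
qed

lemma FF_Y1: "FF (Y 1 a b) = of_nat 2 * XX a b" using S2(5) by simp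
text \<open>\<open>HR\<close> at n = 2 is differentiated by ad t_20, which yields e3 (X_aa + X_jj).
  t_20 itself is not known to commute with R, but after the Leibniz rule only elements already shown
  to commute are left.\<close>

lemma cz_X: "cz (XX a a)"
proof -
  obtain j where ij: "a \<noteq> j"
    using card by (metis (full_types) UNIV_eq_I card_1_singleton_iff less_irrefl singletonI One_nat_def)
  have F: "cz (FF (Y m b c))" if "m < 2" "b \<noteq> c" for m b c
  proof -
    have "cz (XX b c)" using hX[OF that(2)] by (simp add: cz_def)
    then show ?thesis using that(1) S2(4) FF_Y1[of b c] cz_c[OF central_simps(7)] cz_0 by (cases m) (auto simp: less_2_cases_iff)
  qed
  have p: "cz (FF (Y m b c * Y (1 - m) c b))" if "m \<in> {..<2}" "b \<noteq> c" for m b c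
    unfolding comm_mult using that by (intro cz_add cz_mult cz_off F) auto
  have FX: "FF (XX a a - XX j j) = 0" unfolding comm_lin S2 by simp
  have F2: "FF (Y 2 a a - Y 2 j j) = of_nat 4 * (Tone 1 (elemM a a) - Tone 1 (elemM j j))"
    using F_T0[of 1] unfolding comm_lin by (simp add: numeral_2_eq_2 right_diff_distrib)
  have "FF (of_nat 2 * (e3 * (Y 1 a a + Y 1 j j))) = FF (- comm (XX a a - XX j j) (Y 2 a a - Y 2 j j)
    - e1 * (\<Sum>m<2. (\<Sum>x\<in>UNIV-{a}. Y m a x * Y (1 - m) x a) + (\<Sum>x\<in>UNIV-{j}. Y m j x * Y (1 - m) x j)
       + Y m a j * Y (1 - m) j a + Y m j a * Y (1 - m) a j))"
    using HR[OF ij, of 2] by simp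
  moreover have "FF (of_nat 2 * (e3 * (Y 1 a a + Y 1 j j))) = of_nat 4 * (e3 * (XX a a + XX j j))"
    unfolding comm_c(2)[OF central_simps(6)] comm_c(2)[OF central_simps(5)] comm_lin FF_Y1
    unfolding distrib_left[symmetric] c_left[OF central_simps(6), of e3] nm by simp
  moreover have "cz (FF (- comm (XX a a - XX j j) (Y 2 a a - Y 2 j j)
    - e1 * (\<Sum>m<2. (\<Sum>x\<in>UNIV-{a}. Y m a x * Y (1 - m) x a) + (\<Sum>x\<in>UNIV-{j}. Y m j x * Y (1 - m) x j)
       + Y m a j * Y (1 - m) j a + Y m j a * Y (1 - m) a j)))"
  proof -
    have 1: "FF (- A - e1 * S) = - FF A - e1 * FF S" for A S by (simp add: comm_lin comm_c)
    have 2: "FF (comm (XX a a - XX j j) (Y 2 a a - Y 2 j j)) = comm (XX a a - XX j j) (of_nat 4 * (Tone 1 (elemM a a) - Tone 1 (elemM j j)))"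
      unfolding jac2[of t20] FX F2 by (simp add: comm_lin)
    show ?thesis unfolding 1 2 comm_lin(5,10) by (intro cz_diff cz_minus cz_c[OF central_simps(3)] cz_c[OF central_simps(6)] cz_sum cz_add p cz_comm cz_XB cz_Tone ij) (use ij in auto)
  qed
  ultimately have "cz (of_nat 4 * (e3 * (XX a a + XX j j)))" by simp
  from cz_nat[OF _ this] have "cz (e3 * (XX a a + XX j j))" by simp
  from cz_add[OF cz_e3[OF this] cz_XB[OF ij]] have "cz ((XX a a + XX j j) + (XX a a - XX j j))" .
  also have "(XX a a + XX j j) + (XX a a - XX j j) = of_nat 2 * XX a a" by (simp add: mult_2)
  finally show ?thesis using cz_nat[of 2] by simp
qed
lemma one_comm: "comm (T1 (mat 1)) R = 0"
  using cz_sum[of UNIV "\<lambda>a. XX a a"] cz_X unfolding cz_def mat1_elem T_lin by simp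
end

definition "cv f g p = (\<Sum>m\<le>p. of_nat ((m + 1) * (p + 1 - m)) * (f m * g (p - m)))" for f g :: "nat \<Rightarrow> 'b"
lemma Qc_cv: "Qc p = (\<Sum>a\<in>UNIV. \<Sum>b\<in>UNIV. cv (\<lambda>m. Y m a b) (\<lambda>m. Y m b a) p) + e1 * (e2 * cv tz tz p)"
proof -
  have "(\<Sum>m\<le>p. of_nat ((m + 1) * (p + 1 - m)) * YY m (p - m)) = (\<Sum>a\<in>UNIV. \<Sum>b\<in>UNIV. cv (\<lambda>m. Y m a b) (\<lambda>m. Y m b a) p)"
    unfolding YY_def cv_def sum_distrib_left by (rule trans[OF sum.cong[OF refl sum.swap] sum.swap, symmetric])
  then show ?thesis unfolding Qc_def distrib_left sum.distrib
    by (simp only: cv_def sum_distrib_left c_left[OF central_simps(6)])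
qed
context fixes x c :: 'b and f g :: "nat \<Rightarrow> 'b"
  assumes c: "central c" and xf: "\<And>m. comm x (f m) = of_nat m * (c * f (m - 1))" and xg: "\<And>m. comm x (g m) = of_nat m * (c * g (m - 1))"
begin
text \<open>With these weights the convolution at p behaves under ad x like an element of index p +
  3, which matches the shift N - 3 in (A4).\<close>

lemma cv_der: "comm x (cv f g (Suc p)) = of_nat (p + 4) * (c * cv f g p)"
proof -
  have 1: "comm x (f m * g q) = of_nat m * (c * (f (m - 1) * g q)) + of_nat q * (c * (f m * g (q - 1)))" for m q
    unfolding comm_mult xf xg by (simp add: mult.assoc c_left[OF central_simps(6), of "f m"] c_left[OF c, of "f m"])
  have i: "Suc p - m - 1 = p - m" for m by simp
  have "comm x (cv f g (Suc p)) = (\<Sum>m\<le>Suc p. of_nat ((m + 1) * (Suc p + 1 - m) * m) * (c * (f (m - 1) * g (Suc p - m))))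
      + (\<Sum>m\<le>Suc p. of_nat ((m + 1) * (Suc p + 1 - m) * (Suc p - m)) * (c * (f m * g (p - m))))"
    unfolding cv_def comm_lin comm_c(2)[OF central_simps(6)] 1 distrib_left nm sum.distrib
    i ..
  also have "(\<Sum>m\<le>Suc p. of_nat ((m + 1) * (Suc p + 1 - m) * m) * (c * (f (m - 1) * g (Suc p - m))))
     = (\<Sum>m\<le>p. of_nat ((m + 2) * (p + 1 - m) * (m + 1)) * (c * (f m * g (p - m))))"
    by (subst sum.atMost_Suc_shift) (simp del: of_nat_mult of_nat_add of_nat_Suc)
  also have "(\<Sum>m\<le>Suc p. of_nat ((m + 1) * (Suc p + 1 - m) * (Suc p - m)) * (c * (f m * g (p - m))))
     = (\<Sum>m\<le>p. of_nat ((m + 1) * (p + 2 - m) * (p + 1 - m)) * (c * (f m * g (p - m))))"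
    by (subst sum.atMost_Suc) (simp del: of_nat_mult of_nat_add of_nat_Suc)
  also have "(\<Sum>m\<le>p. of_nat ((m + 2) * (p + 1 - m) * (m + 1)) * (c * (f m * g (p - m)))) + \<dots>
     = (\<Sum>m\<le>p. of_nat (p + 4) * (c * (of_nat ((m + 1) * (p + 1 - m)) * (f m * g (p - m)))))"
    unfolding sum.distrib[symmetric]
  proof (intro sum.cong refl)
    fix m assume "m \<in> {..p}"
    then obtain q where q: "p = m + q" using le_Suc_ex by auto
    have "(m + 2) * (p + 1 - m) * (m + 1) + (m + 1) * (p + 2 - m) * (p + 1 - m) = (p + 4) * ((m + 1) * (p + 1 - m))"
      unfolding q by (simp add: algebra_simps)
    then show "of_nat ((m + 2) * (p + 1 - m) * (m + 1)) * (c * (f m * g (p - m))) + of_nat ((m + 1) * (p + 2 - m) * (p + 1 - m)) * (c * (f m * g (p - m)))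
       = of_nat (p + 4) * (c * (of_nat ((m + 1) * (p + 1 - m)) * (f m * g (p - m))))"
      unfolding c_left[OF central_simps(6), of c] nm distrib_right[symmetric] of_nat_add[symmetric] by simp
  qed
  finally show ?thesis unfolding cv_def sum_distrib_left .
qed
lemma cv_der0: "comm x (cv f g 0) = 0"
  unfolding cv_def using xf[of 0] xg[of 0] by (simp add: comm_mult)
end

lemma one_tz: "comm (T1 (mat 1)) (tz n) = of_nat n * (e2 * tz (n - 1))" unfolding X_tz T0_one ..
lemma one_Qc: "comm (T1 (mat 1)) (Qc (Suc p)) = of_nat (p + 4) * (e2 * Qc p)" "comm (T1 (mat 1)) (Qc 0) = 0"
proof -
  have d: "comm (T1 (mat 1)) (cv (\<lambda>m. Y m a b) (\<lambda>m. Y m b a) (Suc p)) = of_nat (p + 4) * (e2 * cv (\<lambda>m. Y m a b) (\<lambda>m. Y m b a) p)"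
      "comm (T1 (mat 1)) (cv (\<lambda>m. Y m a b) (\<lambda>m. Y m b a) 0) = 0"
      "comm (T1 (mat 1)) (cv tz tz (Suc p)) = of_nat (p + 4) * (e2 * cv tz tz p)" "comm (T1 (mat 1)) (cv tz tz 0) = 0" for a b p
    by (rule cv_der[OF central_simps(4) one_T0 one_T0], rule cv_der0[OF central_simps(4) one_T0 one_T0],
        rule cv_der[OF central_simps(4) one_tz one_tz], rule cv_der0[OF central_simps(4) one_tz one_tz])
  show "comm (T1 (mat 1)) (Qc (Suc p)) = of_nat (p + 4) * (e2 * Qc p)"
    unfolding Qc_cv comm_lin comm_c(2)[OF central_simps(3)] comm_c(2)[OF central_simps(4)] d distrib_left sum_distrib_left
      c_left[OF central_simps(6)] c_left[OF central_simps(4), of e1] ..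
  show "comm (T1 (mat 1)) (Qc 0) = 0"
    unfolding Qc_cv comm_lin comm_c(2)[OF central_simps(3)] comm_c(2)[OF central_simps(4)] d by simp
qed
lemma one_Qt: "comm (T1 (mat 1)) (Qt (Suc N)) = of_nat (Suc N) * (e2 * Qt N)"
proof (cases "N \<ge> 3")
  case True
  then obtain p where "N = p + 3" using le_Suc_ex by (metis add.commute)
  then show ?thesis using one_Qc(1)[of p] by (simp add: Qt_def eval_nat_numeral)
next
  case False
  then show ?thesis using one_Qc(2) by (cases "N = 2") (simp_all add: Qt_def comm_lin)
qed

lemma one_tt: "comm (T1 (mat 1)) (tt n m) = of_nat m * (e2 * tt n (m - 1))" unfolding X_tt TT_one ..
lemma one_R: "comm (T1 (mat 1)) (R4 (Suc N)) = of_nat (Suc N) * (e2 * R4 N)"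
proof -
  have 1: "comm (T1 (mat 1)) (comm (tt 3 0) (tz (Suc N))) = of_nat (Suc N) * (e2 * comm (tt 3 0) (tz N))"
    unfolding jac2[of "T1 (mat 1)"] one_tt one_tz comm_c[OF central_simps(6)] comm_c[OF central_simps(4)] by (simp add: comm_lin del: of_nat_Suc)
  have e: "ek (of_nat m * z) = of_nat m * ek z" "ek (e2 * z) = e2 * ek z" for m z by (simp_all add: ek_c)
  have i: "Suc N - 1 = N" "Suc N - 2 = N - 1" "Suc N - 3 = N - 2" "N - 2 - 1 = N - 3" by simp_all
  have l: "of_nat m * (e2 * z) = e2 * (of_nat m * z)" "e1 * (e2 * z) = e2 * (e1 * z)" "e1 * (of_nat m * z) = of_nat m * (e1 * z)" for m z
    by (rule c_left, rule central_simps)+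
  note o = comm_c(2)[OF central_simps(6)] comm_c(2)[OF central_simps(3)] ek_comm
  note nac = mult.commute[where 'a = nat] mult.left_commute[where 'a = nat] mult.assoc[where 'a = nat]
  have p1: "comm (T1 (mat 1)) (of_nat 4 * comm (tt 3 0) (tz (Suc N))) = of_nat (Suc N) * (e2 * (of_nat 4 * comm (tt 3 0) (tz N)))"
    unfolding o 1 by (simp only: l nm nac)
  have p2: "comm (T1 (mat 1)) (of_nat (12 * Suc N) * tt 2 (Suc N - 1)) = of_nat (Suc N) * (e2 * (of_nat (12 * N) * tt 2 (N - 1)))"
    unfolding o one_tt i by (simp only: l nm nac)
  have p3: "comm (T1 (mat 1)) (ek (of_nat (Suc N * (Suc N - 1) * (Suc N - 2)) * tz (Suc N - 3))) = of_nat (Suc N) * (e2 * ek (of_nat (N * (N - 1) * (N - 2)) * tz (N - 3)))"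
    unfolding o one_tz i by (simp only: l e nm nac)
  have p4: "comm (T1 (mat 1)) (of_nat 6 * (e1 * Qt (Suc N))) = of_nat (Suc N) * (e2 * (of_nat 6 * (e1 * Qt N)))"
    unfolding o one_Qt by (simp only: l nm nac)
  show ?thesis unfolding R4_def RHS4_def comm_lin p1 p2 p3 p4 by (simp only: right_diff_distrib distrib_left)
qed

lemma R4_0: "R4 N = 0"
proof -
  have "comm (T1 (mat 1)) (R4 (Suc N)) = 0" by (rule one_comm[OF X_R T00_R ww_R])
  then have "of_nat (Suc N) * (e2 * R4 N) = of_nat (Suc N) * 0" unfolding one_R by simp
  then have "e2 * R4 N = 0" by (rule nat_cancel[rotated]) simp
  then have "e2i * (e2 * R4 N) = 0" by simp
  then show ?thesis unfolding e2i' .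
qed

end

section \<open>The isomorphism\<close>

context small_alg begin
lemma TT_0': "TT 0 = T0" by (rule ext)+ (rule TT_0)
lemma T1_eq: "T1 X = TT 1 0 X" unfolding TT_1 Tone_0 ..

lemma TT_lin: "TT n m (mscale a X + mscale b Z) = k a * TT n m X + k b * TT n m Z"
  unfolding TT_def T_lin FF_pow FF_pow(3)[OF central_simps(2)] distrib_left
  by (simp only: c_left[OF central_simps(2), of "k (fact m / (fact (n + m) * 2 ^ n))"])

text \<open>Of the six pairs (p, q), those with p + q <= 1 come from \<open>op_TT\<close> and its
  companions, and those with p + q = 2 from the sl_2-strings.\<close>

lemma A2: assumes "p + q \<le> 2"
  shows "comm (tt p q) (TT n m X) = of_int (int m * int p - int n * int q) * TT (p + n - 1) (q + m - 1) X"
proof -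
  have c0: "central 0" by (simp add: central_def)
  have z0: "FF (T0 0 (mat 1)) = 0" by (rule S2)
  have t00: "comm (tt 0 0) (TT n m X) = 0"
    unfolding tt_def TT_0 comm_c(1)[OF central_inv(1)]
    by (subst op_TT[OF c0 z0, of X X]) (simp_all add: S1 mcomm_1 T_lin)
  have t10: "comm (tt 1 0) (TT n m X) = of_nat m * TT n (m - 1) X"
    unfolding tt_def T1_eq[symmetric] comm_c(1)[OF central_inv(1)] one_TT by (simp only: c_left[OF central_simps(6), of e2i] e2i')
  have t02': "comm t02 (T1 (mat 1)) = - (2 * T0 1 (mat 1))" using S2(7) by simp
  have t01: "comm (tt 0 1) (TT n m X) = - (of_nat n * TT (n - 1) m X)"
    unfolding tt_def TT_0 comm_c(1)[OF central_inv(1)] op_TT'[OF central_simps(4) S2(6) one_T0 t02']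
    by (simp only: mult_minus_right c_left[OF central_simps(6), of e2i] e2i')
  have t20': "comm (tt 2 0) (TT n m X) = of_nat (2 * m) * TT (n + 1) (m - 1) X"
    unfolding tt_20 using F_TT[of n "m - 1" X] F_TT0[of n X] by (cases m) simp_all
  have t02: "comm (tt 0 2) (TT n m X) = - (of_nat (2 * n) * TT (n - 1) (m + 1) X)"
    unfolding tt_02 using E_TT[of "n - 1" m X] E_TT0[of m X] by (cases n) simp_all
  have t11: "comm (tt 1 1) (TT n m X) = of_int (int m - int n) * TT n m X" unfolding tt_11 H_TT ..
  from assms have "p = 0 \<and> q = 0 \<or> p = 1 \<and> q = 0 \<or> p = 0 \<and> q = 1 \<or> p = 2 \<and> q = 0 \<or> p = 0 \<and> q = 2 \<or> p = 1 \<and> q = 1" by arith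
  then show ?thesis
    using t00 t10 t01 t20' t02 t11 by (elim disjE) (simp_all add: mult.commute)
qed

lemma four_mult: "of_nat 4 * (k (of_nat M / 4) * x) = of_nat M * x" "of_nat 4 * (k (3 / 2) * x) = of_nat 6 * x"
  unfolding nk by (simp_all del: k_simps add: k_numeral)

lemma A4_rel: assumes "3 \<le> n"
  shows "comm (tt 3 0) (tt 0 n) = of_nat (3 * n) * tt 2 (n - 1)
    + \<iota> (of_base (cst (of_nat (n * (n - 1) * (n - 2)) / 4) * (eps1\<^sup>2 - eps2 * eps3 TYPE('k)))) * tt 0 (n - 3)
    - \<iota> (of_base (cst (3 / 2) * eps1)) * (\<Sum>m\<le>n - 3. of_nat ((m + 1) * (n - 2 - m)) *
        (tens (\<lambda>c. \<iota> (of_base (cst c))) (TT 0 m) (TT 0 (n - 3 - m)) Omega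
         + \<iota> (of_base (eps1 * eps2)) * tt 0 m * tt 0 (n - 3 - m)))" (is "_ = ?R")
proof -
  have O: "tens (\<lambda>c. \<iota> (of_base (cst c))) (TT 0 m) (TT 0 q) Omega = YY m q" for m q
    unfolding TT_0' tn Omega_def YY_def by (simp add: tn_sum tn_kron)
  have s: "(\<Sum>m\<le>n - 3. of_nat ((m + 1) * (n - 2 - m)) * (YY m (n - 3 - m) + \<iota> (of_base (eps1 * eps2)) * tz m * tz (n - 3 - m))) = Qc (n - 3)"
  proof -
    have i: "\<iota> (of_base (eps1 * eps2)) * x * y = e1 * (e2 * (x * y))" for x y
      unfolding e1_def e2_def by (simp only: of_base_mult i_mult mult.assoc)
    have "n - 2 - m = n - 3 + 1 - m" for m using assms by simp
    then show ?thesis unfolding Qc_def i by simp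
  qed
  have c1: "\<iota> (of_base (cst (of_nat (n * (n - 1) * (n - 2)) / 4) * (eps1\<^sup>2 - eps2 * eps3 TYPE('k)))) * x = k (of_nat (n * (n - 1) * (n - 2)) / 4) * ek x" for x
    unfolding ek_def k_def e1_def e2_def e3_def
    by (simp only: of_base_mult of_base_diff power2_eq_square i_mult i_diff mult.assoc left_diff_distrib right_diff_distrib)
  have c2: "\<iota> (of_base (cst (3 / 2) * eps1)) * x = k (3 / 2) * (e1 * x)" for x
    unfolding k_def e1_def by (simp only: of_base_mult i_mult mult.assoc)
  have "of_nat 4 * comm (tt 3 0) (tz n) = RHS4 n" using R4_0[of n] unfolding R4_def by simp
  also have "\<dots> = of_nat 4 * (of_nat (3 * n) * tt 2 (n - 1) + k (of_nat (n * (n - 1) * (n - 2)) / 4) * ek (tz (n - 3)) - k (3 / 2) * (e1 * Qc (n - 3)))"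
  proof -
    have e: "4 * (3 * n) = 12 * n" by simp
    show ?thesis
      unfolding RHS4_def Qt_def right_diff_distrib distrib_left four_mult nm e ek_c[OF central_simps(6)] using assms by (simp only: if_True)
  qed
  also have "of_nat (3 * n) * tt 2 (n - 1) + k (of_nat (n * (n - 1) * (n - 2)) / 4) * ek (tz (n - 3)) - k (3 / 2) * (e1 * Qc (n - 3)) = ?R"
    unfolding O tt_0 s c1 c2 ..
  finally show ?thesis unfolding tt_0 by (rule nat_cancel[rotated]) simp
qed

text \<open>All relations of A hold in any algebra with the smaller presentation, which therefore
  receives a homomorphism from A.\<close>

theorem big: "dca_alg (\<lambda>p. \<iota> (of_base p)) TT tt"
proof
  fix n m p q :: nat and a b :: complex and X Y :: "complex^'k^'k"
  show "structure_map (\<lambda>p. \<iota> (of_base p))"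
    unfolding structure_map_def of_base_1 of_base_add of_base_mult i_1 i_add i_mult by (intro conjI allI refl) (rule i_cent)
  show "TT n m (mat 1) = \<iota> (of_base eps2) * tt n m" unfolding TT_one e2_def ..
  show "TT n m (mscale a X + mscale b Y) = \<iota> (of_base (cst a)) * TT n m X + \<iota> (of_base (cst b)) * TT n m Y"
    unfolding TT_lin k_def ..
  show "comm (TT 0 0 X) (TT 0 n Y) = TT 0 n (mcomm X Y)" unfolding TT_0 S1 by simp
  show "comm (TT 0 0 X) (tt 0 n) = 0" unfolding TT_0 T00_tt ..
  show "comm (TT 1 0 X) (tt 0 n) = of_nat n * TT 0 (n - 1) X" unfolding T1_eq[symmetric] X_tt ..
  show "comm (TT 1 0 X) (TT 0 n Y) = TT 1 n (mcomm X Y)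
    - \<iota> (of_base (eps3 TYPE('k) * cst (of_nat n / 2))) * TT 0 (n - 1) (macomm X Y)
    - \<iota> (of_base (of_nat n * eps1 * cst (trace Y))) * TT 0 (n - 1) X
    + \<iota> (of_base eps1) * (\<Sum>m<n. \<iota> (of_base (cst (of_nat (m + 1) / of_nat (n + 1)))) *
        tens (\<lambda>c. \<iota> (of_base (cst c))) (TT 0 m) (TT 0 (n - 1 - m)) (kron (mcomm X Y) (mat 1) ** Omega))
    + \<iota> (of_base eps1) * (\<Sum>m<n.
        tens (\<lambda>c. \<iota> (of_base (cst c))) (TT 0 m) (TT 0 (n - 1 - m))
          ((kron X Y - kron (X ** Y) (mat 1)) ** Omega))"
    unfolding T1_eq[symmetric] unfolding TT_0' S3 TT_1 Tone_def k_def ..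
  show "comm (tt p q) (TT n m X) = of_int (int m * int p - int n * int q) * TT (p + n - 1) (q + m - 1) X" if "p + q \<le> 2" by (rule A2[OF that])
  show "comm (tt p q) (tt n m) = of_int (int m * int p - int n * int q) * tt (p + n - 1) (q + m - 1)" if "p + q \<le> 2"
    unfolding tt_def[of n m] comm_c(2)[OF central_inv(1)] A2[OF that] unfolding tt_def by (rule c_left[OF central_int])
qed (rule A4_rel)
end

lemma small_alg_sq: assumes "CARD('k::finite) > 1"
  shows "small_alg (sq_scal :: 'k laurent \<Rightarrow> 'k sq) (\<lambda>n X. sq_gen (S_T0 n X)) (\<lambda>X. sq_gen (S_T10 X)) (sq_gen S_t20) (sq_gen S_t11) (sq_gen S_t02)"
proof
  let ?ev = "free_eval sq_scal sq_gen :: ('k sgen, 'k laurent) falg \<Rightarrow> _"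
  note ev = free_evals[OF structure_map_sq_scal, of "sq_gen :: 'k sgen \<Rightarrow> _"]
  have r: "?ev x = ?ev y" if "x \<approx>S y" for x y using that by (rule small_rel_sq)
  have T0: "?ev (sT 0 m X) = sq_gen (S_T0 m X)" and T1: "?ev (sT 1 0 X) = sq_gen (S_T10 X)" for m X
    by (simp_all add: sT_def ev)
  have t: "?ev (st 2 0) = sq_gen S_t20" "?ev (st 1 1) = sq_gen S_t11" "?ev (st 0 2) = sq_gen S_t02" by (simp_all add: st_def ev)
  fix n m :: nat and a b :: complex and X Y :: "complex^'k^'k"
  show "CARD('k) > 1" by (rule assms)
  show "structure_map (sq_scal :: 'k laurent \<Rightarrow> 'k sq)" by (rule structure_map_sq_scal)
  show "sq_gen (S_T0 n (mscale a X + mscale b Y)) = sq_scal (of_base (cst a)) * sq_gen (S_T0 n X) + sq_scal (of_base (cst b)) * sq_gen (S_T0 n Y)"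
    using r[OF S0_lin[of 0 n a X b Y]] by (simp add: ev T0)
  show "sq_gen (S_T10 (mscale a X + mscale b Y)) = sq_scal (of_base (cst a)) * sq_gen (S_T10 X) + sq_scal (of_base (cst b)) * sq_gen (S_T10 Y)"
    using r[OF S0_lin[of 1 0 a X b Y]] by (simp only: ev T1 simp_thms)
  show "sq_gen (S_T0 2 (mat 1)) = sq_scal (of_base eps2) * (sq_gen S_t02 :: 'k sq)" using r[OF S0_unit] by (simp only: ev T0 t)
  show "comm (sq_gen (S_T0 m X)) (sq_gen (S_T0 n Y)) = sq_gen (S_T0 (m + n) (mcomm X Y))" using r[OF S1[of m X n Y]] by (simp only: ev T0)
  have evn: "?ev (numeral w) = numeral w" for w using free_eval_of_nat[OF structure_map_sq_scal, of sq_gen "numeral w"] by simp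
  show "comm (sq_gen S_t20) (sq_gen S_t11) = 2 * (sq_gen S_t20 :: 'k sq)" using r[OF S2_t[of 2 0 1 1]] by (simp add: ev evn t t(2)[unfolded One_nat_def])
  show "comm (sq_gen S_t20) (sq_gen S_t02) = 4 * (sq_gen S_t11 :: 'k sq)" using r[OF S2_t[of 2 0 2 0]] by (simp add: ev evn t t(2)[unfolded One_nat_def])
  show "comm (sq_gen S_t02) (sq_gen S_t11) = - 2 * (sq_gen S_t02 :: 'k sq)" using r[OF S2_t[of 0 2 1 1]] by (simp add: ev evn t t(2)[unfolded One_nat_def])
  show "comm (sq_gen S_t20) (sq_gen (S_T0 0 X)) = 0" using r[OF S2_T[of 2 0 0 0 X]] by (simp add: ev t T0)
  show "comm (sq_gen S_t20) (sq_gen (S_T0 1 X)) = 2 * sq_gen (S_T10 X)" using r[OF S2_T[of 2 0 0 1 X]] by (simp add: ev evn t T0 T1[unfolded One_nat_def])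
  show "comm (sq_gen S_t20) (sq_gen (S_T10 X)) = 0" using r[OF S2_T[of 2 0 1 0 X]] by (simp add: ev evn t T0 T1[unfolded One_nat_def])
  show "comm (sq_gen S_t02) (sq_gen (S_T10 X)) = - 2 * sq_gen (S_T0 1 X)" using r[OF S2_T[of 0 2 1 0 X]] by (simp add: ev evn t T0 T1[unfolded One_nat_def])
  show "comm (sq_gen (S_T10 X)) (sq_gen (S_T0 n Y)) =
    sq_scal (of_base (cst (1 / of_nat (2 * n + 2)))) * comm (sq_gen S_t20) (sq_gen (S_T0 (n + 1) (mcomm X Y)))
    - sq_scal (of_base (eps3 TYPE('k) * cst (of_nat n / 2))) * sq_gen (S_T0 (n - 1) (macomm X Y))
    - sq_scal (of_base (of_nat n * eps1 * cst (trace Y))) * sq_gen (S_T0 (n - 1) X)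
    + sq_scal (of_base eps1) * (\<Sum>m<n. sq_scal (of_base (cst (of_nat (m + 1) / of_nat (n + 1)))) *
        tens (\<lambda>c. sq_scal (of_base (cst c))) (\<lambda>X. sq_gen (S_T0 m X)) (\<lambda>X. sq_gen (S_T0 (n - 1 - m) X)) (kron (mcomm X Y) (mat 1) ** Omega))
    + sq_scal (of_base eps1) * (\<Sum>m<n.
        tens (\<lambda>c. sq_scal (of_base (cst c))) (\<lambda>X. sq_gen (S_T0 m X)) (\<lambda>X. sq_gen (S_T0 (n - 1 - m) X))
          ((kron X Y - kron (X ** Y) (mat 1)) ** Omega))"
    using r[OF S3[of X n Y]] by (simp only: ev t T0 T1)
qed

section \<open>The induced homomorphism on the localisation\<close>

context
  fixes \<sigma> :: "'k::finite laurent \<Rightarrow> 'b::ring_1" and T t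
  assumes s: "structure_map \<sigma>" and d: "dca_alg (\<lambda>p. \<sigma> (of_base p)) (T :: nat \<Rightarrow> nat \<Rightarrow> complex^'k^'k \<Rightarrow> 'b) t"
begin
interpretation B: dca_alg "\<lambda>p. \<sigma> (of_base p)" T t by (rule d)
definition "psi0 a = free_eval (\<lambda>p. \<sigma> (of_base p)) B.gval (rep_dca a)"
lemma psi0_abs: "psi0 (abs_dca f) = free_eval (\<lambda>p. \<sigma> (of_base p)) B.gval f"
proof -
  have "abs_dca (rep_dca (abs_dca f)) = abs_dca f" by (rule Quotient_abs_rep[OF Quotient_dca])
  then have "rep_dca (abs_dca f) - f \<in> ideal_of dca_rel" unfolding dca.abs_eq_iff .
  then have "free_eval (\<lambda>p. \<sigma> (of_base p)) B.gval (rep_dca (abs_dca f) - f) = 0"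
    using ideal_of_killed[OF B.sm, of dca_rel B.gval, OF B.rel_killed] by blast
  then show ?thesis unfolding psi0_def free_eval_diff[OF B.sm] by simp
qed
lemma psi0: "psi0 (a + b) = psi0 a + psi0 b" "psi0 (a * b) = psi0 a * psi0 b" "psi0 (dca_scal p) = \<sigma> (of_base p)"
  "psi0 (dca_T n m X) = T n m X" "psi0 (dca_t n m) = t n m"
proof -
  have "\<exists>f. a = abs_dca f" "\<exists>g. b = abs_dca g"
    by (induct a rule: dca.abs_induct, blast, induct b rule: dca.abs_induct, blast)
  then obtain f g where ab: "a = abs_dca f" "b = abs_dca g" by blast
  show "psi0 (a + b) = psi0 a + psi0 b" "psi0 (a * b) = psi0 a * psi0 b"
    unfolding ab plus_dca.abs_eq times_dca.abs_eq psi0_abs free_evals[OF B.sm] by (rule refl)+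
  show "psi0 (dca_scal p) = \<sigma> (of_base p)" "psi0 (dca_T n m X) = T n m X" "psi0 (dca_t n m) = t n m"
    unfolding dca_scal.abs_eq dca_T.abs_eq dca_t.abs_eq psi0_abs free_evals[OF B.sm] B.gval_def dgen.case by (rule refl)+
qed
lemma sig: "\<sigma> (x + y) = \<sigma> x + \<sigma> y" "\<sigma> (x * y) = \<sigma> x * \<sigma> y" "\<sigma> 1 = 1" "\<sigma> x * z = z * \<sigma> x"
  using s unfolding structure_map_def by blast+
lemma sig_left: "z * (\<sigma> x * v) = \<sigma> x * (z * v)"
  unfolding mult.assoc[symmetric] sig(4)[of x z, symmetric] ..
lemma psi0_smult: "psi0 (p *A a) = \<sigma> (of_base p) * psi0 a" unfolding dca_smult_def psi0 ..

definition "Psi x = (THE y. \<exists>a d. x = loc_frac a d \<and> y = \<sigma> (lfrac 1 d) * psi0 a)"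
lemma inv_den: "lfrac 1 d * of_base (den TYPE('k) d) = (1 :: 'k laurent)"
  "lfrac 1 (d + e) = (lfrac 1 d * lfrac 1 e :: 'k laurent)" "lfrac p d = (of_base p * lfrac 1 d :: 'k laurent)"
  unfolding of_base_def lfrac_arith(2) lfrac_arith(3)[symmetric] lfrac_eq_iff by (simp_all add: den_add)
text \<open>Independence of the chosen fraction: denominators have invertible images under the
  structure map, so the common factor in the equality of two fractions can be cancelled.\<close>

lemma Psi_frac: "Psi (loc_frac a d) = \<sigma> (lfrac 1 d) * psi0 a"
  unfolding Psi_def
proof (rule the_equality)
  fix y assume "\<exists>b e. loc_frac a d = loc_frac b e \<and> y = \<sigma> (lfrac 1 e) * psi0 b"
  then obtain b e where eq: "loc_frac a d = loc_frac b e" and y: "y = \<sigma> (lfrac 1 e) * psi0 b" by blast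
  let ?D = "den TYPE('k)"
  from eq obtain u where "?D u *A ?D e *A a = ?D u *A ?D d *A b" unfolding loc_frac_eq_iff by blast
  then have h: "\<sigma> (of_base (?D u)) * (\<sigma> (of_base (?D e)) * psi0 a) = \<sigma> (of_base (?D u)) * (\<sigma> (of_base (?D d)) * psi0 b)"
    unfolding psi0_smult[symmetric] by (rule arg_cong)
  have c: "\<sigma> (lfrac 1 v) * (\<sigma> (of_base (?D v)) * z) = z" for v z
    unfolding mult.assoc[symmetric] sig(2)[symmetric] inv_den(1) sig(3) by simp
  have h1: "\<sigma> (of_base (?D e)) * psi0 a = \<sigma> (of_base (?D d)) * psi0 b"
    using arg_cong[OF h, of "\<lambda>z. \<sigma> (lfrac 1 u) * z"] unfolding c .
  have "\<sigma> (lfrac 1 d) * psi0 a = \<sigma> (lfrac 1 d) * (\<sigma> (lfrac 1 e) * (\<sigma> (of_base (?D e)) * psi0 a))" unfolding c ..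
  also have "\<dots> = \<sigma> (lfrac 1 e) * (\<sigma> (lfrac 1 d) * (\<sigma> (of_base (?D d)) * psi0 b))" unfolding h1 by (rule sig_left)
  finally show "y = \<sigma> (lfrac 1 d) * psi0 a" unfolding y c by (rule sym)
qed blast

lemma Psi_hom: "Psi (x + y) = Psi x + Psi y" "Psi (x * y) = Psi x * Psi y" "Psi (loc_scal c) = \<sigma> c"
proof -
  obtain a d b e p f where xy: "x = loc_frac a d" "y = loc_frac b e" "c = lfrac p f"
    by (metis loc_frac_cases lfrac_cases)
  let ?D = "den TYPE('k)"
  have c: "\<sigma> (lfrac 1 v) * (\<sigma> (of_base (?D v)) * z) = z" for v z
    unfolding mult.assoc[symmetric] sig(2)[symmetric] inv_den(1) sig(3) by simp
  show "Psi (x + y) = Psi x + Psi y"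
    unfolding xy loc_frac_arith Psi_frac psi0 psi0_smult inv_den(2) sig(2) distrib_left
    unfolding mult.assoc c sig_left[of "\<sigma> (lfrac 1 d)" "lfrac 1 e"] c ..
  show "Psi (x * y) = Psi x * Psi y"
    unfolding xy loc_frac_arith Psi_frac psi0 inv_den(2) sig(2) mult.assoc sig_left[of "psi0 a"] ..
  show "Psi (loc_scal c) = \<sigma> c"
    unfolding xy loc_scal_lfrac Psi_frac psi0 unfolding inv_den(3)[of p f] sig(2) by (rule sig(4))
qed
lemma Psi_LL: "Psi (LL a) = psi0 a" using Psi_frac[of a 0] sig(3) by (simp add: lfrac_arith)
end

theorem theorem4:
  assumes "CARD('k::finite) > 1"
  shows "presented_by (loc_scal :: 'k laurent \<Rightarrow> 'k dca_loc) sgen_val small_rel"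
proof -
  interpret S: small_alg "sq_scal :: 'k laurent \<Rightarrow> 'k sq" "\<lambda>n X. sq_gen (S_T0 n X)" "\<lambda>X. sq_gen (S_T10 X)" "sq_gen S_t20" "sq_gen S_t11" "sq_gen S_t02"
    by (rule small_alg_sq[OF assms])
  note sd = structure_map_sq_scal S.big
  define \<Psi> where "\<Psi> = Psi sq_scal S.TT S.tt"
  \<comment> \<open>The quotient map factors through evaluation in the localisation, since both
    homomorphisms agree on generators. Whatever evaluates to 0 is therefore in the ideal.\<close>
  have "abs_sq f = \<Psi> (free_eval loc_scal sgen_val f)" for f :: "('k sgen, 'k laurent) falg"
  proof -
    have "\<Psi> (free_eval loc_scal sgen_val f) = free_eval sq_scal sq_gen f"
    proof (rule falg_hom_unique)
      fix g :: "'k sgen"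
      show "\<Psi> (free_eval loc_scal sgen_val (gen g)) = sq_gen g"
        unfolding free_eval_gen[OF structure_map_loc_scal] \<Psi>_def
        by (cases g) (simp_all only: sgen_val.simps Psi_LL[OF sd] psi0[OF sd] S.T1_eq[symmetric] S.TT_0 S.tt_20 S.tt_11 S.tt_02)
      show "sq_scal 1 = (1 :: 'k sq)" by (rule S.i_1)
    qed (simp_all only: free_eval_simps[OF structure_map_loc_scal] \<Psi>_def Psi_hom[OF sd])
    then show ?thesis unfolding abs_sq_eval by simp
  qed
  moreover have "\<Psi> 0 = 0" using Psi_hom(1)[OF sd, of 0 0] unfolding \<Psi>_def by simp
  ultimately have "free_eval loc_scal sgen_val f = 0 \<Longrightarrow> f \<in> ideal_of small_rel" for f :: "('k sgen, 'k laurent) falg"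
    unfolding abs_sq_0[symmetric] by simp
  then show ?thesis
    unfolding presented_by_def using structure_map_loc_scal surj_small small_ideal_killed by blast
qed

end
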